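(* Let $\lambda/\mu$ be a skew partition, let $\alpha,\beta$ be normal or skew partitions (possibly empty), and let $l_0,l_1$ be positive integers (where, if $\alpha=\emptyset$, one takes $l_0=0$, and if $\beta=\emptyset$, one takes $l_1=0$), such that: $D(\alpha)$ has at least $l_0$ boxes in its right-most column; $D(\beta)$ has at least $l_1$ boxes in its bottom row; the left-arm $A_l(\lambda/\mu)$ has at least $l_0$ boxes and the right-arm $A_r(\lambda/\mu)$ has at least $l_1$ boxes. Let $\mathbf{v}=(v_{ij})\in T(\lambda/\mu,\mathbb{C})$, $\mathbf{a}=(a_{ij})\in T(\alpha,\mathbb{C})$, $\mathbf{b}=(b_{ij})\in T(\beta,\mathbb{C})$ be tableaux of variables. Assume that the real parts of the variables $v_{1j}$ with $\min\{\lambda_2,\sum_{i\ge2}(\lambda_i-\mu_i)\}+\mu_1\le j\le\lambda_1-1$, of the variables $v_{i1}$ with $\min\{\lambda'_2,\sum_{j\ge2}(\lambda'_j-\mu'_j)\}+\mu'_1\le i\le\lambda'_1-1$, and of those $a_{ij},b_{ij}$ which are not in a corner of $[\alpha|_{l_0}\lambda/\mu|_{l_1}\beta]$ are greater than or equal to $1$, and that the real parts of all other variables are greater than $1$. Let $\mathcal{G}(\lambda/\mu)$ be the set of all partitions $\nu$ with $c_{\mu\nu}^\lambda>0$. Then for every choice of a family $(\mathbf{u}_\nu(\mathbf{v})\in U_\nu(\mathbf{v}))_{\nu\in\mathcal{G}(\lambda/\mu)}$, $$\sum_{\mathrm{Sym}(B(\mathbf{v}))}\zeta_{[\alpha|_{l_0}\lambda/\mu|_{l_1}\beta]}\big([\mathbf{a}|_{l_0}\mathbf{v}|_{l_1}\mathbf{b}]\big)=\sum_{\mathrm{Sym}(B(\mathbf{v}))}\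 \sum_{\nu\in\mathcal{G}(\lambda/\mu)}c_{\mu\nu}^{\lambda}\,\zeta_{[\alpha|_{l_0}\nu|_{l_1}\beta]}\big([\mathbf{a}|_{l_0}\mathbf{u}_\nu(\mathbf{v})|_{l_1}\mathbf{b}]\big).$$
   Context: **Partitions, diagrams, tableaux.** A partition $\lambda=(\lambda_1\ge\lambda_2\ge\cdots)$ has Young diagram $D(\lambda)=\{(i,j): 1\le j\le\lambda_i\}$ (row $i$, column $j$; rows numbered downwards; $\lambda_i=0$ beyond the last part). $\lambda'$ is the conjugate: $\lambda'_j=\#\{i:\lambda_i\ge j\}$. A skew partition $\delta=\lambda/\mu$ ($\mu_i\le\lambda_i$ for all $i$; $\mu=\emptyset$ allowed) has diagram $D(\lambda/\mu)=D(\lambda)\setminus D(\mu)$; a "normal" shape is one with $\mu=\emptyset$. $T(\delta,X)$ is the set of fillings of $D(\delta)$ by elements of $X$. $\mathrm{SSYT}(\delta)$ is the set of semi-standard Young tableaux of shape $\delta$: fillings by positive integers, rows weakly increasing left to right, columns strictly increasing top to bottom. Semi-standard tableaux over any other totally ordered set are defined in the same way. **Schur multiple zeta function.** For $\mathbf{s}=(s_{ij})\in T(\delta,\mathbb{C})$, $\zeta_\delta(\mathbf{s})=\sum_{M\in\mathrm{SSYT}(\delta)}\prod_{(i,j)\in D(\delta)}m_{ij}^{-s_{ij}}$, where $M=(m_{ij})$. It converges absolutely if $\Re(s_{ij})\ge1$ for all boxes and $\Re(s_{ij})>1$ at all corners; a corner of $\delta$ is a box $(i,j)\in D(\delta)$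 with $(i+1,j),(i,j+1)\notin D(\delta)$. **Littlewood–Richardson coefficients.** $c_{\mu\nu}^\lambda$ is defined by $s_\mu s_\nu=\sum_\lambda c_{\mu\nu}^\lambda s_\lambda$ for Schur functions. **Arms and body.** With $m=\min\{\lambda_2,\sum_{i\ge2}(\lambda_i-\mu_i)\}$ and $n=\min\{\lambda'_2,\sum_{j\ge2}(\lambda'_j-\mu'_j)\}$, the right-arm $A_r(\lambda/\mu)$ consists of the boxes $(1,j)\in D(\lambda/\mu)$ with $m+\mu_1\le j\le\lambda_1$, the left-arm $A_l(\lambda/\mu)$ consists of the boxes $(i,1)\in D(\lambda/\mu)$ with $n+\mu'_1\le i\le\lambda'_1$ (either may be empty), and the body $B(\lambda/\mu)$ is what remains of $D(\lambda/\mu)$ after removing both arms. For a filling $\mathbf{v}$ of $\lambda/\mu$, $B(\mathbf{v})$ is the restriction of $\mathbf{v}$ to $B(\lambda/\mu)$. **Pasting.** Let $\alpha,\beta,\delta$ be normal or skew partitions such that $D(\alpha)$ has at least $l_0$ boxes in its right-most column, $D(\beta)$ has at least $l_1$ boxes in its bottom row, and $D(\delta)$ has at least $l_0$ boxes in its left-most column and at least $l_1$ boxes in its top row. The skew shape $[\alpha|_{l_0}\delta|_{l_1}\beta]$ is obtained by translating the diagrams so that (1) the right edges of the highest $l_0$ contiguous boxes of the right-most column of $D(\alpha)$ are glued, in order, to the left edges of the lowest $l_0$ contiguous boxes of the left-most column of $D(\delta)$, and (2) the bottom edges of the left-most $l_1$ contiguous boxes of the bottom row of $D(\beta)$ are glued,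 in order, to the top edges of the right-most $l_1$ contiguous boxes of the top row of $D(\delta)$. If $\alpha=\emptyset$ (with $l_0=0$) or $\beta=\emptyset$ (with $l_1=0$), the corresponding gluing is omitted. For fillings $P,T,Q$ of $\alpha,\delta,\beta$, the filling $[P|_{l_0}T|_{l_1}Q]$ of $[\alpha|_{l_0}\delta|_{l_1}\beta]$ is obtained by the same gluing, keeping all entries. (Under the hypotheses of the theorem, both $\delta=\lambda/\mu$ and $\delta=\nu$ with $\nu\in\mathcal{G}(\lambda/\mu)$ are admissible.) **Rectification.** The row-word $w_{row}(L)$ of a tableau $L$ is obtained by reading rows from bottom to top, each from left to right. Knuth equivalence of words over a totally ordered set is the equivalence relation generated by $u\,bca\,v\sim u\,bac\,v$ for $a<b\le c$ and $u\,acb\,v\sim u\,cab\,v$ for $a\le b<c$. For a (skew) semi-standard tableau $L$, $\mathrm{Rect}(L)$ is the unique semi-standard tableau of normal shape whose row-word is Knuth equivalent to $w_{row}(L)$ (equivalently, the result of jeu de taquin on $L$). **Labeling.** $\tilde{\mathbb{N}}=\{k_l: k,l\ge1\}$ is totally ordered by $1_1<1_2<\cdots<2_1<2_2<\cdots<3_1<\cdots$. For $L\in \mathrm{SSYT}(\delta)$, $\phi_T(L)$ is the semi-standard tableau over $\tilde{\mathbb{N}}$ obtained by giving, for each $k$, the entries equal to $k$ the subscripts $1,2,\dots$ in the order in which they occur reading rows from bottom to top and each row from left to right. Entries of $\phi_T(L)$ are pairwise distinct. **$\mathbf{v}_L$ and $U_\nu(\mathbf{v})$.** Let $L\in \mathrm{SSYT}(\lambda/\mu)$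 and let $\nu$ be the shape of $\mathrm{Rect}(L)$ (which equals the shape of $\mathrm{Rect}(\phi_T(L))$). Let $\rho_L:D(\lambda/\mu)\to D(\nu)$ be the bijection sending a box to the box of $\mathrm{Rect}(\phi_T(L))$ containing the same element of $\tilde{\mathbb{N}}$ that the original box contains in $\phi_T(L)$. Then $\mathbf{v}_L\in T(\nu,\mathbb{C})$ is the tableau whose entry in box $\rho_L(i,j)$ is $v_{ij}$. Put $U_\nu(\mathbf{v})=\{\mathbf{v}_L : L\in \mathrm{SSYT}(\lambda/\mu),\ \mathrm{Rect}(L)\text{ has shape }\nu\}$; it is non-empty for $\nu\in\mathcal{G}(\lambda/\mu)$. **Symmetrization.** $\sum_{\mathrm{Sym}(B(\mathbf{v}))}F$ means the sum, over all permutations $\sigma$ of the set of variables in $B(\mathbf{v})$, of the expression obtained from $F$ by substituting $\sigma(x)$ for each such variable $x$ (all other variables being fixed). In particular $\mathbf{u}_\nu(\mathbf{v})=\mathbf{v}_{L_\nu}$ is a fixed arrangement of the variables (with $L_\nu$ fixed) and $\sigma$ acts on the variables in it. *)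

theory Defs
  imports "HOL-Analysis.Analysis" "HOL-Library.Multiset"
begin

section \<open>Partitions and diagrams\<close>

text \<open>A partition is the list of its positive parts; parts are numbered from 1 and vanish beyond
  the end of the list. Boxes are (row, column) with integer coordinates, so that diagrams can be
  translated freely.\<close>

type_synonym box = "int \<times> int"

definition is_partition :: "nat list \<Rightarrow> bool" where
  "is_partition lam \<longleftrightarrow> sorted_wrt (\<ge>) lam \<and> 0 \<notin> set lam"

definition part :: "nat list \<Rightarrow> nat \<Rightarrow> nat" where
  "part lam i = (if 1 \<le> i \<and> i \<le> length lam then lam ! (i - 1) else 0)"

definition young :: "nat list \<Rightarrow> box set" where
  "young lam = {(int i, int j) | i j. 1 \<le> i \<and> 1 \<le> j \<and> j \<le> part lam i}"

definition conjugate :: "nat list \<Rightarrow> nat list" where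
  "conjugate lam = map (\<lambda>j. card {i. 1 \<le> i \<and> j \<le> part lam i}) [1..<Suc (part lam 1)]"

text \<open>A skew partition \<open>lam/mu\<close> is the pair \<open>(lam, mu)\<close>; a normal shape \<open>nu\<close> is \<open>(nu, [])\<close>.\<close>

type_synonym skew = "nat list \<times> nat list"

definition is_skew :: "skew \<Rightarrow> bool" where
  "is_skew d \<longleftrightarrow> is_partition (fst d) \<and> is_partition (snd d) \<and>
     (\<forall>i\<ge>1. part (snd d) i \<le> part (fst d) i)"

definition diagram :: "skew \<Rightarrow> box set" where
  "diagram d = young (fst d) - young (snd d)"

definition corners :: "box set \<Rightarrow> box set" where
  "corners D = {(i, j) \<in> D. (i + 1, j) \<notin> D \<and> (i, j + 1) \<notin> D}"

section \<open>Semi-standard tableaux and the Schur multiple zeta function\<close>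

text \<open>Fillings of \<open>D\<close> by elements of \<open>X\<close> are the extensional functions \<open>D \<rightarrow>\<^sub>E X\<close>, so that a
  filling is determined by its entries. On skew diagrams, comparing all pairs of boxes
  in a row (column) is the same as comparing adjacent ones.\<close>

definition SSYT :: "box set \<Rightarrow> 'a::linorder set \<Rightarrow> (box \<Rightarrow> 'a) set" where
  "SSYT D X = {M \<in> D \<rightarrow>\<^sub>E X.
     (\<forall>i j j'. (i, j) \<in> D \<and> (i, j') \<in> D \<and> j < j' \<longrightarrow> M (i, j) \<le> M (i, j')) \<and>
     (\<forall>i i' j. (i, j) \<in> D \<and> (i', j) \<in> D \<and> i < i' \<longrightarrow> M (i, j) < M (i', j))}"

definition schur_zeta :: "box set \<Rightarrow> (box \<Rightarrow> complex) \<Rightarrow> complex" where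
  "schur_zeta D s = (\<Sum>\<^sub>\<infinity>M\<in>SSYT D {1::nat..}. \<Prod>x\<in>D. of_nat (M x) powr (- s x))"

section \<open>Schur functions and Littlewood--Richardson coefficients\<close>

text \<open>A power series in the variables \<open>x\<^sub>1, x\<^sub>2, \<dots>\<close> with integer coefficients is its coefficient
  function on monomials, a monomial being the finite multiset of the indices of its variables.\<close>

definition schur_function :: "nat list \<Rightarrow> nat multiset \<Rightarrow> int" where
  "schur_function lam w = int (card {M \<in> SSYT (young lam) {1..}.
     image_mset M (mset_set (young lam)) = w})"

definition series_mult ::
  "(nat multiset \<Rightarrow> int) \<Rightarrow> (nat multiset \<Rightarrow> int) \<Rightarrow> nat multiset \<Rightarrow> int" where
  "series_mult f g w = (\<Sum>(p, q) | p + q = w. f p * g q)"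

text \<open>\<open>lr_coeff mu nu lam\<close> is the coefficient \<open>c\<^bsub>mu,nu\<^esub>\<^bsup>lam\<^esup>\<close>: the function \<open>c\<close> below is unique because
  Schur functions are linearly independent.\<close>

definition lr_coeff :: "nat list \<Rightarrow> nat list \<Rightarrow> nat list \<Rightarrow> int" where
  "lr_coeff mu nu = (THE c. finite {lam. c lam \<noteq> 0} \<and> (\<forall>lam. c lam \<noteq> 0 \<longrightarrow> is_partition lam) \<and>
     series_mult (schur_function mu) (schur_function nu) =
       (\<lambda>w. \<Sum>lam | c lam \<noteq> 0. c lam * schur_function lam w))"

definition lr_set :: "skew \<Rightarrow> nat list set" where
  "lr_set d = {nu. is_partition nu \<and> lr_coeff (snd d) nu (fst d) > 0}"

section \<open>Arms and body\<close>

text \<open>\<open>arm_bound (lam, mu)\<close> is the number \<open>m\<close> for the right-arm; the number \<open>n\<close> for the left-arm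
  is the same expression for the conjugate shape.\<close>

definition arm_bound :: "skew \<Rightarrow> nat" where
  "arm_bound d = min (part (fst d) 2) (\<Sum>i=2..length (fst d). part (fst d) i - part (snd d) i)"

definition conjugate_skew :: "skew \<Rightarrow> skew" where
  "conjugate_skew d = (conjugate (fst d), conjugate (snd d))"

definition right_arm :: "skew \<Rightarrow> box set" where
  "right_arm d = {(i, j) \<in> diagram d. i = 1 \<and>
     int (arm_bound d + part (snd d) 1) \<le> j \<and> j \<le> int (part (fst d) 1)}"

definition left_arm :: "skew \<Rightarrow> box set" where
  "left_arm d = {(i, j) \<in> diagram d. j = 1 \<and>
     int (arm_bound (conjugate_skew d) + part (conjugate (snd d)) 1) \<le> i \<and>
     i \<le> int (part (conjugate (fst d)) 1)}"

definition body :: "skew \<Rightarrow> box set" where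
  "body d = diagram d - right_arm d - left_arm d"

section \<open>Pasting\<close>

definition top_row :: "box set \<Rightarrow> box set" where
  "top_row D = {x \<in> D. fst x = Min (fst ` D)}"

definition bottom_row :: "box set \<Rightarrow> box set" where
  "bottom_row D = {x \<in> D. fst x = Max (fst ` D)}"

definition left_column :: "box set \<Rightarrow> box set" where
  "left_column D = {x \<in> D. snd x = Min (snd ` D)}"

definition right_column :: "box set \<Rightarrow> box set" where
  "right_column D = {x \<in> D. snd x = Max (snd ` D)}"

text \<open>The pasted diagram keeps the middle diagram \<open>D\<close> in place. Diagram \<open>A\<close> is translated so that
  the highest box of its right-most column becomes the left neighbour of the \<open>l0\<close>-th box from below
  in the left-most column of \<open>D\<close>; \<open>B\<close> is translated so that the left-most box of its bottom row
  becomes the upper neighbour of the \<open>l1\<close>-th box from the right in the top row of \<open>D\<close>.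
  If \<open>A\<close> (or \<open>B\<close>) is empty the value of the translation vector is irrelevant.\<close>

definition left_shift :: "box set \<Rightarrow> nat \<Rightarrow> box set \<Rightarrow> box" where
  "left_shift A l0 D =
     (Max (fst ` left_column D) - int l0 + 1, Min (snd ` D) - 1) -
     (Min (fst ` right_column A), Max (snd ` A))"

definition right_shift :: "box set \<Rightarrow> nat \<Rightarrow> box set \<Rightarrow> box" where
  "right_shift D l1 B =
     (Min (fst ` D) - 1, Max (snd ` top_row D) - int l1 + 1) -
     (Max (fst ` B), Min (snd ` bottom_row B))"

definition paste :: "box set \<Rightarrow> nat \<Rightarrow> box set \<Rightarrow> nat \<Rightarrow> box set \<Rightarrow> box set" where
  "paste A l0 D l1 B = (+) (left_shift A l0 D) ` A \<union> D \<union> (+) (right_shift D l1 B) ` B"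

definition paste_filling ::
  "box set \<Rightarrow> (box \<Rightarrow> 'a) \<Rightarrow> nat \<Rightarrow> box set \<Rightarrow> (box \<Rightarrow> 'a) \<Rightarrow> nat \<Rightarrow> box set \<Rightarrow> (box \<Rightarrow> 'a) \<Rightarrow> box \<Rightarrow> 'a"
where
  "paste_filling A P l0 D T l1 B Q = (\<lambda>x \<in> paste A l0 D l1 B.
     if x \<in> D then T x
     else if x - left_shift A l0 D \<in> A then P (x - left_shift A l0 D)
     else Q (x - right_shift D l1 B))"

section \<open>Rectification\<close>

definition row_word :: "box set \<Rightarrow> (box \<Rightarrow> 'a) \<Rightarrow> 'a list" where
  "row_word D L = concat (map (\<lambda>i. map (\<lambda>j. L (i, j)) (sorted_list_of_set {j. (i, j) \<in> D}))
     (rev (sorted_list_of_set (fst ` D))))"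

inductive knuth_step :: "'a::linorder list \<Rightarrow> 'a list \<Rightarrow> bool" where
  "a < b \<Longrightarrow> b \<le> c \<Longrightarrow> knuth_step (u @ [b, c, a] @ v) (u @ [b, a, c] @ v)"
| "a \<le> b \<Longrightarrow> b < c \<Longrightarrow> knuth_step (u @ [a, c, b] @ v) (u @ [c, a, b] @ v)"

definition knuth_equiv :: "'a::linorder list \<Rightarrow> 'a list \<Rightarrow> bool" where
  "knuth_equiv = equivclp knuth_step"

text \<open>The rectification of the tableau \<open>L\<close> on \<open>D\<close>, given as its shape together with its filling.\<close>

definition Rect :: "box set \<Rightarrow> (box \<Rightarrow> 'a::linorder) \<Rightarrow> nat list \<times> (box \<Rightarrow> 'a)" where
  "Rect D L = (THE (nu, R). is_partition nu \<and> R \<in> SSYT (young nu) UNIV \<and>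
     knuth_equiv (row_word (young nu) R) (row_word D L))"

section \<open>Labeling\<close>

text \<open>\<open>Lab k l\<close> is the letter \<open>k\<^sub>l\<close>; letters are ordered lexicographically. (The order on pairs is
  not used because \<open>HOL-Analysis\<close> equips products with the componentwise order.)\<close>

datatype label = Lab nat nat

instantiation label :: linorder
begin

fun less_eq_label :: "label \<Rightarrow> label \<Rightarrow> bool" where
  "Lab k l \<le> Lab k' l' \<longleftrightarrow> k < k' \<or> k = k' \<and> l \<le> l'"

fun less_label :: "label \<Rightarrow> label \<Rightarrow> bool" where
  "Lab k l < Lab k' l' \<longleftrightarrow> k < k' \<or> k = k' \<and> l < l'"

instance
proof
  fix x y z :: label
  show "x < y \<longleftrightarrow> x \<le> y \<and> \<not> y \<le> x" by (cases x; cases y) auto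
  show "x \<le> x" by (cases x) auto
  show "x \<le> y \<Longrightarrow> y \<le> z \<Longrightarrow> x \<le> z" by (cases x; cases y; cases z) auto
  show "x \<le> y \<Longrightarrow> y \<le> x \<Longrightarrow> x = y" by (cases x; cases y) auto
  show "x \<le> y \<or> y \<le> x" by (cases x; cases y) auto
qed

end

definition phi_T :: "box set \<Rightarrow> (box \<Rightarrow> nat) \<Rightarrow> box \<Rightarrow> label" where
  "phi_T D L = (\<lambda>(i, j) \<in> D. Lab (L (i, j))
     (card {(i', j') \<in> D. L (i', j') = L (i, j) \<and> (i < i' \<or> i' = i \<and> j' \<le> j)}))"

definition rho :: "box set \<Rightarrow> (box \<Rightarrow> nat) \<Rightarrow> box \<Rightarrow> box" where
  "rho D L x = (case Rect D (phi_T D L) of (nu, R) \<Rightarrow> (THE y. y \<in> young nu \<and> R y = phi_T D L x))"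

text \<open>The rearrangement \<open>v\<^sub>L\<close>: its entry in box \<open>rho D L x\<close> is \<open>v x\<close>.\<close>

definition rearrange :: "box set \<Rightarrow> (box \<Rightarrow> nat) \<Rightarrow> (box \<Rightarrow> 'a) \<Rightarrow> box \<Rightarrow> 'a" where
  "rearrange D L v = (\<lambda>y \<in> young (fst (Rect D L)). v (inv_into D (rho D L) y))"

text \<open>Elements of \<open>U d nu\<close> are arrangements of formal variables, that is the maps \<open>v \<mapsto> v\<^sub>L\<close>, rather than
  tableaux of numbers, so that variables can be substituted in them.\<close>

definition U :: "skew \<Rightarrow> nat list \<Rightarrow> ((box \<Rightarrow> 'a) \<Rightarrow> box \<Rightarrow> 'a) set" where
  "U d nu = {rearrange (diagram d) L | L. L \<in> SSYT (diagram d) {1..} \<and> fst (Rect (diagram d) L) = nu}"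

section \<open>Symmetrization\<close>

text \<open>The sum over all permutations \<open>\<sigma>\<close> of the variables \<open>v x\<close>, \<open>x \<in> X\<close>, where the variable \<open>v x\<close> is
  replaced by \<open>v (\<sigma> x)\<close> and all other variables are fixed.\<close>

definition sym_sum :: "box set \<Rightarrow> ((box \<Rightarrow> 'a) \<Rightarrow> complex) \<Rightarrow> (box \<Rightarrow> 'a) \<Rightarrow> complex" where
  "sym_sum X F v = (\<Sum>\<sigma> | \<sigma> permutes X. F (v \<circ> \<sigma>))"

end

theory Submission
  imports Defs "HOL-Library.Sublist"
begin

text \<open>Crystal raising operators commute with Knuth moves. Hence every rectification of shape \<open>\<nu>\<close>
  is attained by the same number of tableaux of shape \<open>\<lambda>/\<mu>\<close>, namely by the number of tableaux of
  content \<open>\<nu>\<close> whose row word is Yamanouchi. Transposing the matrix of multiplicities of the letters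
  in the rows exchanges the Yamanouchi condition with column strictness, which identifies this
  number with the number of \<open>\<mu>\<close>-dominant tableaux of shape \<open>\<nu>\<close> and content \<open>\<lambda> - \<mu>\<close>, that is, with
  the Littlewood--Richardson coefficient.

  The lengths of longest increasing and decreasing subwords of the word of a tableau show that
  rectification carries the two arms to the ends of the first row and of the first column, whatever
  the tableau is. Therefore the gluing conditions along the arms do not change under rectification,
  and two bijections onto the same rectified shape differ by a permutation of the body, which the
  symmetrization absorbs. The identity follows by regrouping the absolutely convergent sum over
  the fibres of rectification.\<close>

section \<open>Bracketing and crystal operators on words\<close>

text \<open>\<open>Rect\<close> is a definite description, so existence and uniqueness of the
  rectified tableau have to be proved; neither insertion nor sliding is used for this. Every word
  can be raised to a Yamanouchi word, Yamanouchi words of equal content form a single Knuth class,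
  and a normal shape carries exactly one Yamanouchi filling. As raising is injective, these facts
  descend again to arbitrary words. \<open>lr_coeff\<close> is a structure constant, so counting
  tableaux does not reach it directly. Two tableaux are set side by side in one disconnected skew
  shape, whose tableaux are counted by the product of two Schur functions, and linear independence
  then identifies the coefficients. The number in the definition of the right-arm bounds the columns
  that meet the diagram below its first row. An increasing chain whose largest entry lies below the
  first row stays below it, hence has at most that many boxes; a first row that already offers as
  many smaller entries cannot be beaten. This is why the larger entries beyond this point all stay
  in the first row. The left-arm is the same phenomenon for decreasing chains and rows.\<close>

primrec phi :: "nat \<Rightarrow> nat list \<Rightarrow> nat" where
  "phi i [] = 0"
| "phi i (x # w) = (if x = i then Suc (phi i w) else if x = Suc i then phi i w - 1 else phi i w)"

text \<open>Read \<open>Suc i\<close> as an opening and \<open>i\<close> as a closing bracket. Then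
  \<open>eps i\<close> counts the unmatched openings and \<open>phi i\<close> the unmatched
  closings; after cancellation there remains a block of \<open>i\<close> followed by a block of
  \<open>Suc i\<close>. Thus \<open>eps i w = 0\<close> means that every suffix of \<open>w\<close>
  has at least as many \<open>i\<close> as \<open>Suc i\<close>.\<close>

primrec eps :: "nat \<Rightarrow> nat list \<Rightarrow> nat" where
  "eps i [] = 0"
| "eps i (x # w) = (if x = Suc i then eps i w + (1 - phi i w) else eps i w)"

text \<open>Only survivors interact: the openings left over in \<open>u\<close> meet the closings
  left over in \<open>v\<close>.\<close>

lemma phi_append: "phi i (u @ v) = phi i u + (phi i v - eps i u)"
  by (induction u) auto

lemma eps_append: "eps i (u @ v) = eps i v + (eps i u - phi i v)"
  by (induction u) (auto simp: phi_append)

text \<open>A matched pair uses one letter of each kind.\<close>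

lemma eps_phi_count: "eps i w + count_list w i = phi i w + count_list w (Suc i)"
  by (induction w) auto

text \<open>The crystal raising operator as a relation: the left-most unmatched \<open>Suc i\<close>
  becomes the right-most unmatched \<open>i\<close>. The same two conditions on \<open>u\<close> and
  \<open>t\<close> describe the letter before and after the change, so the relation is injective for
  the same reason that it is deterministic.\<close>

definition estep :: "nat \<Rightarrow> nat list \<Rightarrow> nat list \<Rightarrow> bool" where
  "estep i w w' \<longleftrightarrow>
     (\<exists>u t. w = u @ Suc i # t \<and> w' = u @ i # t \<and> eps i u = 0 \<and> phi i t = 0)"

lemma estep_exists:
  assumes "eps i w > 0"
  shows "\<exists>w'. estep i w w'"
  using assms
proof (induction w rule: rev_induct)
  case Nil
  then show ?case by simp
next
  case (snoc x w)
  show ?case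
  proof (cases "eps i w = 0")
    case True
    with snoc.prems have "x = Suc i" by (auto simp: eps_append split: if_splits)
    with True have "estep i (w @ [x]) (w @ [i])" unfolding estep_def by force
    then show ?thesis by blast
  next
    case False
    then obtain w' where "estep i w w'" using snoc.IH by blast
    then obtain u t where ut: "w = u @ Suc i # t" "w' = u @ i # t" "eps i u = 0" "phi i t = 0"
      by (auto simp: estep_def)
    \<comment> \<open>Were \<open>x\<close> an unmatched \<open>i\<close> here, it would close the
      only unmatched \<open>Suc i\<close> of \<open>w\<close>, and \<open>eps\<close> of the longer
      word would vanish.\<close>
    have "phi i (t @ [x]) = 0"
      using snoc.prems ut by (auto simp: eps_append phi_append split: if_splits)
    then have "estep i (w @ [x]) (w' @ [x])" unfolding estep_def using ut by fastforce
    then show ?thesis by blast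
  qed
qed

lemma append_Cons_eq_cases:
  assumes "u @ y # t = u' @ y # t'"
  shows "u = u' \<and> t = t' \<or> (\<exists>s. u' = u @ y # s \<and> t = s @ y # t') \<or>
    (\<exists>s. u = u' @ y # s \<and> t' = s @ y # t)"
proof -
  obtain us where "u = u' @ us \<and> us @ y # t = y # t' \<or> u @ us = u' \<and> y # t = us @ y # t'"
    using assms by (auto simp: append_eq_append_conv2)
  then show ?thesis by (cases us) auto
qed

text \<open>If the two letters were distinct, the stretch \<open>s\<close> between them would
  contain no unmatched \<open>i\<close>, by the suffix condition of the left one; but the prefix
  condition of the right one demands that the left \<open>Suc i\<close> be closed within
  \<open>s\<close>.\<close>

lemma estep_deterministic:
  assumes "estep i w w1" "estep i w w2"
  shows "w1 = w2"
proof -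
  obtain u t where 1: "w = u @ Suc i # t" "w1 = u @ i # t" "eps i u = 0" "phi i t = 0"
    using assms(1) by (auto simp: estep_def)
  obtain u' t' where 2: "w = u' @ Suc i # t'" "w2 = u' @ i # t'" "eps i u' = 0" "phi i t' = 0"
    using assms(2) by (auto simp: estep_def)
  have "u @ Suc i # t = u' @ Suc i # t'" using 1 2 by simp
  from append_Cons_eq_cases[OF this] show ?thesis
    using 1 2 by (auto simp: eps_append phi_append)
qed

lemma estep_inj:
  assumes "estep i w1 w" "estep i w2 w"
  shows "w1 = w2"
proof -
  obtain u t where 1: "w1 = u @ Suc i # t" "w = u @ i # t" "eps i u = 0" "phi i t = 0"
    using assms(1) by (auto simp: estep_def)
  obtain u' t' where 2: "w2 = u' @ Suc i # t'" "w = u' @ i # t'" "eps i u' = 0" "phi i t' = 0"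
    using assms(2) by (auto simp: estep_def)
  have "u @ i # t = u' @ i # t'" using 1 2 by simp
  from append_Cons_eq_cases[OF this] show ?thesis
    using 1 2 by (auto simp: eps_append phi_append)
qed

section \<open>Knuth equivalence\<close>

definition knuth_triple :: "'a::linorder list \<Rightarrow> 'a list \<Rightarrow> bool" where
  "knuth_triple p q \<longleftrightarrow> (\<exists>a b c. a < b \<and> b \<le> c \<and>
       (p = [b, c, a] \<and> q = [b, a, c] \<or> q = [b, c, a] \<and> p = [b, a, c])) \<or>
     (\<exists>a b c. a \<le> b \<and> b < c \<and>
       (p = [a, c, b] \<and> q = [c, a, b] \<or> q = [a, c, b] \<and> p = [c, a, b]))"

lemma symclp_knuth_step_iff:
  "symclp knuth_step w w' \<longleftrightarrow> (\<exists>u p q v. w = u @ p @ v \<and> w' = u @ q @ v \<and> knuth_triple p q)"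
proof
  assume "symclp knuth_step w w'"
  then show "\<exists>u p q v. w = u @ p @ v \<and> w' = u @ q @ v \<and> knuth_triple p q"
    unfolding symclp_def knuth_triple_def
    by (elim disjE knuth_step.cases) blast+
next
  assume "\<exists>u p q v. w = u @ p @ v \<and> w' = u @ q @ v \<and> knuth_triple p q"
  then obtain u p q v where eq: "w = u @ p @ v" "w' = u @ q @ v" and "knuth_triple p q" by blast
  then show "symclp knuth_step w w'"
    unfolding symclp_def knuth_triple_def eq
    by (elim disjE exE conjE) (simp; use knuth_step.intros[of _ _ _ u v] in auto)+
qed

text \<open>The step case keeps the equivalence with the initial word, so that its content and its
  set of letters are known at every intermediate word.\<close>

lemma knuth_equiv_induct [consumes 1, case_names refl step]:
  assumes "knuth_equiv w w'" and "P w"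
    and "\<And>u p q v. knuth_equiv w (u @ p @ v) \<Longrightarrow> knuth_triple p q \<Longrightarrow> P (u @ p @ v) \<Longrightarrow> P (u @ q @ v)"
  shows "P w'"
proof -
  have "(symclp knuth_step)\<^sup>*\<^sup>* w w'" using assms(1) by (simp add: knuth_equiv_def equivclp_def)
  then have "knuth_equiv w w' \<and> P w'"
  proof (induction rule: rtranclp_induct)
    case base
    then show ?case by (simp add: assms(2) knuth_equiv_def)
  next
    case (step y z)
    then show ?case
      using assms(3) by (auto simp: symclp_knuth_step_iff)
        (metis equivclp_into_equivclp knuth_equiv_def symclp_def symclp_knuth_step_iff)
  qed
  then show ?thesis ..
qed

lemma knuth_equiv_refl [simp]: "knuth_equiv w w"
  by (simp add: knuth_equiv_def)

lemma knuth_equiv_sym: "knuth_equiv w w' \<Longrightarrow> knuth_equiv w' w"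
  by (simp add: knuth_equiv_def equivclp_sym)

lemma knuth_equiv_trans: "knuth_equiv w w' \<Longrightarrow> knuth_equiv w' w'' \<Longrightarrow> knuth_equiv w w''"
  unfolding knuth_equiv_def by (rule equivclp_trans)

lemma knuth_equiv_triple: "knuth_triple p q \<Longrightarrow> knuth_equiv (u @ p @ v) (u @ q @ v)"
  unfolding knuth_equiv_def equivclp_def by (rule r_into_rtranclp) (auto simp: symclp_knuth_step_iff)

lemma knuth_equiv_append:
  assumes "knuth_equiv w w'"
  shows "knuth_equiv (x @ w @ y) (x @ w' @ y)"
  using assms
proof (induction rule: knuth_equiv_induct)
  case (step u p q v)
  then show ?case
    using knuth_equiv_triple[of p q "x @ u" "v @ y"] knuth_equiv_trans by simp blast
qed simp

lemma knuth_equiv_Cons: "knuth_equiv w w' \<Longrightarrow> knuth_equiv (x # w) (x # w')"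
  using knuth_equiv_append[of w w' "[x]" "[]"] by simp

lemma knuth_equiv_mset: "knuth_equiv w w' \<Longrightarrow> mset w = mset w'"
  by (induction rule: knuth_equiv_induct) (auto simp: knuth_triple_def)

lemma knuth_triple_eps: "knuth_triple p q \<Longrightarrow> eps i p = eps i q \<and> phi i p = phi i q"
  unfolding knuth_triple_def by auto

lemma knuth_equiv_eps: "knuth_equiv w w' \<Longrightarrow> eps i w = eps i w' \<and> phi i w = phi i w'"
  by (induction rule: knuth_equiv_induct) (auto dest: knuth_triple_eps[of _ _ i] simp: eps_append phi_append)

lemma split3_iff:
  "[x, y, z] = p1 @ s # p2 \<longleftrightarrow> (p1 = [] \<and> x = s \<and> p2 = [y, z]) \<or> (p1 = [x] \<and> y = s \<and> p2 = [z]) \<or>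
     (p1 = [x, y] \<and> z = s \<and> p2 = [])"
  by (auto simp: Cons_eq_append_conv)

lemma ex_split3_iff:
  "(\<exists>q1 q2. [x, y, z] = q1 @ s # q2 \<and> P q1 q2) \<longleftrightarrow>
     (x = s \<and> P [] [y, z]) \<or> (y = s \<and> P [x] [z]) \<or> (z = s \<and> P [x, y] [])"
  unfolding split3_iff by blast

lemma knuth_triple_iff:
  "knuth_triple [x, y, z] [x', y', z'] \<longleftrightarrow>
     x = x' \<and> y = z' \<and> z = y' \<and> (y < x \<and> x \<le> z \<or> z < x \<and> x \<le> y) \<or>
     x = y' \<and> y = x' \<and> z = z' \<and> (x \<le> z \<and> z < y \<or> y \<le> z \<and> z < x)"
  (is "?l = ?r")
proof
  show "?l \<Longrightarrow> ?r" unfolding knuth_triple_def by (elim disjE exE conjE) simp_all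
  show "?r \<Longrightarrow> ?l" unfolding knuth_triple_def by (elim disjE conjE) blast+
qed

text \<open>The common form of all moves: two neighbours are exchanged in the presence of a witness
  whose value lies between them. The witness stands to the left in the first case and to the right
  in the second.\<close>

lemma knuth_triple_cases:
  assumes "knuth_triple p q"
  obtains x y z where "p = [x, y, z]" "q = [x, z, y]" "y < x \<and> x \<le> z \<or> z < x \<and> x \<le> y"
  | x y z where "p = [x, y, z]" "q = [y, x, z]" "x \<le> z \<and> z < y \<or> y \<le> z \<and> z < x"
  using assms unfolding knuth_triple_def by blast

text \<open>The two inequalities serve the context: in \<open>u @ p @ v\<close> the part before the
  letter has \<open>eps\<close> zero only if also \<open>eps i u \<le> phi i p1\<close>, and the
  part after it has \<open>phi\<close> zero only if \<open>phi i v \<le> eps i p2\<close>, so these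
  bounds must survive the move. The move after raising can be of the other type: 221 and 212 are
  raised to 121 and 211.\<close>

lemma knuth_triple_estep:
  assumes "knuth_triple p q" "p = p1 @ Suc i # p2" "eps i p1 = 0" "phi i p2 = 0"
  shows "\<exists>q1 q2. q = q1 @ Suc i # q2 \<and> eps i q1 = 0 \<and> phi i q2 = 0 \<and> phi i p1 \<le> phi i q1 \<and>
    eps i p2 \<le> eps i q2 \<and> knuth_triple (p1 @ i # p2) (q1 @ i # q2)"
  using assms(1)
proof (cases rule: knuth_triple_cases)
  case (1 x y z)
  have "[x, y, z] = p1 @ Suc i # p2" using assms 1 by simp
  note split = this[unfolded split3_iff]
  show ?thesis
    unfolding 1(2) ex_split3_iff using split 1(3) assms(3,4)
    by (elim disjE) (auto simp: knuth_triple_iff split: if_splits)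
next
  case (2 x y z)
  have "[x, y, z] = p1 @ Suc i # p2" using assms 2 by simp
  note split = this[unfolded split3_iff]
  show ?thesis
    unfolding 2(2) ex_split3_iff using split 2(3) assms(3,4)
    by (elim disjE) (auto simp: knuth_triple_iff split: if_splits)
qed

lemma knuth_triple_estep_back:
  assumes "knuth_triple p q" "p = p1 @ i # p2" "eps i p1 = 0" "phi i p2 = 0"
  shows "\<exists>q1 q2. q = q1 @ i # q2 \<and> eps i q1 = 0 \<and> phi i q2 = 0 \<and> phi i p1 \<le> phi i q1 \<and>
    eps i p2 \<le> eps i q2 \<and> knuth_triple (p1 @ Suc i # p2) (q1 @ Suc i # q2)"
  using assms(1)
proof (cases rule: knuth_triple_cases)
  case (1 x y z)
  have "[x, y, z] = p1 @ i # p2" using assms 1 by simp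
  note split = this[unfolded split3_iff]
  show ?thesis
    unfolding 1(2) ex_split3_iff using split 1(3) assms(3,4)
    by (elim disjE) (auto simp: knuth_triple_iff split: if_splits)
next
  case (2 x y z)
  have "[x, y, z] = p1 @ i # p2" using assms 2 by simp
  note split = this[unfolded split3_iff]
  show ?thesis
    unfolding 2(2) ex_split3_iff using split 2(3) assms(3,4)
    by (elim disjE) (auto simp: knuth_triple_iff split: if_splits)
qed

lemma append_eq_append3_cases:
  assumes "u @ p @ v = a @ y # t"
  obtains s where "u = a @ y # s" "t = s @ p @ v"
  | p1 p2 where "p = p1 @ y # p2" "a = u @ p1" "t = p2 @ v"
  | s where "v = s @ y # t" "a = u @ p @ s"
proof -
  obtain us where "u = a @ us \<and> us @ p @ v = y # t \<or> u @ us = a \<and> p @ v = us @ y # t"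
    using assms by (auto simp: append_eq_append_conv2)
  then consider "u = a @ us" "us @ p @ v = y # t" | "a = u @ us" "p @ v = us @ y # t" by blast
  then show thesis
  proof cases
    case 1
    show thesis
    proof (cases us)
      case Nil
      with 1 show thesis
        by (cases p) (use that(2)[of "[]"] that(3)[of "[]"] in auto)
    next
      case (Cons z zs)
      with 1 show thesis using that(1)[of zs] by auto
    qed
  next
    case 2
    obtain vs where "p = us @ vs \<and> vs @ v = y # t \<or> p @ vs = us \<and> v = vs @ y # t"
      using 2(2) by (auto simp: append_eq_append_conv2)
    then show thesis
    proof
      assume *: "p = us @ vs \<and> vs @ v = y # t"
      show thesis
      proof (cases vs)
        case Nil
        with * 2 show thesis using that(3)[of "[]"] by auto
      next
        case (Cons z zs)
        with * 2 show thesis using that(2)[of us zs] by auto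
      qed
    next
      assume "p @ vs = us \<and> v = vs @ y # t"
      with 2 show thesis using that(3)[of vs] by auto
    qed
  qed
qed

text \<open>Raising and lowering together, by the choice of \<open>s\<close> and \<open>r\<close>.
  If the letter lies outside the triple, the move does not affect the bracketing around it and can
  be made after the change as well; inside the triple the three-letter case analysis
  applies.\<close>

lemma knuth_triple_letter_change:
  assumes sr: "s = Suc i \<and> r = i \<or> s = i \<and> r = Suc i"
    and pq: "knuth_triple p q" and w: "u @ p @ v = a @ s # t" and a: "eps i a = 0" and t: "phi i t = 0"
  shows "\<exists>a' t'. u @ q @ v = a' @ s # t' \<and> eps i a' = 0 \<and> phi i t' = 0 \<and>
    knuth_equiv (a @ r # t) (a' @ r # t')"
  using w
proof (cases rule: append_eq_append3_cases)
  case (1 x)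
  have "u @ q @ v = a @ s # (x @ q @ v)" using 1 by simp
  moreover have "phi i (x @ q @ v) = 0"
    using t 1 knuth_triple_eps[OF pq, of i] by (simp add: phi_append eps_append)
  moreover have "knuth_equiv (a @ r # t) (a @ r # (x @ q @ v))"
    using knuth_equiv_triple[OF pq, of "a @ r # x" v] 1 by simp
  ultimately show ?thesis using a by blast
next
  case (2 p1 p2)
  have "eps i p1 = 0" "phi i p2 = 0" "eps i u \<le> phi i p1" "phi i v \<le> eps i p2"
    using a t 2 by (auto simp: phi_append eps_append)
  then obtain q1 q2 where q: "q = q1 @ s # q2" "eps i q1 = 0" "phi i q2 = 0" "phi i p1 \<le> phi i q1"
    "eps i p2 \<le> eps i q2" "knuth_triple (p1 @ r # p2) (q1 @ r # q2)"
    using knuth_triple_estep[of p q p1 i p2] knuth_triple_estep_back[of p q p1 i p2] pq 2(1) sr by blast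
  have "u @ q @ v = (u @ q1) @ s # (q2 @ v)" using q by simp
  moreover have "eps i (u @ q1) = 0" "phi i (q2 @ v) = 0"
    using q \<open>eps i u \<le> phi i p1\<close> \<open>phi i v \<le> eps i p2\<close> by (auto simp: phi_append eps_append)
  moreover have "knuth_equiv (a @ r # t) ((u @ q1) @ r # (q2 @ v))"
    using knuth_equiv_triple[OF q(6), of u v] 2 by simp
  ultimately show ?thesis by blast
next
  case (3 x)
  have "u @ q @ v = (u @ q @ x) @ s # t" using 3 by simp
  moreover have "eps i (u @ q @ x) = 0"
    using a 3 knuth_triple_eps[OF pq, of i] by (simp add: phi_append eps_append) linarith
  moreover have "knuth_equiv (a @ r # t) ((u @ q @ x) @ r # t)"
    using knuth_equiv_triple[OF pq, of u "x @ r # t"] 3 by simp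
  ultimately show ?thesis using t by blast
qed

lemma knuth_equiv_estep:
  assumes "knuth_equiv w w'" "estep i w w1"
  shows "\<exists>w1'. estep i w' w1' \<and> knuth_equiv w1 w1'"
  using assms
proof (induction rule: knuth_equiv_induct)
  case refl
  then show ?case by auto
next
  case (step u p q v)
  then obtain w2 where w2: "estep i (u @ p @ v) w2" "knuth_equiv w1 w2" by blast
  then obtain a t where at: "u @ p @ v = a @ Suc i # t" "w2 = a @ i # t" "eps i a = 0" "phi i t = 0"
    by (auto simp: estep_def)
  obtain a' t' where "u @ q @ v = a' @ Suc i # t'" "eps i a' = 0" "phi i t' = 0"
    "knuth_equiv w2 (a' @ i # t')"
    using knuth_triple_letter_change[OF disjI1[OF conjI[OF refl refl]] step.hyps(2) at(1,3,4)] at(2) by blast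
  then show ?case unfolding estep_def using w2(2) knuth_equiv_trans by blast
qed

lemma knuth_equiv_estep_back:
  assumes "knuth_equiv w w'" "estep i w1 w"
  shows "\<exists>w1'. estep i w1' w' \<and> knuth_equiv w1 w1'"
  using assms
proof (induction rule: knuth_equiv_induct)
  case refl
  then show ?case by auto
next
  case (step u p q v)
  then obtain w2 where w2: "estep i w2 (u @ p @ v)" "knuth_equiv w1 w2" by blast
  then obtain a t where at: "u @ p @ v = a @ i # t" "w2 = a @ Suc i # t" "eps i a = 0" "phi i t = 0"
    by (auto simp: estep_def)
  obtain a' t' where "u @ q @ v = a' @ i # t'" "eps i a' = 0" "phi i t' = 0"
    "knuth_equiv w2 (a' @ Suc i # t')"
    using knuth_triple_letter_change[OF disjI2[OF conjI[OF refl refl]] step.hyps(2) at(1,3,4)] at(2) by blast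
  then show ?case unfolding estep_def using w2(2) knuth_equiv_trans by blast
qed

lemma estep_sum_list: "estep i w w' \<Longrightarrow> sum_list w = Suc (sum_list w')"
  by (auto simp: estep_def)

lemma estep_positive: "estep i w w' \<Longrightarrow> i \<ge> 1 \<Longrightarrow> set w \<subseteq> {1..} \<longleftrightarrow> set w' \<subseteq> {1..}"
  by (auto simp: estep_def)

section \<open>Yamanouchi words\<close>

text \<open>The highest weight words of the crystal, also called reverse lattice words. Rows are
  read from bottom to top, so the suffixes in question belong to the upper part of a
  tableau.\<close>

definition yamanouchi :: "nat list \<Rightarrow> bool" where
  "yamanouchi w \<longleftrightarrow> set w \<subseteq> {1..} \<and> (\<forall>i\<ge>1. eps i w = 0)"

lemma yamanouchi_append: "yamanouchi (u @ v) \<Longrightarrow> yamanouchi v"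
  by (simp add: yamanouchi_def eps_append)

lemma yamanouchi_knuth: "knuth_equiv w w' \<Longrightarrow> yamanouchi w \<longleftrightarrow> yamanouchi w'"
  using knuth_equiv_eps[of w w'] knuth_equiv_mset[of w w'] mset_eq_setD[of w w']
  by (auto simp: yamanouchi_def)

lemma yamanouchi_count_list:
  assumes "yamanouchi w" "1 \<le> i" "i \<le> j"
  shows "count_list w j \<le> count_list w i"
  using assms(3)
proof (induction j rule: dec_induct)
  case (step n)
  then have "eps n w = 0" using assms by (simp add: yamanouchi_def)
  then show ?case using step eps_phi_count[of n w] by simp
qed simp

text \<open>Raising lowers the sum of the letters by one, so it terminates, and it can only
  terminate at a Yamanouchi word.\<close>

lemma yamanouchi_induct [consumes 1, case_names yamanouchi step]:
  assumes "set w \<subseteq> {1..}" and "\<And>w. yamanouchi w \<Longrightarrow> P w"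
    and "\<And>i w w'. 1 \<le> i \<Longrightarrow> set w \<subseteq> {1..} \<Longrightarrow> estep i w w' \<Longrightarrow> P w' \<Longrightarrow> P w"
  shows "P w"
  using assms(1)
proof (induction "sum_list w" arbitrary: w rule: less_induct)
  case less
  show ?case
  proof (cases "yamanouchi w")
    case False
    then obtain i where "1 \<le> i" "eps i w > 0" using less.prems by (auto simp: yamanouchi_def)
    then obtain w' where "estep i w w'" using estep_exists by blast
    then show ?thesis
      using less.hyps[of w'] estep_sum_list estep_positive assms(3) \<open>1 \<le> i\<close> less.prems by fastforce
  qed (rule assms(2))
qed

text \<open>Column reading of the tableau with column heights \<open>hs\<close> whose columns read
  1, 2, 3, ... downwards. It is a normal form for Yamanouchi words: a letter put in front of it can
  be pushed through entire columns.\<close>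

definition col_word :: "nat list \<Rightarrow> nat list" where
  "col_word hs = concat (map (\<lambda>h. rev [1..<Suc h]) hs)"

lemma col_word_simps [simp]:
  "col_word [] = []" "col_word (h # hs) = rev [1..<Suc h] @ col_word hs"
  "col_word (hs @ hs') = col_word hs @ col_word hs'"
  by (simp_all add: col_word_def)

lemma count_list_col_word: "1 \<le> k \<Longrightarrow> count_list (col_word hs) k = length (filter (\<lambda>h. k \<le> h) hs)"
proof (induction hs)
  case (Cons h hs)
  have "count_list (rev [1..<Suc h]) k = (if k \<le> h then 1 else 0)"
    by (induction h) (use Cons.prems in auto)
  then show ?case using Cons by (simp add: count_list_append del: upt_Suc)
qed simp

text \<open>The witness for passing an entry of the column is the next entry after it. In front of
  its own copy the letter has arrived, as the two cannot be told apart.\<close>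

lemma column_pass_upper:
  "knuth_equiv (x # rev [x..<Suc (x + d)]) (rev [x..<Suc (x + d)] @ [x])"
proof (induction d)
  case (Suc d)
  have "knuth_triple [x, Suc (x + d), x + d] [Suc (x + d), x, x + d]"
    by (simp add: knuth_triple_iff)
  from knuth_equiv_triple[OF this, of "[]" "rev [x..<x + d]"]
  have "knuth_equiv (x # rev [x..<Suc (x + Suc d)]) (Suc (x + d) # x # rev [x..<Suc (x + d)])" by simp
  moreover have "knuth_equiv (Suc (x + d) # x # rev [x..<Suc (x + d)])
      (Suc (x + d) # rev [x..<Suc (x + d)] @ [x])"
    by (rule knuth_equiv_Cons[OF Suc])
  ultimately show ?case using knuth_equiv_trans by fastforce
qed simp

text \<open>Now the witness is on the left: it is the entry \<open>z\<close> passed last, and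
  \<open>z \<le> x\<close> lets the next smaller entry slip in front of \<open>x\<close>.\<close>

lemma column_pass_lower:
  "1 \<le> z \<Longrightarrow> z \<le> x \<Longrightarrow> knuth_equiv (z # x # rev [1..<z]) (z # rev [1..<z] @ [x])"
proof (induction z)
  case (Suc z)
  show ?case
  proof (cases "z = 0")
    case False
    then have "knuth_triple [Suc z, x, z] [Suc z, z, x]" using Suc.prems by (simp add: knuth_triple_iff)
    from knuth_equiv_triple[OF this, of "[]" "rev [1..<z]"]
    have "knuth_equiv (Suc z # x # rev [1..<Suc z]) (Suc z # z # x # rev [1..<z])" using False by simp
    moreover have "knuth_equiv (Suc z # z # x # rev [1..<z]) (Suc z # z # rev [1..<z] @ [x])"
      using False Suc by (intro knuth_equiv_Cons Suc.IH) auto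
    ultimately show ?thesis using False knuth_equiv_trans by fastforce
  qed simp
qed simp

text \<open>The letter \<open>x\<close> travels past the larger letters of the column, then its own copy there, and past
  the smaller ones.\<close>

lemma column_pass:
  assumes "1 \<le> x" "x \<le> h"
  shows "knuth_equiv (x # rev [1..<Suc h]) (rev [1..<Suc h] @ [x])"
proof -
  obtain d where d: "h = x + d" using assms(2) le_Suc_ex by blast
  have split: "rev [1..<Suc h] = rev [x..<Suc (x + d)] @ rev [1..<x]"
    using upt_add_eq_append[of 1 x "Suc d"] assms by (simp add: d)
  have split': "rev [x..<Suc (x + d)] = rev [Suc x..<Suc (x + d)] @ [x]"
    by (simp add: upt_conv_Cons del: upt_Suc)
  have "knuth_equiv (x # rev [1..<Suc h]) (rev [x..<Suc (x + d)] @ [x] @ rev [1..<x])"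
    unfolding split using knuth_equiv_append[OF column_pass_upper, of "[]" x d "rev [1..<x]"] by simp
  also have "rev [x..<Suc (x + d)] @ [x] @ rev [1..<x] =
      rev [Suc x..<Suc (x + d)] @ (x # x # rev [1..<x]) @ []" using split' by simp
  finally have 1: "knuth_equiv (x # rev [1..<Suc h])
    (rev [Suc x..<Suc (x + d)] @ (x # x # rev [1..<x]) @ [])" .
  have 2: "knuth_equiv (rev [Suc x..<Suc (x + d)] @ (x # x # rev [1..<x]) @ [])
      (rev [Suc x..<Suc (x + d)] @ (x # rev [1..<x] @ [x]) @ [])"
    using assms by (intro knuth_equiv_append column_pass_lower) auto
  have 3: "rev [Suc x..<Suc (x + d)] @ (x # rev [1..<x] @ [x]) @ [] = rev [1..<Suc h] @ [x]"
    unfolding split using split' by simp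
  show ?thesis using knuth_equiv_trans[OF 1 2] unfolding 3 .
qed

lemma col_word_pass:
  assumes "1 \<le> x" "\<forall>h\<in>set hs. x \<le> h"
  shows "knuth_equiv (x # col_word hs) (col_word hs @ [x])"
  using assms(2)
proof (induction hs)
  case (Cons h hs)
  have "knuth_equiv (x # rev [1..<Suc h] @ col_word hs) (rev [1..<Suc h] @ [x] @ col_word hs)"
    using knuth_equiv_append[OF column_pass[of x h], of "[]" "col_word hs"] Cons.prems assms(1) by simp
  moreover have "knuth_equiv (rev [1..<Suc h] @ [x] @ col_word hs) (rev [1..<Suc h] @ col_word hs @ [x])"
    using knuth_equiv_append[OF Cons.IH, of "rev [1..<Suc h]" "[]"] Cons.prems by simp
  ultimately show ?case using knuth_equiv_trans by fastforce
qed simp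

lemma length_filter_ge_Suc:
  "length (filter (\<lambda>h. k \<le> h) hs) = count_list hs k + length (filter (\<lambda>h. Suc k \<le> h) hs)"
  by (induction hs) auto

text \<open>The counts are the parts of the conjugate partition, and their differences are the
  multiplicities of the parts.\<close>

lemma partition_eqI:
  assumes "is_partition hs" "is_partition hs'"
    and "\<And>k. 1 \<le> k \<Longrightarrow> length (filter (\<lambda>h. k \<le> h) hs) = length (filter (\<lambda>h. k \<le> h) hs')"
  shows "hs = hs'"
proof -
  have "count_list hs k = count_list hs' k" for k
  proof (cases "k = 0")
    case True
    then show ?thesis using assms(1,2) by (simp add: is_partition_def count_list_0_iff)
  next
    case False
    then show ?thesis
      using length_filter_ge_Suc[of k hs] length_filter_ge_Suc[of k hs'] assms(3)[of k] assms(3)[of "Suc k"]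
      by simp
  qed
  then have "mset (rev hs) = mset (rev hs')" by (simp add: multiset_eq_iff count_mset)
  moreover have "sorted (rev hs)" "sorted (rev hs')"
    using assms(1,2) by (simp_all add: is_partition_def sorted_wrt_rev)
  ultimately show ?thesis by (metis properties_for_sort rev_rev_ident)
qed

text \<open>By induction from the right end. A new first letter \<open>x\<close> moves past the
  columns of height at least \<open>x\<close> and then extends the first column of height
  \<open>x - 1\<close>; the letter 1 becomes a new column at the end.\<close>

lemma yamanouchi_col_word:
  assumes "yamanouchi w"
  shows "\<exists>hs. is_partition hs \<and> knuth_equiv w (col_word hs)"
  using assms
proof (induction w)
  case Nil
  then show ?case by (intro exI[of _ "[]"]) (simp add: is_partition_def)
next
  case (Cons x w)
  have "yamanouchi w" using Cons.prems yamanouchi_append[of "[x]" w] by simp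
  then obtain hs where hs: "is_partition hs" "knuth_equiv w (col_word hs)" using Cons.IH by blast
  have cnt: "count_list w k = length (filter (\<lambda>h. k \<le> h) hs)" if "1 \<le> k" for k
    using knuth_equiv_mset[OF hs(2)] count_list_col_word[OF that] by (metis count_mset)
  have xw: "knuth_equiv (x # w) (x # col_word hs)" by (rule knuth_equiv_Cons[OF hs(2)])
  have "x \<ge> 1" using Cons.prems by (simp add: yamanouchi_def)
  show ?case
  proof (cases "x = 1")
    case True
    have "\<forall>h\<in>set hs. x \<le> h" using hs(1) True by (auto simp: is_partition_def) (metis One_nat_def Suc_leI neq0_conv)
    then have "knuth_equiv (x # col_word hs) (col_word (hs @ [1]))"
      using col_word_pass[of x hs] True by simp
    moreover have "is_partition (hs @ [1])"
      using hs(1) \<open>\<forall>h\<in>set hs. x \<le> h\<close> True by (auto simp: is_partition_def sorted_wrt_append)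
    ultimately show ?thesis using knuth_equiv_trans[OF xw] by blast
  next
    case False
    then obtain y where y: "x = Suc y" "1 \<le> y" using \<open>x \<ge> 1\<close> by (cases x) auto
    \<comment> \<open>The Yamanouchi condition for the word including its new letter makes the
      number of columns of height at least \<open>x\<close> strictly smaller than that of height at
      least \<open>y\<close>, so some column has height exactly \<open>y\<close>.\<close>
    have "count_list (x # w) x \<le> count_list (x # w) y"
      using yamanouchi_count_list[OF Cons.prems, of y x] y by simp
    then have "count_list hs y \<noteq> 0" using cnt[of x] cnt[of y] length_filter_ge_Suc[of y hs] y by simp
    then have "y \<in> set hs" by (simp add: count_list_0_iff)
    then obtain hs1 hs2 where split: "hs = hs1 @ y # hs2" "y \<notin> set hs1" using split_list_first by metis
    have ge: "\<forall>h\<in>set hs1. x \<le> h"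
    proof
      fix h
      assume "h \<in> set hs1"
      then have "h \<ge> y" "h \<noteq> y"
        using hs(1) split by (auto simp: is_partition_def sorted_wrt_append)
      then show "x \<le> h" by (simp add: y)
    qed
    have "knuth_equiv (x # col_word hs) (col_word hs1 @ [x] @ rev [1..<Suc y] @ col_word hs2)"
      using knuth_equiv_append[OF col_word_pass[OF \<open>x \<ge> 1\<close> ge], of "[]" "rev [1..<Suc y] @ col_word hs2"]
      by (simp add: split)
    then have "knuth_equiv (x # col_word hs) (col_word (hs1 @ x # hs2))" by (simp add: y)
    moreover have "is_partition (hs1 @ x # hs2)"
      using hs(1) split ge y by (fastforce simp: is_partition_def sorted_wrt_append)
    ultimately show ?thesis using knuth_equiv_trans[OF xw] by blast
  qed
qed

text \<open>The normal form depends on the content alone: the multiplicity of \<open>k\<close> is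
  the number of columns of height at least \<open>k\<close>.\<close>

lemma yamanouchi_knuth_equivI:
  assumes "yamanouchi w" "yamanouchi w'" "mset w = mset w'"
  shows "knuth_equiv w w'"
proof -
  obtain hs hs' where hs: "is_partition hs" "knuth_equiv w (col_word hs)"
    "is_partition hs'" "knuth_equiv w' (col_word hs')" using assms yamanouchi_col_word by metis
  have "length (filter (\<lambda>h. k \<le> h) hs) = length (filter (\<lambda>h. k \<le> h) hs')" if "1 \<le> k" for k
    using knuth_equiv_mset[OF hs(2)] knuth_equiv_mset[OF hs(4)] count_list_col_word[OF that] assms(3)
    by (metis count_mset)
  then have "hs = hs'" using partition_eqI hs by blast
  then show ?thesis using hs knuth_equiv_sym knuth_equiv_trans by metis
qed

section \<open>Tableaux as sequences of rows\<close>

primrec rword :: "nat \<Rightarrow> (nat \<Rightarrow> 'a list) \<Rightarrow> 'a list" where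
  "rword 0 f = []"
| "rword (Suc n) f = f (Suc n) @ rword n f"

definition cle :: "nat \<Rightarrow> nat list \<Rightarrow> nat" where
  "cle x r = length (filter (\<lambda>y. y \<le> x) r)"

text \<open>Row \<open>k\<close> has length \<open>l k\<close> and starts to the right of column \<open>m k\<close>. The last condition says
  that the columns are strict: the entries \<open>\<le> x + 1\<close> of row \<open>k + 1\<close> lie below entries \<open>\<le> x\<close> of
  row \<open>k\<close>, or to the left of row \<open>k\<close>.\<close>

definition row_tableaux :: "nat \<Rightarrow> (nat \<Rightarrow> nat) \<Rightarrow> (nat \<Rightarrow> nat) \<Rightarrow> (nat \<Rightarrow> nat list) set" where
  "row_tableaux n m l = {f.
     (\<forall>k. k \<notin> {1..n} \<longrightarrow> f k = []) \<and>
     (\<forall>k\<in>{1..n}. sorted (f k) \<and> length (f k) = l k \<and> set (f k) \<subseteq> {1..}) \<and>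
     (\<forall>k\<in>{1..<n}. \<forall>x. m (Suc k) + cle (Suc x) (f (Suc k)) \<le> m k + cle x (f k))}"

lemma cle_append [simp]: "cle x (r @ s) = cle x r + cle x s"
  by (simp add: cle_def)

lemma cle_Nil [simp]: "cle x [] = 0"
  by (simp add: cle_def)

lemma cle_Cons [simp]: "cle x (y # r) = (if y \<le> x then Suc (cle x r) else cle x r)"
  by (simp add: cle_def)

lemma cle_Suc: "cle (Suc x) r = cle x r + count_list r (Suc x)"
  by (induction r) auto

lemma cle_le_length: "cle x r \<le> length r"
  by (simp add: cle_def)

lemma cle_0: "set r \<subseteq> {1..} \<Longrightarrow> cle 0 r = 0"
  by (induction r) auto

text \<open>In a weakly increasing word each \<open>i\<close> precedes each \<open>Suc i\<close>, so
  no bracket is matched.\<close>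

lemma phi_eps_sorted: "sorted r \<Longrightarrow> phi i r = count_list r i \<and> eps i r = count_list r (Suc i)"
proof (induction r)
  case (Cons x r)
  have "count_list r i = 0" if "x = Suc i"
    using Cons.prems that by (auto simp: count_list_0_iff)
  then show ?case using Cons by auto
qed simp

text \<open>The rows below row \<open>k\<close>, which are read before it.\<close>

definition hword :: "nat \<Rightarrow> nat \<Rightarrow> (nat \<Rightarrow> 'a list) \<Rightarrow> 'a list" where
  "hword n k f = concat (map f (rev [Suc k..<Suc n]))"

lemma rword_split:
  assumes "1 \<le> k" "k \<le> n"
  shows "rword n f = hword n k f @ f k @ rword (k - 1) f"
  using assms(2)
proof (induction n rule: dec_induct)
  case base
  then show ?case using assms(1) by (cases k) (auto simp: hword_def)
next
  case (step n)
  then show ?case using assms by (simp add: hword_def)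
qed

lemma hword_Suc: "k < n \<Longrightarrow> hword n k f = hword n (Suc k) f @ f (Suc k)"
  by (simp add: hword_def upt_conv_Cons del: upt_Suc)

lemma rword_cong: "(\<And>k. 1 \<le> k \<Longrightarrow> k \<le> n \<Longrightarrow> f k = g k) \<Longrightarrow> rword n f = rword n g"
  by (induction n) auto

lemma rword_update:
  assumes "1 \<le> k" "k \<le> n"
  shows "rword n (f(k := r)) = hword n k f @ r @ rword (k - 1) f"
proof -
  have "hword n k (f(k := r)) = hword n k f"
    by (auto simp: hword_def intro!: arg_cong[of _ _ concat] simp del: upt_Suc)
  moreover have "rword (k - 1) (f(k := r)) = rword (k - 1) f"
    by (rule rword_cong) (use assms in auto)
  ultimately show ?thesis using rword_split[OF assms, of "f(k := r)"] by simp
qed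

lemma rword_letter:
  assumes "rword n f = u @ y # t"
  shows "\<exists>k p q. 1 \<le> k \<and> k \<le> n \<and> f k = p @ y # q \<and> u = hword n k f @ p \<and> t = q @ rword (k - 1) f"
  using assms
proof (induction n arbitrary: u t)
  case (Suc n)
  have eq: "[] @ f (Suc n) @ rword n f = u @ y # t" using Suc.prems by simp
  show ?case
    using eq
  proof (cases rule: append_eq_append3_cases)
    case (2 p1 p2)
    then show ?thesis by (intro exI[of _ "Suc n"]) (simp add: hword_def)
  next
    case (3 s)
    obtain k p q where "1 \<le> k" "k \<le> n" "f k = p @ y # q" "s = hword n k f @ p" "t = q @ rword (k - 1) f"
      using Suc.IH[OF 3(1)] by blast
    then show ?thesis using 3(2) by (intro exI[of _ k]) (auto simp: hword_def)
  qed simp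
qed simp

text \<open>The row lengths are prescribed, so the word can be cut into rows in only one
  way.\<close>

lemma rword_inj:
  assumes "f \<in> row_tableaux n m l" "g \<in> row_tableaux n m l" "rword n f = rword n g"
  shows "f = g"
proof -
  have *: "k \<le> n \<Longrightarrow> rword k f = rword k g \<Longrightarrow> 1 \<le> j \<Longrightarrow> j \<le> k \<Longrightarrow> f j = g j" for j k
  proof (induction k)
    case (Suc k)
    have "length (f (Suc k)) = length (g (Suc k))"
      using assms(1,2) Suc.prems(1) by (auto simp: row_tableaux_def)
    then have "f (Suc k) = g (Suc k)" "rword k f = rword k g" using Suc.prems by auto
    then show ?case using Suc by (cases "j = Suc k") auto
  qed simp
  show ?thesis
  proof
    fix k
    show "f k = g k"
      using *[of n k] assms by (cases "k \<in> {1..n}") (auto simp: row_tableaux_def)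
  qed
qed

text \<open>The raised letter is the left-most \<open>Suc i\<close> of its row, so the row stays
  sorted. The only inequality at risk is the one with the row above at threshold
  \<open>i - 1\<close>. There every \<open>i\<close> of the upper row is matched by a
  \<open>Suc i\<close> to the right of the raised letter, and this leaves room for one more
  \<open>i\<close> underneath.\<close>

lemma row_tableaux_estep:
  assumes f: "f \<in> row_tableaux n m l" and "1 \<le> i" and e: "estep i (rword n f) w"
  shows "\<exists>g\<in>row_tableaux n m l. rword n g = w"
proof -
  obtain u t where ut: "rword n f = u @ Suc i # t" "w = u @ i # t" "eps i u = 0" "phi i t = 0"
    using e by (auto simp: estep_def)
  obtain k p q where k: "1 \<le> k" "k \<le> n" and fk: "f k = p @ Suc i # q"
    and u: "u = hword n k f @ p" and t: "t = q @ rword (k - 1) f"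
    using rword_letter[OF ut(1)] by blast
  have rows: "sorted (f j) \<and> length (f j) = l j \<and> set (f j) \<subseteq> {1..}" if "1 \<le> j" "j \<le> n" for j
    using f that by (auto simp: row_tableaux_def)
  have cols: "m (Suc j) + cle (Suc x) (f (Suc j)) \<le> m j + cle x (f j)" if "1 \<le> j" "j < n" for j x
    using f that by (auto simp: row_tableaux_def)
  have sk: "sorted (p @ Suc i # q)" using rows k fk by metis
  have p0: "count_list p (Suc i) = 0"
    using ut(3) u phi_eps_sorted[of p i] sk by (auto simp: eps_append sorted_append)
  have snew: "sorted (p @ i # q)"
    using sk p0 by (fastforce simp: sorted_append count_list_0_iff le_Suc_eq)
  define g where "g = f(k := p @ i # q)"
  have gk: "g k = p @ i # q" and gj: "j \<noteq> k \<Longrightarrow> g j = f j" for j by (auto simp: g_def)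
  have cnew: "cle x (p @ i # q) = cle x (f k) + (if x = i then 1 else 0)" for x
    by (simp add: fk)
  have "m (Suc j) + cle (Suc x) (g (Suc j)) \<le> m j + cle x (g j)" if j: "1 \<le> j" "j < n" for j x
  proof -
    consider "j = k" | "Suc j = k" | "j \<noteq> k" "Suc j \<noteq> k" by blast
    then show ?thesis
    proof cases
      case 1
      then show ?thesis using cols[OF j, of x] by (simp add: gk gj cnew del: cle_append)
    next
      case 2
      have sj: "sorted (f j)" "sorted q" using rows[of j] j sk by (auto simp: sorted_append)
      \<comment> \<open>The row above is read immediately after \<open>q\<close>, so its letters
        \<open>i\<close> can only be closed against the letters \<open>Suc i\<close> of
        \<open>q\<close> and of earlier parts; \<open>phi i t = 0\<close> excludes all but
        \<open>q\<close>.\<close>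
      have "rword (k - 1) f = f j @ rword (j - 1) f" using 2 j by (cases j) auto
      then have "count_list (f j) i \<le> count_list q (Suc i)"
        using ut(4) t phi_eps_sorted[OF sj(1), of i] phi_eps_sorted[OF sj(2), of i]
        by (auto simp: phi_append)
      moreover have "cle i (f j) = cle (i - 1) (f j) + count_list (f j) i"
        using cle_Suc[of "i - 1" "f j"] \<open>1 \<le> i\<close> by simp
      moreover have "cle (Suc i) (f k) = cle i (f k) + count_list q (Suc i) + 1"
        using cle_Suc[of i "f k"] fk p0 by simp
      moreover have "m k + cle (Suc i) (f k) \<le> m j + cle i (f j)"
        using cols[OF j, of i] 2 by simp
      ultimately show ?thesis
        using cols[OF j, of x] 2 by (auto simp: gk gj cnew simp del: cle_append)
    next
      case 3
      then show ?thesis using cols[OF j] by (simp add: gj)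
    qed
  qed
  moreover have "\<forall>j. j \<notin> {1..n} \<longrightarrow> g j = []"
    using f k by (auto simp: g_def row_tableaux_def)
  moreover have "sorted (g j) \<and> length (g j) = l j \<and> set (g j) \<subseteq> {1..}" if "1 \<le> j" "j \<le> n" for j
    using rows[OF that] rows[OF k] snew fk \<open>1 \<le> i\<close> by (cases "j = k") (auto simp: g_def)
  ultimately have "g \<in> row_tableaux n m l" by (auto simp: row_tableaux_def)
  moreover have "rword n g = w" using rword_update[OF k, of f] by (simp add: g_def ut(2) u t)
  ultimately show ?thesis by blast
qed

text \<open>The mirror image: the lowered letter is the right-most \<open>i\<close> of its row, and
  the inequality at risk is the one with the row below. Each \<open>Suc i\<close> of that row is
  matched by an \<open>i\<close> to the left of the lowered letter.\<close>

lemma row_tableaux_estep_back: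
  assumes f: "f \<in> row_tableaux n m l" and "1 \<le> i" and e: "estep i w (rword n f)"
  shows "\<exists>g\<in>row_tableaux n m l. rword n g = w"
proof -
  obtain u t where ut: "rword n f = u @ i # t" "w = u @ Suc i # t" "eps i u = 0" "phi i t = 0"
    using e by (auto simp: estep_def)
  obtain k p q where k: "1 \<le> k" "k \<le> n" and fk: "f k = p @ i # q"
    and u: "u = hword n k f @ p" and t: "t = q @ rword (k - 1) f"
    using rword_letter[OF ut(1)] by blast
  have rows: "sorted (f j) \<and> length (f j) = l j \<and> set (f j) \<subseteq> {1..}" if "1 \<le> j" "j \<le> n" for j
    using f that by (auto simp: row_tableaux_def)
  have cols: "m (Suc j) + cle (Suc x) (f (Suc j)) \<le> m j + cle x (f j)" if "1 \<le> j" "j < n" for j x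
    using f that by (auto simp: row_tableaux_def)
  have sk: "sorted (p @ i # q)" using rows k fk by metis
  have q0: "count_list q i = 0"
    using ut(4) t phi_eps_sorted[of q i] sk by (auto simp: phi_append sorted_append)
  have snew: "sorted (p @ Suc i # q)"
    using sk q0 by (fastforce simp: sorted_append count_list_0_iff Suc_le_eq le_less)
  define g where "g = f(k := p @ Suc i # q)"
  have gk: "g k = p @ Suc i # q" and gj: "j \<noteq> k \<Longrightarrow> g j = f j" for j by (auto simp: g_def)
  have cnew: "cle x (f k) = cle x (p @ Suc i # q) + (if x = i then 1 else 0)" for x
    by (simp add: fk)
  have "m (Suc j) + cle (Suc x) (g (Suc j)) \<le> m j + cle x (g j)" if j: "1 \<le> j" "j < n" for j x
  proof -
    consider "j = k" | "Suc j = k" | "j \<noteq> k" "Suc j \<noteq> k" by blast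
    then show ?thesis
    proof cases
      case 1
      have sj: "sorted (f (Suc k))" "sorted p" using rows[of "Suc k"] 1 j sk by (auto simp: sorted_append)
      have "count_list (f (Suc k)) (Suc i) \<le> count_list p i"
        using ut(3) u hword_Suc[of k n f] 1 j phi_eps_sorted[OF sj(1), of i] phi_eps_sorted[OF sj(2), of i]
        by (auto simp: eps_append)
      moreover have "cle (Suc i) (f (Suc k)) = cle i (f (Suc k)) + count_list (f (Suc k)) (Suc i)"
        by (rule cle_Suc)
      moreover have "cle i (f k) = cle (i - 1) (f k) + count_list p i + 1"
        using cle_Suc[of "i - 1" "f k"] \<open>1 \<le> i\<close> fk q0 by simp
      moreover have "m (Suc k) + cle i (f (Suc k)) \<le> m k + cle (i - 1) (f k)"
        using cols[OF j, of "i - 1"] 1 \<open>1 \<le> i\<close> by simp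
      ultimately show ?thesis
        using cols[OF j, of x] 1 cnew[of x]
        by (cases "x = i") (auto simp: gk gj simp del: cle_append cle_Cons)
    next
      case 2
      then show ?thesis using cols[OF j, of x] cnew[of "Suc x"] by (simp add: gk gj del: cle_append)
    next
      case 3
      then show ?thesis using cols[OF j] by (simp add: gj)
    qed
  qed
  moreover have "\<forall>j. j \<notin> {1..n} \<longrightarrow> g j = []"
    using f k by (auto simp: g_def row_tableaux_def)
  moreover have "sorted (g j) \<and> length (g j) = l j \<and> set (g j) \<subseteq> {1..}" if "1 \<le> j" "j \<le> n" for j
    using rows[OF that] rows[OF k] snew fk \<open>1 \<le> i\<close> by (cases "j = k") (auto simp: g_def)
  ultimately have "g \<in> row_tableaux n m l" by (auto simp: row_tableaux_def)
  moreover have "rword n g = w" using rword_update[OF k, of f] by (simp add: g_def ut(2) u t)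
  ultimately show ?thesis by blast
qed


section \<open>Tableaux of normal shape\<close>

text \<open>A suffix of largest excess starts in some row \<open>k\<close> just after its letters
  \<open>i\<close>: it contains the \<open>Suc i\<close> of the rows up to \<open>k\<close>, but the
  \<open>i\<close> of the rows strictly above only. The empty suffix accounts for
  \<open>c' \<le> c\<close>. The offsets allow the Yamanouchi condition and dominance over a
  partition to be handled alike.\<close>

lemma eps_rword:
  assumes "\<And>k. 1 \<le> k \<Longrightarrow> k \<le> n \<Longrightarrow> sorted (f k)"
  shows "c' + eps i (rword n f) \<le> c \<longleftrightarrow> c' \<le> c \<and>
    (\<forall>k\<in>{1..n}. c' + (\<Sum>r\<in>{1..k}. count_list (f r) (Suc i)) \<le> c + (\<Sum>r\<in>{1..<k}. count_list (f r) i))"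
  using assms
proof (induction n)
  case (Suc n)
  have sums: "count_list (rword n f) x = (\<Sum>r\<in>{1..n}. count_list (f r) x)" for x n
    by (induction n) auto
  have "sorted (f (Suc n))" using Suc.prems by auto
  then have ef: "eps i (f (Suc n)) = count_list (f (Suc n)) (Suc i)" by (simp add: phi_eps_sorted)
  have "c' + eps i (rword (Suc n) f) \<le> c \<longleftrightarrow> c' + eps i (rword n f) \<le> c \<and>
     c' + (\<Sum>r\<in>{1..Suc n}. count_list (f r) (Suc i)) \<le> c + (\<Sum>r\<in>{1..<Suc n}. count_list (f r) i)"
    using eps_phi_count[of i "rword n f"] sums[of n i] sums[of n "Suc i"]
    by (auto simp: eps_append ef atLeastLessThanSuc_atLeastAtMost)
  also have "c' + eps i (rword n f) \<le> c \<longleftrightarrow> c' \<le> c \<and>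
    (\<forall>k\<in>{1..n}. c' + (\<Sum>r\<in>{1..k}. count_list (f r) (Suc i)) \<le> c + (\<Sum>r\<in>{1..<k}. count_list (f r) i))"
    using Suc by auto
  finally show ?case by (auto simp: atLeastAtMostSuc_conv)
qed simp

lemma count_list_rword: "count_list (rword n f) x = (\<Sum>r\<in>{1..n}. count_list (f r) x)"
  by (induction n) auto

definition normal_tableaux :: "nat list \<Rightarrow> (nat \<Rightarrow> nat list) set" where
  "normal_tableaux nu = row_tableaux (length nu) (\<lambda>_. 0) (part nu)"

text \<open>The highest weight tableau. Its content is its shape, so the content of its word
  recovers the shape.\<close>

definition super_tableau :: "nat list \<Rightarrow> nat \<Rightarrow> nat list" where
  "super_tableau nu k = replicate (part nu k) k"

lemma part_0 [simp]: "part nu 0 = 0"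
  by (simp add: part_def)

lemma part_beyond: "length nu < k \<Longrightarrow> part nu k = 0"
  by (simp add: part_def)

lemma part_antimono: "is_partition nu \<Longrightarrow> 1 \<le> j \<Longrightarrow> j \<le> k \<Longrightarrow> part nu k \<le> part nu j"
  unfolding is_partition_def part_def sorted_wrt_iff_nth_less
  by (cases "j = k") auto

lemma part_pos:
  assumes "is_partition nu" "1 \<le> k"
  shows "1 \<le> part nu k \<longleftrightarrow> k \<le> length nu"
proof (cases "k \<le> length nu")
  case True
  then have "part nu k \<in> set nu" using assms(2) by (simp add: part_def)
  then have "part nu k \<noteq> 0" using assms(1) by (metis is_partition_def)
  then show ?thesis using True by simp
qed (simp add: part_def)

lemma partition_part_eqI:
  assumes "is_partition nu" "is_partition nu'" "\<And>k. 1 \<le> k \<Longrightarrow> part nu k = part nu' k"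
  shows "nu = nu'"
proof (rule nth_equalityI)
  have "k \<le> length nu \<longleftrightarrow> k \<le> length nu'" if "1 \<le> k" for k
    using part_pos[OF assms(1) that] part_pos[OF assms(2) that] assms(3)[OF that] by simp
  from this[of "length nu"] this[of "length nu'"] show len: "length nu = length nu'"
    by (cases "length nu = 0"; cases "length nu' = 0") auto
  show "nu ! i = nu' ! i" if "i < length nu" for i
    using assms(3)[of "Suc i"] that len by (simp add: part_def)
qed

lemma cle_replicate: "cle x (replicate c k) = (if k \<le> x then c else 0)"
  by (simp add: cle_def)

lemma count_list_replicate: "count_list (replicate c k) x = (if x = k then c else 0)"
  by (induction c) auto

lemma part_eq_0: "k \<notin> {1..length nu} \<Longrightarrow> part nu k = 0"
  by (auto simp: part_def)

lemma super_tableau_in: "is_partition nu \<Longrightarrow> super_tableau nu \<in> normal_tableaux nu"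
  by (auto simp: normal_tableaux_def row_tableaux_def super_tableau_def part_eq_0 cle_replicate
      intro: part_antimono)

lemma count_super_tableau:
  assumes "1 \<le> k"
  shows "count_list (rword (length nu) (super_tableau nu)) k = part nu k"
  using assms part_beyond[of nu k]
  by (auto simp: count_list_rword super_tableau_def count_list_replicate)

lemma letters_rword: "set (rword n f) = (\<Union>k\<in>{1..n}. set (f k))"
  by (induction n) (auto simp: atLeastAtMostSuc_conv)

lemma row_tableaux_letters: "f \<in> row_tableaux n m l \<Longrightarrow> set (rword n f) \<subseteq> {1..}"
  by (auto simp: letters_rword row_tableaux_def)

lemma yamanouchi_super_tableau:
  assumes "is_partition nu"
  shows "yamanouchi (rword (length nu) (super_tableau nu))"
proof -
  have sorted: "sorted (super_tableau nu k)" for k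
    by (simp add: super_tableau_def)
  have "(\<Sum>r\<in>{1..k}. count_list (super_tableau nu r) (Suc i)) \<le> (\<Sum>r\<in>{1..<k}. count_list (super_tableau nu r) i)"
    if "1 \<le> i" for i k
    using that part_antimono[OF assms that, of "Suc i"]
    by (auto simp: super_tableau_def count_list_replicate)
  then have "eps i (rword (length nu) (super_tableau nu)) = 0" if "1 \<le> i" for i
    using that eps_rword[OF sorted, where n = "length nu" and c' = 0 and i = i and c = 0] by simp
  then show ?thesis
    using row_tableaux_letters[OF super_tableau_in[OF assms, unfolded normal_tableaux_def]]
    by (simp add: yamanouchi_def)
qed

lemma normal_tableaux_letters:
  assumes f: "f \<in> normal_tableaux nu" and k: "1 \<le> k" "k \<le> length nu" and x: "x \<in> set (f k)"
  shows "k \<le> x"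
proof -
  have "cle (k - 1) (f k) = 0"
    using k
  proof (induction k rule: dec_induct)
    case base
    then show ?case using f cle_0 by (auto simp: normal_tableaux_def row_tableaux_def)
  next
    case (step j)
    then have "j \<in> {1..<length nu}" by simp
    then have "\<forall>x. cle (Suc x) (f (Suc j)) \<le> cle x (f j)"
      using f unfolding normal_tableaux_def row_tableaux_def by simp
    from this[rule_format, of "j - 1"]
    have "cle (Suc (j - 1)) (f (Suc j)) \<le> cle (j - 1) (f j)" .
    moreover have "Suc (j - 1) = j" using step.hyps by simp
    ultimately show ?case using step by simp
  qed
  then show ?thesis using x k by (force simp: cle_def filter_empty_conv)
qed

text \<open>A letter \<open>Suc i\<close> larger than \<open>k\<close> in row \<open>k\<close> would
  have to be matched by an \<open>i\<close> in a higher row; but by induction the letters there are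
  bounded by the row number, which is smaller than \<open>i\<close>. Column strictness gives the
  bound from below.\<close>

lemma yamanouchi_normal:
  assumes f: "f \<in> normal_tableaux nu" and y: "yamanouchi (rword (length nu) f)"
  shows "f = super_tableau nu"
proof
  fix k
  have sorted: "sorted (f k)" if "1 \<le> k" "k \<le> length nu" for k
    using f that by (auto simp: normal_tableaux_def row_tableaux_def)
  have upper: "x \<le> k" if "1 \<le> k" "k \<le> length nu" "x \<in> set (f k)" for k x
    using that
  proof (induction k arbitrary: x rule: less_induct)
    case (less k)
    show ?case
    proof (rule ccontr)
      assume "\<not> x \<le> k"
      then obtain i where i: "x = Suc i" "k \<le> i" by (cases x) auto
      have "eps i (rword (length nu) f) = 0" using y i less.prems by (simp add: yamanouchi_def)
      then have "(\<Sum>r\<in>{1..k}. count_list (f r) (Suc i)) \<le> (\<Sum>r\<in>{1..<k}. count_list (f r) i)"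
        using eps_rword[OF sorted, where n = "length nu" and c' = 0 and i = i and c = 0] less.prems by auto
      also have "\<dots> = 0" using less.IH[where x = i] less.prems i by (fastforce simp: count_list_0_iff)
      finally have "count_list (f k) x = 0" using less.prems i by auto
      then show False using less.prems by (simp add: count_list_0_iff)
    qed
  qed
  show "f k = super_tableau nu k"
  proof (cases "k \<in> {1..length nu}")
    case True
    then have "\<forall>x\<in>set (f k). x = k" using upper[of k] normal_tableaux_letters[OF f, of k] by (auto intro: antisym)
    moreover have "length (f k) = part nu k" using f True by (auto simp: normal_tableaux_def row_tableaux_def)
    ultimately show ?thesis by (metis replicate_length_same super_tableau_def)
  next
    case False
    then have "f k = []" using f unfolding normal_tableaux_def row_tableaux_def by blast
    moreover have "part nu k = 0" using False by (auto simp: part_def)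
    ultimately show ?thesis by (simp add: super_tableau_def)
  qed
qed

lemma normal_tableaux_estep:
  assumes "f \<in> normal_tableaux nu" "1 \<le> i" "estep i (rword (length nu) f) w"
  obtains g where "g \<in> normal_tableaux nu" "rword (length nu) g = w"
  using row_tableaux_estep[OF assms(1)[unfolded normal_tableaux_def] assms(2,3)]
  unfolding normal_tableaux_def by blast

lemma normal_tableaux_estep_back:
  assumes "f \<in> normal_tableaux nu" "1 \<le> i" "estep i w (rword (length nu) f)"
  obtains g where "g \<in> normal_tableaux nu" "rword (length nu) g = w"
  using row_tableaux_estep_back[OF assms(1)[unfolded normal_tableaux_def] assms(2,3)]
  unfolding normal_tableaux_def by blast

lemma normal_tableaux_positive: "f \<in> normal_tableaux nu \<Longrightarrow> set (rword (length nu) f) \<subseteq> {1..}"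
  unfolding normal_tableaux_def by (rule row_tableaux_letters)

text \<open>Both tableaux are raised in parallel until their words are Yamanouchi. Then both are
  highest weight tableaux, and equal contents force equal shapes; injectivity of raising carries the
  equality back.\<close>

theorem normal_tableau_unique:
  assumes "is_partition nu" "is_partition nu'" "f \<in> normal_tableaux nu" "g \<in> normal_tableaux nu'"
    and "knuth_equiv (rword (length nu) f) (rword (length nu') g)"
  shows "nu = nu' \<and> f = g"
proof -
  have "w = rword (length nu) f \<Longrightarrow> ?thesis" if "set w \<subseteq> {1..}" for w
    using that assms(3-5)
  proof (induction w arbitrary: f g rule: yamanouchi_induct)
    case (yamanouchi w)
    have "yamanouchi (rword (length nu') g)"
      using yamanouchi_knuth[OF yamanouchi(5)] yamanouchi(1,2) by simp
    then have fg: "f = super_tableau nu" "g = super_tableau nu'"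
      using yamanouchi_normal[OF yamanouchi(3)] yamanouchi_normal[OF yamanouchi(4)] yamanouchi(1,2) by auto
    have "part nu k = part nu' k" if "1 \<le> k" for k
      using arg_cong[OF knuth_equiv_mset[OF yamanouchi(5)], of "\<lambda>M. count M k"]
        count_super_tableau[OF that, of nu] count_super_tableau[OF that, of nu']
      unfolding fg count_mset by simp
    then show ?case using partition_part_eqI[OF assms(1,2)] fg by blast
  next
    case (step i w w')
    have e: "estep i (rword (length nu) f) w'" using step.hyps(3) step.prems(1) by simp
    obtain f' where f': "f' \<in> normal_tableaux nu" "rword (length nu) f' = w'"
      using normal_tableaux_estep[OF step.prems(2) step.hyps(1) e] by blast
    obtain v where v: "estep i (rword (length nu') g) v" "knuth_equiv w' v"
      using knuth_equiv_estep[OF step.prems(4) e] by blast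
    obtain g' where g': "g' \<in> normal_tableaux nu'" "rword (length nu') g' = v"
      using normal_tableaux_estep[OF step.prems(3) step.hyps(1) v(1)] by blast
    have eq: "nu = nu' \<and> f' = g'"
      by (rule step.IH) (use f' g' v(2) in auto)
    then have "estep i (rword (length nu) g) w'" using v(1) f'(2) g'(2) by simp
    then have "rword (length nu) f = rword (length nu) g" by (rule estep_inj[OF e])
    moreover have "g \<in> normal_tableaux nu" using step.prems(3) eq by simp
    ultimately show ?case
      using rword_inj[OF step.prems(2)[unfolded normal_tableaux_def]] eq unfolding normal_tableaux_def by blast
  qed
  from this[OF normal_tableaux_positive[OF assms(3)] refl] show ?thesis .
qed

text \<open>The content of a Yamanouchi word is a partition, and the word is equivalent to that of
  the highest weight tableau of this shape. The raising steps are then undone one at a time inside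
  the tableaux of the same shape.\<close>

theorem normal_tableau_exists:
  assumes "set w \<subseteq> {1..}"
  shows "\<exists>nu f. is_partition nu \<and> f \<in> normal_tableaux nu \<and> knuth_equiv (rword (length nu) f) w"
  using assms
proof (induction w rule: yamanouchi_induct)
  case (yamanouchi w)
  define N where "N = Max (insert 0 (set w))"
  have down: "k \<in> set w" if "j \<in> set w" "1 \<le> k" "k \<le> j" for j k
    using yamanouchi_count_list[OF yamanouchi that(2,3)] that(1) by (metis count_list_0_iff le_zero_eq)
  \<comment> \<open>The letters of a Yamanouchi word form an initial segment of the positive
    integers, so the list of multiplicities up to \<open>p\<close> has no zero entry.\<close>
  define p where "p = card (set w)"
  have setw: "set w = {1..p}"
  proof (cases "w = []")
    case False
    have "set w = {1..N}"
    proof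
      show "set w \<subseteq> {1..N}" using yamanouchi by (auto simp: N_def yamanouchi_def)
      have "N \<in> set w" using Max_in[of "set w"] False by (simp add: N_def max_def)
      then show "{1..N} \<subseteq> set w" using down[of N] by auto
    qed
    then show ?thesis by (simp add: p_def)
  qed (simp add: p_def)
  define mu where "mu = map (count_list w) [1..<Suc p]"
  have part_mu: "part mu k = count_list w k" if "1 \<le> k" for k
    using that setw by (auto simp: part_def mu_def count_list_0_iff simp del: upt_Suc)
  have "is_partition mu"
    unfolding is_partition_def mu_def sorted_wrt_map
    using yamanouchi_count_list[OF yamanouchi] setw
    by (auto simp: count_list_0_iff sorted_wrt_iff_nth_less simp del: upt_Suc)
  moreover have "knuth_equiv (rword (length mu) (super_tableau mu)) w"
  proof (rule yamanouchi_knuth_equivI)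
    show "yamanouchi (rword (length mu) (super_tableau mu))"
      by (rule yamanouchi_super_tableau) fact
    show "mset (rword (length mu) (super_tableau mu)) = mset w"
    proof (rule multiset_eqI)
      fix k
      show "count (mset (rword (length mu) (super_tableau mu))) k = count (mset w) k"
      proof (cases "k = 0")
        case True
        have "0 \<notin> set w" "0 \<notin> set (rword (length mu) (super_tableau mu))"
          using setw normal_tableaux_positive[OF super_tableau_in[OF \<open>is_partition mu\<close>]] by auto
        then show ?thesis using True by (simp add: count_mset count_list_0_iff)
      next
        case False
        then show ?thesis using count_super_tableau[of k mu] part_mu[of k] by (simp add: count_mset)
      qed
    qed
  qed fact
  ultimately show ?case using super_tableau_in by blast
next
  case (step i w w')
  then obtain nu f where nu: "is_partition nu" "f \<in> normal_tableaux nu" "knuth_equiv (rword (length nu) f) w'"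
    by blast
  obtain v where v: "estep i v (rword (length nu) f)" "knuth_equiv w v"
    using knuth_equiv_estep_back[OF knuth_equiv_sym[OF nu(3)] step.hyps(3)] by blast
  obtain g where "g \<in> normal_tableaux nu" "rword (length nu) g = v"
    using normal_tableaux_estep_back[OF nu(2) step.hyps(1) v(1)] by blast
  then show ?case using nu(1) knuth_equiv_sym[OF v(2)] by blast
qed

section \<open>Counting the fibres of rectification\<close>

definition lr_tableaux :: "nat \<Rightarrow> (nat \<Rightarrow> nat) \<Rightarrow> (nat \<Rightarrow> nat) \<Rightarrow> nat list \<Rightarrow> (nat \<Rightarrow> nat list) set" where
  "lr_tableaux n m l nu = {f \<in> row_tableaux n m l. yamanouchi (rword n f) \<and>
     (\<forall>k\<ge>1. count_list (rword n f) k = part nu k)}"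

lemma finite_row_tableaux_mset: "finite {f \<in> row_tableaux n m l. mset (rword n f) = M}"
proof (rule finite_imageD)
  obtain v where "mset v = M" using ex_mset by blast
  then have "finite {w. mset w = M}" using mset_eq_finite[of v] by simp
  then show "finite (rword n ` {f \<in> row_tableaux n m l. mset (rword n f) = M})"
    by (rule rev_finite_subset) auto
  show "inj_on (rword n) {f \<in> row_tableaux n m l. mset (rword n f) = M}"
    by (auto intro!: inj_onI intro: rword_inj)
qed

text \<open>Raising maps the fibre over \<open>w\<close> bijectively onto the fibre over
  \<open>w'\<close>, because it respects Knuth classes in both directions and preserves the shape.
  Over a Yamanouchi word the fibre consists of all tableaux with a Yamanouchi word of the same
  content, as these words are all equivalent.\<close>

theorem card_rectification_fiber:
  assumes nu: "is_partition nu" and "g \<in> normal_tableaux nu"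
  shows "card {f \<in> row_tableaux n m l. knuth_equiv (rword n f) (rword (length nu) g)} =
    card (lr_tableaux n m l nu)"
proof -
  define F where "F w = {f \<in> row_tableaux n m l. knuth_equiv (rword n f) w}" for w
  have "w = rword (length nu) g \<Longrightarrow> card (F w) = card (lr_tableaux n m l nu)" if "set w \<subseteq> {1..}" for w
    using that assms(2)
  proof (induction w arbitrary: g rule: yamanouchi_induct)
    case (yamanouchi w)
    then have g: "g = super_tableau nu" using yamanouchi_normal by metis
    have "knuth_equiv (rword n f) w \<longleftrightarrow> yamanouchi (rword n f) \<and>
        (\<forall>k\<ge>1. count_list (rword n f) k = part nu k)" if f: "f \<in> row_tableaux n m l" for f
    proof
      assume "knuth_equiv (rword n f) w"
      then show "yamanouchi (rword n f) \<and> (\<forall>k\<ge>1. count_list (rword n f) k = part nu k)"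
        using yamanouchi_knuth[of "rword n f" w] knuth_equiv_mset[of "rword n f" w] yamanouchi(1,2)
          count_super_tableau[of _ nu] g
        by (metis count_mset)
    next
      assume *: "yamanouchi (rword n f) \<and> (\<forall>k\<ge>1. count_list (rword n f) k = part nu k)"
      have "count_list (rword n f) k = count_list w k" for k
      proof (cases "k = 0")
        case True
        have "0 \<notin> set (rword n f)" "0 \<notin> set w" using * yamanouchi by (auto simp: yamanouchi_def)
        then show ?thesis using True by (simp add: count_list_0_iff)
      next
        case False
        then show ?thesis using * yamanouchi(2) count_super_tableau[of k nu] g by simp
      qed
      then show "knuth_equiv (rword n f) w"
        using * yamanouchi by (intro yamanouchi_knuth_equivI) (auto simp: multiset_eq_iff count_mset)
    qed
    then show ?case by (auto simp: F_def lr_tableaux_def intro!: arg_cong[of _ _ card])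
  next
    case (step i w w')
    have e: "estep i (rword (length nu) g) w'" using step.hyps(3) step.prems(1) by simp
    obtain g' where g': "g' \<in> normal_tableaux nu" "rword (length nu) g' = w'"
      using normal_tableaux_estep[OF step.prems(2) step.hyps(1) e] by blast
    have "bij_betw (rword n) (F w) (rword n ` F w)" "bij_betw (rword n) (F w') (rword n ` F w')"
      by (auto intro!: bij_betw_imageI inj_onI intro: rword_inj simp: F_def)
    \<comment> \<open>Determinism and injectivity of \<open>estep\<close> turn the two descriptions
      into mutually inverse functions.\<close>
    moreover have "bij_betw (\<lambda>x. THE y. estep i x y) (rword n ` F w) (rword n ` F w')"
    proof (rule bij_betw_byWitness[where f' = "\<lambda>y. THE x. estep i x y"])
      have the1: "(THE y. estep i x y) = y" "(THE x. estep i x y) = x" if "estep i x y" for x y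
        using that estep_deterministic estep_inj by blast+
      have fwd: "\<exists>f'\<in>F w'. estep i (rword n f) (rword n f')" if "f \<in> F w" for f
      proof -
        obtain v where "estep i (rword n f) v" "knuth_equiv w' v"
          using knuth_equiv_estep[OF knuth_equiv_sym step.hyps(3)] \<open>f \<in> F w\<close> unfolding F_def by blast
        then show ?thesis
          using row_tableaux_estep[of f n m l i v] \<open>f \<in> F w\<close> step.hyps(1) knuth_equiv_sym unfolding F_def by auto
      qed
      have bwd: "\<exists>f\<in>F w. estep i (rword n f) (rword n f')" if "f' \<in> F w'" for f'
      proof -
        obtain v where "estep i v (rword n f')" "knuth_equiv w v"
          using knuth_equiv_estep_back[OF knuth_equiv_sym step.hyps(3)] \<open>f' \<in> F w'\<close> unfolding F_def by blast
        then show ?thesis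
          using row_tableaux_estep_back[of f' n m l i v] \<open>f' \<in> F w'\<close> step.hyps(1) knuth_equiv_sym
          unfolding F_def by auto
      qed
      show "\<forall>a\<in>rword n ` F w. (THE x. estep i x (THE y. estep i a y)) = a"
        using fwd the1 by fastforce
      show "\<forall>b\<in>rword n ` F w'. (THE y. estep i (THE x. estep i x b) y) = b"
        using bwd the1 by fastforce
      show "(\<lambda>x. THE y. estep i x y) ` rword n ` F w \<subseteq> rword n ` F w'"
        using fwd the1 by fastforce
      show "(\<lambda>y. THE x. estep i x y) ` rword n ` F w' \<subseteq> rword n ` F w"
        using bwd the1 by fastforce
    qed
    ultimately have "card (F w) = card (F w')" by (metis bij_betw_same_card)
    also have "\<dots> = card (lr_tableaux n m l nu)" using step.IH[of g'] g' by simp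
    finally show ?case .
  qed
  from this[OF normal_tableaux_positive[OF assms(2)] refl] show ?thesis by (simp add: F_def)
qed

section \<open>Tableaux on diagrams and their rows\<close>

lemma diagram_iff:
  "(i, j) \<in> diagram (lam, mu) \<longleftrightarrow> (\<exists>k c. i = int k \<and> j = int c \<and> part mu k < c \<and> c \<le> part lam k)"
proof -
  have "1 \<le> k" if "part mu k < c" "c \<le> part lam k" for k c
    using that by (cases k) auto
  then show ?thesis
    by (fastforce simp: diagram_def young_def)
qed

lemma diagram_int_iff [simp]: "(int k, int c) \<in> diagram (lam, mu) \<longleftrightarrow> part mu k < c \<and> c \<le> part lam k"
  by (simp add: diagram_iff)

lemma finite_diagram [simp]: "finite (diagram d)"
proof -
  have "young lam \<subseteq> (\<Union>k\<in>{1..length lam}. (\<lambda>j. (int k, int j)) ` {..part lam k})" for lam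
    unfolding young_def using part_eq_0[of _ lam] by (fastforce simp: image_iff)
  then have "finite (young lam)" for lam by (rule finite_subset) auto
  then show ?thesis by (simp add: diagram_def)
qed

lemma diagram_normal [simp]: "diagram (nu, []) = young nu"
  by (auto simp: diagram_def young_def part_def)

lemma is_skew_normal: "is_partition nu \<Longrightarrow> is_skew (nu, [])"
  by (auto simp: is_skew_def is_partition_def part_def)

definition diagram_rows :: "skew \<Rightarrow> (box \<Rightarrow> 'a) \<Rightarrow> nat \<Rightarrow> 'a list" where
  "diagram_rows d L k = map (\<lambda>c. L (int k, int c)) [Suc (part (snd d) k)..<Suc (part (fst d) k)]"

lemma length_diagram_rows [simp]: "length (diagram_rows d L k) = part (fst d) k - part (snd d) k"
  by (simp add: diagram_rows_def del: upt_Suc)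

lemma diagram_rows_nth:
  "t < part lam k - part mu k \<Longrightarrow> diagram_rows (lam, mu) L k ! t = L (int k, int (part mu k + 1 + t))"
  by (simp add: diagram_rows_def nth_append del: upt_Suc)

lemma rword_eq_concat: "rword n f = concat (map f (rev [1..<Suc n]))"
  by (induction n) auto

lemma concat_map_filter: "(\<And>x. \<not> P x \<Longrightarrow> f x = []) \<Longrightarrow> concat (map f (filter P xs)) = concat (map f xs)"
  by (induction xs) auto

lemma sorted_list_of_set_map_int:
  assumes "sorted ks" "distinct ks"
  shows "sorted_list_of_set (set (map int ks)) = map int ks"
proof (rule sorted_list_of_set.idem_if_sorted_distinct)
  show "sorted (map int ks)" using assms(1) by (induction ks) auto
  show "distinct (map int ks)" using assms(2) by (simp add: distinct_map inj_on_def)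
qed

text \<open>\<open>row_word\<close> visits only the rows that occur in the diagram,
  \<open>rword\<close> visits all of them; the rows rejected by \<open>P\<close> contribute empty
  words.\<close>

lemma row_word_diagram: "row_word (diagram (lam, mu)) L = rword (length lam) (diagram_rows (lam, mu) L)"
proof -
  define D where "D = diagram (lam, mu)"
  define P where "P k \<longleftrightarrow> part mu k < part lam k" for k
  have cols: "map (\<lambda>j. L (int k, j)) (sorted_list_of_set {j. (int k, j) \<in> D}) = diagram_rows (lam, mu) L k" for k
  proof -
    have "{j. (int k, j) \<in> D} = set (map int [Suc (part mu k)..<Suc (part lam k)])"
    proof (intro set_eqI iffI)
      fix j
      assume "j \<in> {j. (int k, j) \<in> D}"
      then obtain c where "j = int c" "part mu k < c" "c \<le> part lam k" by (auto simp: D_def diagram_iff)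
      then show "j \<in> set (map int [Suc (part mu k)..<Suc (part lam k)])" by (simp del: upt_Suc)
    qed (auto simp: D_def simp del: upt_Suc)
    moreover have "sorted_list_of_set (set (map int [Suc (part mu k)..<Suc (part lam k)])) =
        map int [Suc (part mu k)..<Suc (part lam k)]"
      by (rule sorted_list_of_set_map_int) (simp_all del: upt_Suc)
    ultimately show ?thesis by (simp add: diagram_rows_def del: upt_Suc)
  qed
  have in_fst: "int k \<in> fst ` D \<longleftrightarrow> P k" for k
  proof
    assume "P k"
    then have "(int k, int (part lam k)) \<in> D" by (simp add: D_def P_def)
    then show "int k \<in> fst ` D" by force
  qed (auto simp: D_def P_def diagram_iff)
  have P_range: "k \<in> {1..length lam}" if "P k" for k
    using that part_eq_0[of k lam] unfolding P_def by (metis not_less_zero)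
  have "fst ` D = set (map int (filter P [1..<Suc (length lam)]))"
  proof (intro set_eqI iffI)
    fix i
    assume i: "i \<in> fst ` D"
    then obtain k where k: "i = int k" by (auto simp: D_def diagram_iff)
    then have "P k" using i in_fst by simp
    then show "i \<in> set (map int (filter P [1..<Suc (length lam)]))"
      using P_range[of k] k by (simp del: upt_Suc)
  next
    fix i
    assume "i \<in> set (map int (filter P [1..<Suc (length lam)]))"
    then obtain k where "i = int k" "P k" by (auto simp del: upt_Suc)
    then show "i \<in> fst ` D" using in_fst by simp
  qed
  moreover have "sorted_list_of_set (set (map int (filter P [1..<Suc (length lam)]))) =
      map int (filter P [1..<Suc (length lam)])"
    by (rule sorted_list_of_set_map_int) (simp_all add: sorted_wrt_filter del: upt_Suc)
  ultimately have "row_word D L = concat (map (diagram_rows (lam, mu) L) (filter P (rev [1..<Suc (length lam)])))"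
    by (simp add: row_word_def rev_map rev_filter comp_def cols del: upt_Suc)
  also have "\<dots> = concat (map (diagram_rows (lam, mu) L) (rev [1..<Suc (length lam)]))"
    by (rule concat_map_filter) (simp add: P_def diagram_rows_def del: upt_Suc)
  finally show ?thesis by (simp add: D_def rword_eq_concat)
qed

lemma mset_sorted_list_of_set': "mset (sorted_list_of_set A) = mset_set A"
  by (cases "finite A") (use mset_set_set[of "sorted_list_of_set A"] in auto)

lemma image_mset_sum: "image_mset f (\<Sum>i\<in>A. M i) = (\<Sum>i\<in>A. image_mset f (M i))"
  by (induction A rule: infinite_finite_induct) auto

lemma mset_row_word:
  assumes "finite D"
  shows "mset (row_word D L) = image_mset L (mset_set D)"
proof -
  have fin: "finite {j. (i, j) \<in> D}" for i
    using assms by (rule finite_surj[where f = snd]) force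
  have "mset (row_word D L) = (\<Sum>i\<leftarrow>rev (sorted_list_of_set (fst ` D)). image_mset (\<lambda>j. L (i, j)) (mset_set {j. (i, j) \<in> D}))"
    by (simp add: row_word_def mset_concat comp_def mset_sorted_list_of_set')
  also have "\<dots> = (\<Sum>i\<in>fst ` D. image_mset (\<lambda>j. L (i, j)) (mset_set {j. (i, j) \<in> D}))"
    using assms by (simp add: sum_list_distinct_conv_sum_set)
  also have "\<dots> = image_mset L (\<Sum>i\<in>fst ` D. image_mset (Pair i) (mset_set {j. (i, j) \<in> D}))"
    by (simp only: image_mset_sum multiset.map_comp comp_def)
  also have "(\<Sum>i\<in>fst ` D. image_mset (Pair i) (mset_set {j. (i, j) \<in> D})) = mset_set D"
  proof (rule multiset_eqI)
    fix x :: box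
    obtain i j where x: "x = (i, j)" by fastforce
    have "count (image_mset (Pair k) (mset_set {j. (k, j) \<in> D})) x = (if k = i then if x \<in> D then 1 else 0 else 0)" for k
      using fin by (auto simp: x image_mset_mset_set inj_on_def count_mset_set')
    then have "count (\<Sum>i\<in>fst ` D. image_mset (Pair i) (mset_set {j. (i, j) \<in> D})) x =
        (if i \<in> fst ` D then if x \<in> D then 1 else 0 else 0)"
      using assms by (simp add: count_sum)
    moreover have "i \<in> fst ` D" if "x \<in> D" using that x by force
    ultimately show "count (\<Sum>i\<in>fst ` D. image_mset (Pair i) (mset_set {j. (i, j) \<in> D})) x = count (mset_set D) x"
      using assms by (simp add: count_mset_set')
  qed
  finally show ?thesis .
qed

lemma cle_nth: "sorted r \<Longrightarrow> t < length r \<Longrightarrow> t < cle x r \<longleftrightarrow> r ! t \<le> x"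
proof (induction r arbitrary: t)
  case (Cons y r)
  have "cle x r = 0" if "\<not> y \<le> x"
    using Cons.prems(1) that by (auto simp: cle_def filter_empty_conv)
  moreover have "y \<le> r ! s" if "s < length r" for s
    using Cons.prems(1) that by simp
  ultimately show ?case using Cons by (cases t) (auto, (meson order_trans less_Suc_eq_le)?)
qed simp

definition skew_tableaux :: "skew \<Rightarrow> (nat \<Rightarrow> nat list) set" where
  "skew_tableaux d = row_tableaux (length (fst d)) (part (snd d)) (\<lambda>k. part (fst d) k - part (snd d) k)"

lemma SSYT_iff_skew_tableaux:
  assumes skew: "is_skew (lam, mu)" and ext: "L \<in> diagram (lam, mu) \<rightarrow>\<^sub>E UNIV"
  shows "L \<in> SSYT (diagram (lam, mu)) {1..} \<longleftrightarrow> diagram_rows (lam, mu) L \<in> skew_tableaux (lam, mu)"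
proof
  define f where "f = diagram_rows (lam, mu) L"
  have len: "length (f k) = part lam k - part mu k" for k by (simp add: f_def)
  have nth: "f k ! t = L (int k, int (part mu k + 1 + t))" if "t < part lam k - part mu k" for k t
    using that by (simp add: f_def diagram_rows_nth)
  have nth': "f k ! (c - part mu k - 1) = L (int k, int c)" if "part mu k < c" "c \<le> part lam k" for k c
    using nth[of "c - part mu k - 1" k] that by simp
  have part_lam: "part lam (Suc k) \<le> part lam k" and part_mu: "part mu (Suc k) \<le> part mu k" if "1 \<le> k" for k
    using skew that by (auto simp: is_skew_def intro: part_antimono)
  have sub: "part mu k \<le> part lam k" for k using skew by (cases "k = 0") (auto simp: is_skew_def)
  {
    assume L: "L \<in> SSYT (diagram (lam, mu)) {1..}"
    have srt: "sorted (f k)" for k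
    proof -
      have "f k ! s \<le> f k ! t" if "s < t" "t < length (f k)" for s t
      proof -
        have "(int k, int (part mu k + 1 + s)) \<in> diagram (lam, mu)"
          "(int k, int (part mu k + 1 + t)) \<in> diagram (lam, mu)"
          unfolding diagram_int_iff using that by (auto simp: len)
        moreover have "int (part mu k + 1 + s) < int (part mu k + 1 + t)" using that by simp
        ultimately have "L (int k, int (part mu k + 1 + s)) \<le> L (int k, int (part mu k + 1 + t))"
          using L unfolding SSYT_def by blast
        then show ?thesis using nth[of s k] nth[of t k] that len[of k] by simp
      qed
      then show ?thesis by (auto simp: sorted_iff_nth_mono le_less)
    qed
    have col: "L (int k, int c) < L (int (Suc k), int c)"
      if "part mu k < c" "c \<le> part lam (Suc k)" "1 \<le> k" for k c
    proof -
      have "part mu (Suc k) < c" "c \<le> part lam k"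
        using that part_lam[of k] part_mu[of k] by auto
      then have "(int k, int c) \<in> diagram (lam, mu)" "(int (Suc k), int c) \<in> diagram (lam, mu)"
        using that by (simp_all del: of_nat_Suc)
      moreover have "int k < int (Suc k)" by simp
      ultimately show ?thesis using L unfolding SSYT_def by blast
    qed
    have "part mu (Suc k) + cle (Suc x) (f (Suc k)) \<le> part mu k + cle x (f k)" if "1 \<le> k" for k x
    proof (rule ccontr)
      \<comment> \<open>The right-most column of row \<open>Suc k\<close> with an entry at most
        \<open>Suc x\<close>. If the inequality failed, the box above it would lie in row
        \<open>k\<close> and hold an entry at most \<open>x\<close>, although it lies beyond the
        \<open>cle x (f k)\<close> boxes with such entries.\<close>
      define c where "c = part mu (Suc k) + cle (Suc x) (f (Suc k))"
      assume "\<not> ?thesis"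
      then have c: "part mu k + cle x (f k) < c" by (simp add: c_def)
      have le: "c \<le> part lam (Suc k)"
        using cle_le_length[of "Suc x" "f (Suc k)"] sub[of "Suc k"] by (simp add: c_def len)
      have "c - part mu (Suc k) - 1 < cle (Suc x) (f (Suc k))"
        using c part_mu[OF that] by (simp add: c_def)
      then have "L (int (Suc k), int c) \<le> Suc x"
        using cle_nth[OF srt, of "c - part mu (Suc k) - 1" "Suc k" "Suc x"] nth'[of "Suc k" c] le c part_mu[OF that]
        by (simp add: len)
      then have "L (int k, int c) \<le> x" using col[of k c] c le that by simp
      then have "c - part mu k - 1 < cle x (f k)"
        using cle_nth[OF srt, of "c - part mu k - 1" k x] nth'[of k c] le c part_lam[OF that] by (simp add: len)
      then show False using c by simp
    qed
    moreover have "f k = []" if "k \<notin> {1..length lam}" for k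
      using part_eq_0[OF that] len[of k] by simp
    moreover have "set (f k) \<subseteq> {1..}" for k
    proof
      fix y
      assume "y \<in> set (f k)"
      then obtain t where t: "t < part lam k - part mu k" "y = f k ! t" by (auto simp: in_set_conv_nth len)
      then have "(int k, int (part mu k + 1 + t)) \<in> diagram (lam, mu)" unfolding diagram_int_iff by simp
      then have "L (int k, int (part mu k + 1 + t)) \<in> {1..}"
        using L unfolding SSYT_def by blast
      then show "y \<in> {1..}" using nth[OF t(1)] t(2) by simp
    qed
    ultimately show "diagram_rows (lam, mu) L \<in> skew_tableaux (lam, mu)"
      using srt len by (auto simp: skew_tableaux_def row_tableaux_def f_def)
  next
    assume "diagram_rows (lam, mu) L \<in> skew_tableaux (lam, mu)"
    then have f: "f \<in> skew_tableaux (lam, mu)" by (simp add: f_def)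
    have in_range: "k \<in> {1..length lam}" if "part mu k < c" "c \<le> part lam k" for k c
      using that part_eq_0[of k lam] by (cases "k \<in> {1..length lam}") auto
    have srt: "sorted (f k)" if "k \<in> {1..length lam}" for k
      using f that by (auto simp: skew_tableaux_def row_tableaux_def)
    have pos: "L (int k, int c) \<ge> 1" if "part mu k < c" "c \<le> part lam k" for k c
    proof -
      have "L (int k, int c) \<in> set (f k)"
        using nth'[OF that] nth_mem[of "c - part mu k - 1" "f k"] that by (simp add: len)
      then show ?thesis using f in_range[OF that] by (auto simp: skew_tableaux_def row_tableaux_def)
    qed
    have row: "L (int k, int c) \<le> L (int k, int c')"
      if "part mu k < c" "c \<le> part lam k" "part mu k < c'" "c' \<le> part lam k" "c < c'" for k c c'
      using srt[OF in_range[OF that(1,2)]] nth'[OF that(1,2)] nth'[OF that(3,4)] that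
        sorted_nth_mono[of "f k" "c - part mu k - 1" "c' - part mu k - 1"] by (simp add: len)
    have col1: "L (int k, int c) < L (int (Suc k), int c)"
      if "part mu k < c" "c \<le> part lam (Suc k)" "1 \<le> k" for k c
    proof -
      have bounds: "part mu (Suc k) < c" "c \<le> part lam k"
        using that part_lam[of k] part_mu[of k] by auto
      obtain x where x: "L (int (Suc k), int c) = Suc x"
        using pos[OF bounds(1) \<open>c \<le> part lam (Suc k)\<close>] by (metis Suc_le_D One_nat_def)
      have k: "k \<in> {1..length lam}" "Suc k \<in> {1..length lam}"
        using in_range[of k c] in_range[of "Suc k" c] that bounds by auto
      have "c - part mu (Suc k) - 1 < cle (Suc x) (f (Suc k))"
        using cle_nth[OF srt[OF k(2)], of "c - part mu (Suc k) - 1" "Suc x"] nth'[of "Suc k" c] bounds that x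
        by (simp add: len)
      moreover have "part mu (Suc k) + cle (Suc x) (f (Suc k)) \<le> part mu k + cle x (f k)"
        using f k by (auto simp: skew_tableaux_def row_tableaux_def)
      ultimately have "c - part mu k - 1 < cle x (f k)" using bounds that by simp
      then have "L (int k, int c) \<le> x"
        using cle_nth[OF srt[OF k(1)], of "c - part mu k - 1" x] nth'[of k c] bounds that by (simp add: len)
      then show ?thesis by (simp only: x less_Suc_eq_le)
    qed
    have col: "L (int k, int c) < L (int (k + Suc d), int c)"
      if "part mu k < c" "c \<le> part lam (k + Suc d)" "1 \<le> k" for k c d
      using that
    proof (induction d)
      case 0
      then show ?case using col1[of k c] by simp
    next
      case (Suc d)
      have "part mu (k + Suc d) \<le> part mu k"
        using skew \<open>1 \<le> k\<close> by (auto simp: is_skew_def intro: part_antimono)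
      then have "L (int (k + Suc d), int c) < L (int (Suc (k + Suc d)), int c)"
        using col1[of "k + Suc d" c] Suc.prems by simp
      moreover have "c \<le> part lam (k + Suc d)" using Suc.prems part_lam[of "k + Suc d"] by simp
      ultimately show ?case using Suc by simp
    qed
    show "L \<in> SSYT (diagram (lam, mu)) {1..}"
      unfolding SSYT_def
    proof (intro CollectI conjI allI impI)
      have "L x \<in> {1..}" if "x \<in> diagram (lam, mu)" for x
      proof -
        obtain i j where "x = (i, j)" by fastforce
        with that obtain k c where "x = (int k, int c)" "part mu k < c" "c \<le> part lam k"
          by (auto simp: diagram_iff)
        then show ?thesis using pos by simp
      qed
      then show "L \<in> diagram (lam, mu) \<rightarrow>\<^sub>E {1..}"
        using ext by (simp add: PiE_def Pi_def)
    next
      fix i j j'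
      assume *: "(i, j) \<in> diagram (lam, mu) \<and> (i, j') \<in> diagram (lam, mu) \<and> j < j'"
      then obtain k c where k: "i = int k" "j = int c" "part mu k < c" "c \<le> part lam k"
        using diagram_iff[of i j] by blast
      then obtain c' where "j' = int c'" "part mu k < c'" "c' \<le> part lam k"
        using * diagram_iff[of i j'] by auto
      then show "L (i, j) \<le> L (i, j')" using row[of k c c'] k * by simp
    next
      fix i i' j
      assume *: "(i, j) \<in> diagram (lam, mu) \<and> (i', j) \<in> diagram (lam, mu) \<and> i < i'"
      then obtain k c where k: "i = int k" "j = int c" "part mu k < c" "c \<le> part lam k"
        using diagram_iff[of i j] by blast
      then obtain k' where k': "i' = int k'" "c \<le> part lam k'"
        using * diagram_iff[of i' j] by auto
      obtain e where e: "k' = k + Suc e" using * k k' less_imp_Suc_add[of k k'] by auto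
      have "1 \<le> k" using in_range[OF k(3,4)] by simp
      then show "L (i, j) < L (i', j)" using col[of k c e] k k' e by simp
    qed
  }
qed

lemma bij_betw_diagram_rows:
  assumes "is_skew (lam, mu)"
  shows "bij_betw (diagram_rows (lam, mu)) (SSYT (diagram (lam, mu)) {1..}) (skew_tableaux (lam, mu))"
proof (rule bij_betw_imageI)
  let ?D = "diagram (lam, mu)"
  show "inj_on (diagram_rows (lam, mu)) (SSYT ?D {1..})"
  proof (rule inj_onI)
    fix L L'
    assume L: "L \<in> SSYT ?D {1..}" "L' \<in> SSYT ?D {1..}" and eq: "diagram_rows (lam, mu) L = diagram_rows (lam, mu) L'"
    have "L x = L' x" if "x \<in> ?D" for x
    proof -
      obtain i j where "x = (i, j)" by fastforce
      with that obtain k c where x: "x = (int k, int c)" "part mu k < c" "c \<le> part lam k"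
        by (auto simp: diagram_iff)
      show ?thesis
        using diagram_rows_nth[of "c - part mu k - 1" lam k mu L]
          diagram_rows_nth[of "c - part mu k - 1" lam k mu L'] eq x by simp
    qed
    then show "L = L'" using L by (intro PiE_ext[of L ?D "\<lambda>_. {1..}" L']) (auto simp: SSYT_def)
  qed
  have "f \<in> diagram_rows (lam, mu) ` SSYT ?D {1..}" if f: "f \<in> skew_tableaux (lam, mu)" for f
  proof -
    define L where "L = (\<lambda>x\<in>?D. f (nat (fst x)) ! (nat (snd x) - part mu (nat (fst x)) - 1))"
    have len: "length (f k) = part lam k - part mu k" for k
    proof (cases "k \<in> {1..length lam}")
      case False
      then show ?thesis using f part_eq_0[OF False] unfolding skew_tableaux_def row_tableaux_def by auto
    qed (use f in \<open>auto simp: skew_tableaux_def row_tableaux_def\<close>)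
    have "diagram_rows (lam, mu) L = f"
    proof
      fix k
      show "diagram_rows (lam, mu) L k = f k"
      proof (rule nth_equalityI)
        fix t
        assume "t < length (diagram_rows (lam, mu) L k)"
        then have t: "t < part lam k - part mu k" by simp
        then have "(int k, int (part mu k + 1 + t)) \<in> ?D" unfolding diagram_int_iff by simp
        then have "L (int k, int (part mu k + 1 + t)) = f k ! t"
          unfolding L_def by (simp del: of_nat_add of_nat_Suc)
        then show "diagram_rows (lam, mu) L k ! t = f k ! t" using diagram_rows_nth[OF t, of L] by simp
      qed (simp add: len)
    qed
    moreover have "L \<in> ?D \<rightarrow>\<^sub>E UNIV" by (simp add: L_def)
    ultimately show ?thesis using SSYT_iff_skew_tableaux[OF assms] f by (metis image_eqI)
  qed
  moreover have "SSYT ?D {1..} \<subseteq> ?D \<rightarrow>\<^sub>E UNIV" by (auto simp: SSYT_def)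
  ultimately show "diagram_rows (lam, mu) ` SSYT ?D {1..} = skew_tableaux (lam, mu)"
    using SSYT_iff_skew_tableaux[OF assms] by blast
qed

lemma part_Nil [simp]: "part [] = (\<lambda>_. 0)"
  by (auto simp: part_def)

lemma skew_tableaux_normal: "skew_tableaux (nu, []) = normal_tableaux nu"
  by (simp add: skew_tableaux_def normal_tableaux_def)

section \<open>The symmetry between shape and weight\<close>

lemma cle_eq_sum: "set r \<subseteq> {1..} \<Longrightarrow> cle x r = (\<Sum>y\<in>{1..x}. count_list r y)"
proof (induction x)
  case 0
  then show ?case using cle_0[OF 0] by simp
next
  case (Suc x)
  then show ?case using cle_Suc[of x r] by simp
qed

text \<open>A sorted row is determined by the multiplicities of its letters, so a tableau amounts to
  a matrix, and any matrix can be read back as sorted rows.\<close>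

definition transpose_rows :: "nat \<Rightarrow> nat \<Rightarrow> (nat \<Rightarrow> nat list) \<Rightarrow> nat \<Rightarrow> nat list" where
  "transpose_rows n' n f x =
     (if x \<in> {1..n'} then concat (map (\<lambda>k. replicate (count_list (f k) x) k) [1..<Suc n]) else [])"

lemma set_transpose_rows: "set (transpose_rows n' n f x) \<subseteq> {1..n}"
proof
  fix y
  assume "y \<in> set (transpose_rows n' n f x)"
  then have "\<exists>k\<in>set [1..<Suc n]. y \<in> set (replicate (count_list (f k) x) k)"
    unfolding transpose_rows_def by (simp only: set_concat set_map split: if_splits) auto
  then obtain k where "k \<in> set [1..<Suc n]" "y \<in> set (replicate (count_list (f k) x) k)" by blast
  then show "y \<in> {1..n}" by (simp only: in_set_replicate set_upt) auto
qed

lemma count_transpose_rows: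
  "count_list (transpose_rows n' n f x) k =
     (if x \<in> {1..n'} \<and> k \<in> {1..n} then count_list (f k) x else 0)"
proof -
  have "count_list (concat (map (\<lambda>k. replicate (h k) k) [1..<Suc n])) k = (if k \<in> {1..n} then h k else 0)"
    for h :: "nat \<Rightarrow> nat"
    by (induction n) (auto simp: count_list_replicate)
  from this[of "\<lambda>k. count_list (f k) x"] show ?thesis
    unfolding transpose_rows_def by (cases "x \<in> {1..n'}") (simp_all only: if_True if_False simp_thms count_list.simps)
qed

lemma sorted_transpose_rows: "sorted (transpose_rows n' n f x)"
proof -
  have "sorted (concat (map (\<lambda>k. replicate (h k) k) [1..<Suc n]))" for h :: "nat \<Rightarrow> nat"
    by (induction n) (auto simp: sorted_append)
  then show ?thesis by (simp add: transpose_rows_def)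
qed

lemma length_eq_sum_count: "set (r :: nat list) \<subseteq> {1..n} \<Longrightarrow> length r = (\<Sum>y\<in>{1..n}. count_list r y)"
  using sum_count_set[OF _ finite_atLeastAtMost, of r 1 n] by simp

text \<open>A Yamanouchi word of content \<open>c'\<close> offers \<open>c' i - c' (Suc i)\<close>
  unmatched letters \<open>i\<close>. Dominance thus says that the word of the tableau stays
  Yamanouchi when such a word is appended; for \<open>c'\<close> zero it is the Yamanouchi condition
  itself.\<close>

definition dominant_tableaux ::
  "nat \<Rightarrow> (nat \<Rightarrow> nat) \<Rightarrow> (nat \<Rightarrow> nat) \<Rightarrow> (nat \<Rightarrow> nat) \<Rightarrow> (nat \<Rightarrow> nat) \<Rightarrow> (nat \<Rightarrow> nat list) set" where
  "dominant_tableaux n m l c' c = {f \<in> row_tableaux n m l.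
     (\<forall>i\<ge>1. c' (Suc i) + eps i (rword n f) \<le> c' i) \<and> (\<forall>i\<ge>1. count_list (rword n f) i = c i)}"

text \<open>For the matrix of multiplicities of the letter \<open>x\<close> in row \<open>k\<close>, column strictness with respect to
  the inner shape \<open>m\<close> and dominance with respect to \<open>c'\<close> are the same system of inequalities,
  up to transposition.\<close>

lemma transpose_rows_in:
  assumes f: "f \<in> dominant_tableaux n m l c' c"
    and m: "\<And>k. 1 \<le> k \<Longrightarrow> m (Suc k) \<le> m k"
    and c0: "\<And>x. n' < x \<Longrightarrow> c x = 0" and l0: "\<And>k. n < k \<Longrightarrow> l k = 0"
  shows "transpose_rows n' n f \<in> dominant_tableaux n' c' c m l"
proof -
  define g where "g = transpose_rows n' n f"
  have rows: "sorted (f k)" "length (f k) = l k" "set (f k) \<subseteq> {1..}" if "1 \<le> k" "k \<le> n" for k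
    using f that by (auto simp: dominant_tableaux_def row_tableaux_def)
  have cols: "m (Suc k) + cle (Suc x) (f (Suc k)) \<le> m k + cle x (f k)" if "1 \<le> k" "k < n" for k x
    using f that by (auto simp: dominant_tableaux_def row_tableaux_def)
  have dom': "c' (Suc i) + (\<Sum>r\<in>{1..k}. count_list (f r) (Suc i)) \<le> c' i + (\<Sum>r\<in>{1..<k}. count_list (f r) i)"
    if "1 \<le> i" "k \<in> {1..n}" for i k
    using f that eps_rword[of n f "c' (Suc i)" i "c' i"] rows(1) by (auto simp: dominant_tableaux_def)
  have dom0: "c' (Suc i) \<le> c' i" if "1 \<le> i" for i
    using f that by (force simp: dominant_tableaux_def)
  have cnt: "(\<Sum>r\<in>{1..n}. count_list (f r) x) = c x" if "1 \<le> x" for x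
    using f that by (simp add: dominant_tableaux_def count_list_rword)
  \<comment> \<open>The content excludes letters beyond \<open>n'\<close>, so cutting the matrix at
    column \<open>n'\<close> loses nothing.\<close>
  have letter_le: "x \<le> n'" if "x \<in> set (f k)" "1 \<le> k" "k \<le> n" for x k
  proof (rule ccontr)
    assume "\<not> x \<le> n'"
    moreover have "1 \<le> x" using rows(3)[OF that(2,3)] that(1) by auto
    ultimately have "(\<Sum>r\<in>{1..n}. count_list (f r) x) = 0" using cnt c0 by auto
    then show False using that by (auto simp: count_list_0_iff)
  qed
  have gc: "count_list (g x) k = (if x \<in> {1..n'} \<and> k \<in> {1..n} then count_list (f k) x else 0)" for x k
    by (simp add: g_def count_transpose_rows)
  have gpos: "set (g x) \<subseteq> {1..}" for x using set_transpose_rows[of n' n f x] by (auto simp: g_def)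
  have gc': "count_list (g x) k = (if k \<in> {1..n} then count_list (f k) x else 0)" if "1 \<le> x" for x k
  proof (cases "x \<le> n'")
    case False
    then have "count_list (f k) x = 0" if "k \<in> {1..n}"
      using letter_le[of x k] that by (auto simp: count_list_0_iff)
    then show ?thesis using False by (simp add: gc)
  qed (use that in \<open>simp add: gc\<close>)
  have "g \<in> row_tableaux n' c' c"
    unfolding row_tableaux_def
  proof (intro CollectI conjI allI ballI impI)
    fix x assume "x \<notin> {1..n'}" then show "g x = []" unfolding g_def transpose_rows_def by (simp only: if_False)
  next
    fix x
    show "sorted (g x)" by (simp add: g_def sorted_transpose_rows)
    show "set (g x) \<subseteq> {1..}" by (rule gpos)
    assume x: "x \<in> {1..n'}"
    have "length (g x) = (\<Sum>k\<in>{1..n}. count_list (g x) k)"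
      unfolding g_def by (rule length_eq_sum_count[OF set_transpose_rows])
    also have "\<dots> = (\<Sum>k\<in>{1..n}. count_list (f k) x)" using x by (simp add: gc)
    finally show "length (g x) = c x" using cnt[of x] x by simp
  next
    fix x k
    assume x: "x \<in> {1..<n'}"
    have *: "cle k (g y) = (\<Sum>r\<in>{1..min k n}. count_list (f r) y)" if "y \<in> {1..n'}" for k y
    proof -
      have "cle k (g y) = (\<Sum>r\<in>{1..k}. if r \<in> {1..n} then count_list (f r) y else 0)"
        using that by (simp add: cle_eq_sum[OF gpos] gc)
      also have "\<dots> = (\<Sum>r\<in>{1..k} \<inter> {1..n}. count_list (f r) y)"
        by (rule sum.inter_restrict[symmetric]) simp
      also have "{1..k} \<inter> {1..n} = {1..min k n}" by auto
      finally show ?thesis .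
    qed
    show "c' (Suc x) + cle (Suc k) (g (Suc x)) \<le> c' x + cle k (g x)"
    proof (cases "n = 0")
      case True
      then show ?thesis using * x dom0[of x] by simp
    next
      case False
      \<comment> \<open>The letters of \<open>g\<close> are row numbers of \<open>f\<close> and do
        not exceed \<open>n\<close>; a threshold beyond \<open>n\<close> gives nothing new and is
        clipped.\<close>
      define j where "j = min (Suc k) n"
      have "c' (Suc x) + (\<Sum>r\<in>{1..j}. count_list (f r) (Suc x)) \<le> c' x + (\<Sum>r\<in>{1..<j}. count_list (f r) x)"
        using dom'[of x j] x False by (auto simp: j_def)
      also have "(\<Sum>r\<in>{1..<j}. count_list (f r) x) \<le> (\<Sum>r\<in>{1..min k n}. count_list (f r) x)"
        by (rule sum_mono2) (auto simp: j_def)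
      finally show ?thesis using * x by (simp add: j_def)
    qed
  qed
  moreover have "m (Suc k) + eps k (rword n' g) \<le> m k" if "1 \<le> k" for k
  proof -
    have "m (Suc k) + (\<Sum>y\<in>{1..x}. count_list (g y) (Suc k)) \<le> m k + (\<Sum>y\<in>{1..<x}. count_list (g y) k)"
      if x: "x \<in> {1..n'}" for x
    proof (cases "k < n")
      case True
      have "m (Suc k) + cle (Suc (x - 1)) (f (Suc k)) \<le> m k + cle (x - 1) (f k)"
        using cols True \<open>1 \<le> k\<close> by blast
      moreover have "Suc (x - 1) = x" "{1..<x} = {1..x - 1}" using x by auto
      moreover have "cle z (f j) = (\<Sum>y\<in>{1..z}. count_list (g y) j)" if "j \<in> {1..n}" for j z
        using rows(3)[of j] that by (simp add: cle_eq_sum gc')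
      ultimately show ?thesis using True \<open>1 \<le> k\<close> by simp
    next
      case False
      then show ?thesis using m[OF \<open>1 \<le> k\<close>] by (simp add: gc)
    qed
    then show ?thesis
      using eps_rword[of n' g "m (Suc k)" k "m k"] m[OF \<open>1 \<le> k\<close>] by (auto simp: g_def sorted_transpose_rows)
  qed
  moreover have "count_list (rword n' g) k = l k" if "1 \<le> k" for k
  proof (cases "k \<le> n")
    case True
    have "set (f k) \<subseteq> {1..n'}" using rows(3)[OF that True] letter_le[of _ k] that True by auto
    then have "length (f k) = (\<Sum>x\<in>{1..n'}. count_list (f k) x)" by (rule length_eq_sum_count)
    then show ?thesis using rows(2)[OF that True] True that by (simp add: count_list_rword gc)
  next
    case False
    then show ?thesis using l0[of k] by (simp add: count_list_rword gc)
  qed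
  ultimately show ?thesis by (simp add: dominant_tableaux_def g_def)
qed

lemma sorted_eq_count_list:
  "sorted r \<Longrightarrow> sorted s \<Longrightarrow> (\<And>x. count_list r x = count_list s x) \<Longrightarrow> r = (s :: nat list)"
  by (metis count_mset multiset_eqI properties_for_sort)

lemma transpose_rows_transpose_rows:
  assumes f: "f \<in> dominant_tableaux n m l c' c" and c0: "\<And>x. n' < x \<Longrightarrow> c x = 0"
  shows "transpose_rows n n' (transpose_rows n' n f) = f"
proof
  fix k
  show "transpose_rows n n' (transpose_rows n' n f) k = f k"
  proof (cases "k \<in> {1..n}")
    case True
    have "count_list (f k) x = 0" if "x \<notin> {1..n'}" for x
    proof (cases "x = 0")
      case True
      have "set (f k) \<subseteq> {1..}" using f \<open>k \<in> {1..n}\<close> by (auto simp: dominant_tableaux_def row_tableaux_def)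
      then show ?thesis using True by (auto simp: count_list_0_iff)
    next
      case False
      then have "count_list (rword n f) x = 0" using f c0[of x] that by (auto simp: dominant_tableaux_def)
      then show ?thesis using \<open>k \<in> {1..n}\<close> by (simp add: count_list_rword)
    qed
    then show ?thesis
      using f True
      by (intro sorted_eq_count_list sorted_transpose_rows)
        (auto simp: dominant_tableaux_def row_tableaux_def count_transpose_rows)
  next
    case False
    then have "f k = []" using f unfolding dominant_tableaux_def row_tableaux_def by blast
    then show ?thesis using False by (simp only: transpose_rows_def if_False)
  qed
qed

theorem card_dominant_tableaux_transpose:
  assumes "\<And>k. 1 \<le> k \<Longrightarrow> m (Suc k) \<le> m k" "\<And>k. 1 \<le> k \<Longrightarrow> c' (Suc k) \<le> c' k"
    and "\<And>x. n' < x \<Longrightarrow> c x = 0" "\<And>k. n < k \<Longrightarrow> l k = 0"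
  shows "card (dominant_tableaux n m l c' c) = card (dominant_tableaux n' c' c m l)"
  by (rule bij_betw_same_card[OF bij_betw_byWitness
        [where f = "transpose_rows n' n" and f' = "transpose_rows n n'"]])
    (use transpose_rows_in transpose_rows_transpose_rows assms in \<open>auto simp: image_subset_iff\<close>)

section \<open>Products of Schur functions\<close>

text \<open>The shape \<open>mu\<close> placed above and to the right of \<open>nu\<close>. The
  offset \<open>part nu 1\<close> moves the rows of \<open>mu\<close> beyond the widest row of
  \<open>nu\<close>, so that no column meets both and the two tableaux are independent.\<close>

definition product_tableaux ::
  "nat list \<Rightarrow> nat list \<Rightarrow> (nat \<Rightarrow> nat list) set" where
  "product_tableaux mu nu = row_tableaux (length mu + length nu)
     (\<lambda>k. if k \<le> length mu then part nu 1 else 0)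
     (\<lambda>k. if k \<le> length mu then part mu k else part nu (k - length mu))"

definition stack_rows :: "nat \<Rightarrow> (nat \<Rightarrow> 'a list) \<times> (nat \<Rightarrow> 'a list) \<Rightarrow> nat \<Rightarrow> 'a list" where
  "stack_rows a p k = (if k \<le> a then fst p k else snd p (k - a))"

lemma rword_stack_rows: "rword (a + n) (stack_rows a (t, u)) = rword n u @ rword a t"
proof (induction n)
  case 0
  show ?case by (auto simp: stack_rows_def intro!: rword_cong)
qed (simp add: stack_rows_def)

lemma bij_betw_stack_rows:
  assumes mu: "is_partition mu" and nu: "is_partition nu"
  shows "bij_betw (stack_rows (length mu)) (normal_tableaux mu \<times> normal_tableaux nu) (product_tableaux mu nu)"
proof (rule bij_betw_byWitness[where f' = "\<lambda>f. (\<lambda>k. if k \<le> length mu then f k else [], \<lambda>k. if k = 0 then [] else f (length mu + k))"])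
  let ?a = "length mu"
  show "\<forall>p\<in>normal_tableaux mu \<times> normal_tableaux nu.
      (\<lambda>k. if k \<le> ?a then stack_rows ?a p k else [], \<lambda>k. if k = 0 then [] else stack_rows ?a p (?a + k)) = p"
    by (auto simp: stack_rows_def normal_tableaux_def row_tableaux_def fun_eq_iff)
  show "\<forall>f\<in>product_tableaux mu nu. stack_rows ?a
      (\<lambda>k. if k \<le> ?a then f k else [], \<lambda>k. if k = 0 then [] else f (?a + k)) = f"
    by (auto simp: stack_rows_def fun_eq_iff)
  show "stack_rows ?a ` (normal_tableaux mu \<times> normal_tableaux nu) \<subseteq> product_tableaux mu nu"
  proof (clarify)
    fix t u
    assume t: "t \<in> normal_tableaux mu" and u: "u \<in> normal_tableaux nu"
    have t0: "t k = []" if "k \<notin> {1..?a}" for k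
      using t that unfolding normal_tableaux_def row_tableaux_def by blast
    have u0: "u k = []" if "k \<notin> {1..length nu}" for k
      using u that unfolding normal_tableaux_def row_tableaux_def by blast
    have tr: "sorted (t k)" "length (t k) = part mu k" "set (t k) \<subseteq> {1..}" if "k \<in> {1..?a}" for k
      using t that by (auto simp: normal_tableaux_def row_tableaux_def)
    have ur: "sorted (u k)" "length (u k) = part nu k" "set (u k) \<subseteq> {1..}" if "k \<in> {1..length nu}" for k
      using u that by (auto simp: normal_tableaux_def row_tableaux_def)
    have tc: "cle (Suc x) (t (Suc k)) \<le> cle x (t k)" if "k \<in> {1..<?a}" for k x
      using t that by (auto simp: normal_tableaux_def row_tableaux_def)
    have uc: "cle (Suc x) (u (Suc k)) \<le> cle x (u k)" if "k \<in> {1..<length nu}" for k x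
      using u that by (auto simp: normal_tableaux_def row_tableaux_def)
    show "stack_rows ?a (t, u) \<in> product_tableaux mu nu"
      unfolding product_tableaux_def row_tableaux_def
    proof (intro CollectI conjI allI ballI impI)
      fix k
      assume "k \<notin> {1..?a + length nu}"
      then have "k \<le> ?a \<Longrightarrow> k \<notin> {1..?a}" "\<not> k \<le> ?a \<Longrightarrow> k - ?a \<notin> {1..length nu}" by auto
      then show "stack_rows ?a (t, u) k = []" using t0[of k] u0[of "k - ?a"] unfolding stack_rows_def by simp
    next
      fix k
      assume k: "k \<in> {1..?a + length nu}"
      show "sorted (stack_rows ?a (t, u) k)"
        "length (stack_rows ?a (t, u) k) = (if k \<le> ?a then part mu k else part nu (k - ?a))"
        "set (stack_rows ?a (t, u) k) \<subseteq> {1..}"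
        using k tr[of k] ur[of "k - ?a"] unfolding stack_rows_def by (cases "k \<le> ?a"; force)+
    next
      fix k x
      assume k: "k \<in> {1..<?a + length nu}"
      consider "k < ?a" | "k = ?a" | "?a < k" by linarith
      then show "(if Suc k \<le> ?a then part nu 1 else 0) + cle (Suc x) (stack_rows ?a (t, u) (Suc k))
          \<le> (if k \<le> ?a then part nu 1 else 0) + cle x (stack_rows ?a (t, u) k)"
      proof cases
        case 1
        then show ?thesis using tc[of k x] k by (simp add: stack_rows_def)
      next
        case 2
        \<comment> \<open>At the seam the inequality holds because the whole first row of
          \<open>nu\<close> fits into the offset.\<close>
        have "cle (Suc x) (u 1) \<le> part nu 1"
          using cle_le_length[of "Suc x" "u 1"] ur(2)[of 1] k 2 by (cases nu) auto
        then show ?thesis using 2 by (simp add: stack_rows_def)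
      next
        case 3
        then have "k - ?a \<in> {1..<length nu}" "Suc k - ?a = Suc (k - ?a)" using k by auto
        then show ?thesis using uc[of "k - ?a" x] 3 by (simp add: stack_rows_def)
      qed
    qed
  qed
  show "(\<lambda>f. (\<lambda>k. if k \<le> ?a then f k else [], \<lambda>k. if k = 0 then [] else f (?a + k))) ` product_tableaux mu nu
      \<subseteq> normal_tableaux mu \<times> normal_tableaux nu"
  proof (clarify, intro conjI)
    fix f
    assume f: "f \<in> product_tableaux mu nu"
    have f0: "f k = []" if "k \<notin> {1..?a + length nu}" for k
      using f that unfolding product_tableaux_def row_tableaux_def by blast
    have fr: "sorted (f k)" "length (f k) = (if k \<le> ?a then part mu k else part nu (k - ?a))" "set (f k) \<subseteq> {1..}"
      if "k \<in> {1..?a + length nu}" for k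
      using f that by (auto simp: product_tableaux_def row_tableaux_def)
    have fc: "(if Suc k \<le> ?a then part nu 1 else 0) + cle (Suc x) (f (Suc k))
          \<le> (if k \<le> ?a then part nu 1 else 0) + cle x (f k)" if "k \<in> {1..<?a + length nu}" for k x
      using f that unfolding product_tableaux_def row_tableaux_def by blast
    show "(\<lambda>k. if k \<le> ?a then f k else []) \<in> normal_tableaux mu"
      unfolding normal_tableaux_def row_tableaux_def
    proof (intro CollectI conjI allI ballI impI)
      fix k x
      assume "k \<in> {1..<?a}"
      then show "0 + cle (Suc x) (if Suc k \<le> ?a then f (Suc k) else []) \<le> 0 + cle x (if k \<le> ?a then f k else [])"
        using fc[of k x] by simp
    qed (use fr f0 in auto)
    show "(\<lambda>k. if k = 0 then [] else f (?a + k)) \<in> normal_tableaux nu"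
      unfolding normal_tableaux_def row_tableaux_def
    proof (intro CollectI conjI allI ballI impI)
      fix k x
      assume "k \<in> {1..<length nu}"
      then show "0 + cle (Suc x) (if Suc k = 0 then [] else f (?a + Suc k)) \<le> 0 + cle x (if k = 0 then [] else f (?a + k))"
        using fc[of "?a + k" x] by auto
    next
      fix k
      assume "k \<in> {1..length nu}"
      then show "sorted (if k = 0 then [] else f (?a + k))" "set (if k = 0 then [] else f (?a + k)) \<subseteq> {1..}"
        "length (if k = 0 then [] else f (?a + k)) = part nu k"
        using fr[of "?a + k"] by auto
    qed (use f0 in auto)
  qed
qed

section \<open>Littlewood--Richardson coefficients\<close>

lemma SSYT_normal_bij:
  "is_partition nu \<Longrightarrow> bij_betw (diagram_rows (nu, [])) (SSYT (young nu) {1..}) (normal_tableaux nu)"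
  using bij_betw_diagram_rows[OF is_skew_normal, of nu] by (simp add: skew_tableaux_normal)

lemma schur_function_eq_card:
  assumes "is_partition nu"
  shows "schur_function nu w = int (card {f \<in> normal_tableaux nu. mset (rword (length nu) f) = w})"
proof -
  have eq: "image_mset M (mset_set (young nu)) = mset (rword (length nu) (diagram_rows (nu, []) M))" for M :: "box \<Rightarrow> nat"
    using mset_row_word[OF finite_diagram, of "(nu, [])" M] row_word_diagram[of nu "[]" M] by simp
  have "bij_betw (diagram_rows (nu, [])) {M \<in> SSYT (young nu) {1..}. image_mset M (mset_set (young nu)) = w}
      {f \<in> normal_tableaux nu. mset (rword (length nu) f) = w}"
    unfolding eq using SSYT_normal_bij[OF assms] by (auto simp: bij_betw_def inj_on_def)
  then show ?thesis unfolding schur_function_def by (simp add: bij_betw_same_card)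
qed

lemma length_rword: "length (rword n f) = (\<Sum>k\<in>{1..n}. length (f k))"
  by (induction n) auto

lemma sum_list_rword: "sum_list (rword n f) = (\<Sum>k\<in>{1..n}. sum_list (f k :: nat list))"
  by (induction n) auto

lemma sum_part: "(\<Sum>k\<in>{1..length nu}. part nu k) = sum_list nu"
proof -
  have "(\<Sum>k\<in>{1..length nu}. part nu k) = (\<Sum>k\<in>{..<length nu}. nu ! k)"
    by (rule sum.reindex_bij_witness[where i = Suc and j = "\<lambda>k. k - 1"]) (auto simp: part_def)
  then show ?thesis by (simp add: sum_list_sum_nth atLeast0LessThan)
qed

lemma length_rword_normal: "f \<in> normal_tableaux nu \<Longrightarrow> length (rword (length nu) f) = sum_list nu"
  by (simp add: length_rword normal_tableaux_def row_tableaux_def flip: sum_part)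

lemma finite_partitions: "finite {nu. is_partition nu \<and> sum_list nu = n}"
proof (rule finite_subset)
  show "{nu. is_partition nu \<and> sum_list nu = n} \<subseteq> {nu. set nu \<subseteq> {..n} \<and> length nu \<le> n}"
  proof clarify
    fix nu :: "nat list"
    assume "is_partition nu"
    then have "0 \<notin> set nu" by (simp add: is_partition_def)
    then have "length nu \<le> sum_list nu" by (induction nu) auto
    then show "set nu \<subseteq> {..sum_list nu} \<and> length nu \<le> sum_list nu"
      using member_le_sum_list by auto
  qed
  show "finite {nu. set nu \<subseteq> {..n} \<and> length nu \<le> n}"
    by (rule finite_lists_length_le) simp
qed

lemma mset_super_tableau:
  assumes "is_partition nu"
  shows "mset (rword (length nu) (super_tableau nu)) = mset w \<longleftrightarrow>
    set w \<subseteq> {1..} \<and> (\<forall>k\<ge>1. count_list w k = part nu k)"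
proof -
  have pos: "set (rword (length nu) (super_tableau nu)) \<subseteq> {1..}"
    by (rule normal_tableaux_positive[OF super_tableau_in[OF assms]])
  show ?thesis
  proof
    assume eq: "mset (rword (length nu) (super_tableau nu)) = mset w"
    have "count_list w k = count_list (rword (length nu) (super_tableau nu)) k" for k
      using arg_cong[OF eq, of "\<lambda>M. count M k"] by (simp add: count_mset)
    then show "set w \<subseteq> {1..} \<and> (\<forall>k\<ge>1. count_list w k = part nu k)"
      using pos mset_eq_setD[OF eq] count_super_tableau[of _ nu] by auto
  next
    assume *: "set w \<subseteq> {1..} \<and> (\<forall>k\<ge>1. count_list w k = part nu k)"
    show "mset (rword (length nu) (super_tableau nu)) = mset w"
    proof (rule multiset_eqI)
      fix k
      show "count (mset (rword (length nu) (super_tableau nu))) k = count (mset w) k"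
      proof (cases "k = 0")
        case True
        then have "k \<notin> set w" "k \<notin> set (rword (length nu) (super_tableau nu))" using * pos by auto
        then show ?thesis by (simp add: count_mset count_list_0_iff)
      next
        case False
        then show ?thesis using * count_super_tableau[of k nu] by (simp add: count_mset)
      qed
    qed
  qed
qed

lemma lr_tableaux_iff:
  assumes "is_partition nu"
  shows "f \<in> lr_tableaux n m l nu \<longleftrightarrow> f \<in> row_tableaux n m l \<and> yamanouchi (rword n f) \<and>
    mset (rword n f) = mset (rword (length nu) (super_tableau nu))"
  using mset_super_tableau[OF assms, of "rword n f"] row_tableaux_letters[of f n m l]
  by (auto simp: lr_tableaux_def)

text \<open>The expansion of a skew Schur function into Schur functions, coefficient by coefficient:
  the tableaux are sorted by their rectification, and each rectified tableau of shape
  \<open>nu\<close> occurs equally often. Any finite set \<open>N\<close> of partitions containing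
  the shapes that occur will do.\<close>

lemma card_row_tableaux_mset:
  assumes fin: "finite N" and N: "\<And>nu. nu \<in> N \<Longrightarrow> is_partition nu"
    and size: "\<And>nu. is_partition nu \<Longrightarrow> sum_list nu = size w \<Longrightarrow> lr_tableaux n m l nu \<noteq> {} \<Longrightarrow> nu \<in> N"
  shows "int (card {f \<in> row_tableaux n m l. mset (rword n f) = w}) =
    (\<Sum>nu\<in>N. int (card (lr_tableaux n m l nu)) * schur_function nu w)"
proof -
  define F where "F nu g = {f \<in> row_tableaux n m l. knuth_equiv (rword n f) (rword (length nu) g)}" for nu :: "nat list" and g
  define G where "G nu = {g \<in> normal_tableaux nu. mset (rword (length nu) g) = w}" for nu
  have finG: "finite (G nu)" for nu
    unfolding G_def normal_tableaux_def by (rule finite_row_tableaux_mset)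
  have finF: "finite (F nu g)" for nu g
    by (rule finite_subset[OF _ finite_row_tableaux_mset[of n m l "mset (rword (length nu) g)"]])
      (auto simp: F_def dest: knuth_equiv_mset)
  have cardF: "card (F nu g) = card (lr_tableaux n m l nu)" if "nu \<in> N" "g \<in> G nu" for nu g
    unfolding F_def using that by (intro card_rectification_fiber N) (auto simp: G_def)
  have "{f \<in> row_tableaux n m l. mset (rword n f) = w} = (\<Union>p\<in>Sigma N G. F (fst p) (snd p))"
  proof (intro set_eqI iffI)
    fix f
    assume f: "f \<in> {f \<in> row_tableaux n m l. mset (rword n f) = w}"
    then obtain nu g where nu: "is_partition nu" "g \<in> normal_tableaux nu"
      "knuth_equiv (rword (length nu) g) (rword n f)"
      using normal_tableau_exists row_tableaux_letters by blast
    have g: "g \<in> G nu" using nu f knuth_equiv_mset[OF nu(3)] by (simp add: G_def)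
    have fF: "f \<in> F nu g" using f knuth_equiv_sym[OF nu(3)] by (simp add: F_def)
    have "card (F nu g) = card (lr_tableaux n m l nu)"
      unfolding F_def by (rule card_rectification_fiber[OF nu(1,2)])
    then have "lr_tableaux n m l nu \<noteq> {}" using fF finF[of nu g] by auto
    moreover have "sum_list nu = size w"
      using length_rword_normal[OF nu(2)] g by (auto simp: G_def simp flip: size_mset)
    ultimately have "nu \<in> N" using size nu(1) by blast
    then show "f \<in> (\<Union>p\<in>Sigma N G. F (fst p) (snd p))" using g fF by force
  next
    fix f
    assume "f \<in> (\<Union>p\<in>Sigma N G. F (fst p) (snd p))"
    then show "f \<in> {f \<in> row_tableaux n m l. mset (rword n f) = w}"
      using knuth_equiv_mset by (force simp: F_def G_def)
  qed
  moreover have "F (fst p) (snd p) \<inter> F (fst q) (snd q) = {}" if "p \<in> Sigma N G" "q \<in> Sigma N G" "p \<noteq> q" for p q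
  proof (rule ccontr)
    assume "F (fst p) (snd p) \<inter> F (fst q) (snd q) \<noteq> {}"
    then obtain f where "knuth_equiv (rword n f) (rword (length (fst p)) (snd p))"
      "knuth_equiv (rword n f) (rword (length (fst q)) (snd q))" by (auto simp: F_def)
    then have "knuth_equiv (rword (length (fst p)) (snd p)) (rword (length (fst q)) (snd q))"
      using knuth_equiv_sym knuth_equiv_trans by blast
    then have "fst p = fst q \<and> snd p = snd q"
      using that N by (intro normal_tableau_unique) (auto simp: G_def)
    then show False using that(3) by (simp add: prod_eq_iff)
  qed
  ultimately have "card {f \<in> row_tableaux n m l. mset (rword n f) = w} = (\<Sum>p\<in>Sigma N G. card (F (fst p) (snd p)))"
    using fin finG finF by (simp add: card_UN_disjoint)
  also have "\<dots> = (\<Sum>nu\<in>N. \<Sum>g\<in>G nu. card (F nu g))"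
    using fin finG by (simp add: sum.Sigma split_def)
  also have "\<dots> = (\<Sum>nu\<in>N. card (lr_tableaux n m l nu) * card (G nu))"
    using cardF by (intro sum.cong) auto
  finally show ?thesis
    using N by (simp add: schur_function_eq_card G_def)
qed

text \<open>The word of the \<open>mu\<close> part is a suffix of a Yamanouchi word, so that part is
  the highest weight tableau. For the \<open>nu\<close> part there remains dominance over
  \<open>mu\<close> with content \<open>lam - mu\<close>. Transposition turns \<open>mu\<close> into
  the inner shape, \<open>lam - mu\<close> into the row lengths and \<open>nu\<close> into the
  content, and dominance becomes the Yamanouchi condition.\<close>

lemma product_lr_card:
  assumes "is_partition mu" "is_partition nu" "is_partition lam" "is_skew (lam, mu)"
  shows "card {f \<in> product_tableaux mu nu. yamanouchi (rword (length mu + length nu) f) \<and>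
      (\<forall>k\<ge>1. count_list (rword (length mu + length nu) f) k = part lam k)} =
    card (lr_tableaux (length lam) (part mu) (\<lambda>k. part lam k - part mu k) nu)"
proof -
  let ?a = "length mu" and ?n = "length nu"
  define P where "P w \<longleftrightarrow> yamanouchi w \<and> (\<forall>k\<ge>1. count_list w k = part lam k)" for w
  define Y where "Y = dominant_tableaux ?n (\<lambda>_. 0) (part nu) (part mu) (\<lambda>k. part lam k - part mu k)"
  have sub: "part mu k \<le> part lam k" if "1 \<le> k" for k using assms(4) that by (simp add: is_skew_def)
  have bij: "bij_betw (stack_rows ?a) {p \<in> normal_tableaux mu \<times> normal_tableaux nu. P (rword (?a + ?n) (stack_rows ?a p))}
      {f \<in> product_tableaux mu nu. P (rword (?a + ?n) f)}"
    using bij_betw_stack_rows[OF assms(1,2)] by (auto simp: bij_betw_def inj_on_def)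
  have super_eps: "eps i (rword ?a (super_tableau mu)) = 0" if "1 \<le> i" for i
    using yamanouchi_super_tableau[OF assms(1)] that by (simp add: yamanouchi_def)
  have super_phi: "phi i (rword ?a (super_tableau mu)) + part mu (Suc i) = part mu i" if "1 \<le> i" for i
    using eps_phi_count[of i "rword ?a (super_tableau mu)"] super_eps[OF that]
      count_super_tableau[of i mu] count_super_tableau[of "Suc i" mu] that by simp
  have key: "P (rword ?n u @ rword ?a t) \<longleftrightarrow> t = super_tableau mu \<and> u \<in> Y"
    if t: "t \<in> normal_tableaux mu" and u: "u \<in> normal_tableaux nu" for t u
  proof
    assume *: "P (rword ?n u @ rword ?a t)"
    then have t_eq: "t = super_tableau mu"
      using yamanouchi_append[of "rword ?n u" "rword ?a t"] yamanouchi_normal[OF t] by (simp add: P_def)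
    have "part mu (Suc i) + eps i (rword ?n u) \<le> part mu i" if "1 \<le> i" for i
      using * super_phi[OF that] super_eps[OF that] that by (auto simp: P_def yamanouchi_def eps_append t_eq)
    moreover have "count_list (rword ?n u) k = part lam k - part mu k" if "1 \<le> k" for k
    proof -
      have "count_list (rword ?n u @ rword ?a t) k = part lam k" using * that unfolding P_def by blast
      then show ?thesis using count_super_tableau[OF that, of mu] by (simp add: t_eq)
    qed
    ultimately show "t = super_tableau mu \<and> u \<in> Y"
      using t_eq u by (simp add: Y_def dominant_tableaux_def normal_tableaux_def)
  next
    assume *: "t = super_tableau mu \<and> u \<in> Y"
    then have dom: "part mu (Suc i) + eps i (rword ?n u) \<le> part mu i" if "1 \<le> i" for i
      using that by (simp add: Y_def dominant_tableaux_def)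
    have "eps i (rword ?n u @ rword ?a t) = 0" if "1 \<le> i" for i
      using * super_phi[OF that] super_eps[OF that] dom[OF that] by (simp add: eps_append)
    moreover have "count_list (rword ?n u @ rword ?a t) k = part lam k" if "1 \<le> k" for k
      using * that sub[OF that] count_super_tableau[OF that, of mu] by (auto simp: Y_def dominant_tableaux_def)
    ultimately show "P (rword ?n u @ rword ?a t)"
      using normal_tableaux_positive[OF t] normal_tableaux_positive[OF u] by (auto simp: P_def yamanouchi_def)
  qed
  have "{p \<in> normal_tableaux mu \<times> normal_tableaux nu. P (rword (?a + ?n) (stack_rows ?a p))} =
      {super_tableau mu} \<times> Y"
    using key super_tableau_in[OF assms(1)]
    by (auto simp: rword_stack_rows Y_def dominant_tableaux_def normal_tableaux_def)
  with bij have "card {f \<in> product_tableaux mu nu. P (rword (?a + ?n) f)} = card Y"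
    using bij_betw_same_card by (fastforce simp: card_cartesian_product_singleton)
  also have "card Y = card (dominant_tableaux (length lam) (part mu) (\<lambda>k. part lam k - part mu k) (\<lambda>_. 0) (part nu))"
    unfolding Y_def by (rule card_dominant_tableaux_transpose) (auto intro: part_antimono assms simp: part_beyond)
  also have "dominant_tableaux (length lam) (part mu) (\<lambda>k. part lam k - part mu k) (\<lambda>_. 0) (part nu) =
      lr_tableaux (length lam) (part mu) (\<lambda>k. part lam k - part mu k) nu"
    using row_tableaux_letters by (force simp: dominant_tableaux_def lr_tableaux_def yamanouchi_def)
  finally show ?thesis by (simp add: P_def)
qed

text \<open>Row \<open>k\<close> only contains letters at least \<open>k\<close>, so the highest
  weight filling alone attains the minimal letter sum. This sum takes the place of the dominance
  order on partitions.\<close>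

lemma normal_tableaux_sum_list:
  assumes "g \<in> normal_tableaux nu"
  shows "g = super_tableau nu \<or>
    sum_list (rword (length nu) (super_tableau nu)) < sum_list (rword (length nu) g)"
proof (cases "\<forall>k\<in>{1..length nu}. \<forall>x\<in>set (g k). x = k")
  case True
  have "g k = super_tableau nu k" for k
  proof (cases "k \<in> {1..length nu}")
    case k: True
    then have "length (g k) = part nu k" using assms by (simp add: normal_tableaux_def row_tableaux_def)
    then show ?thesis using True k replicate_length_same[of "g k" k] by (simp add: super_tableau_def)
  next
    case False
    then have "g k = []" using assms unfolding normal_tableaux_def row_tableaux_def by blast
    then show ?thesis using part_eq_0[OF False] by (simp add: super_tableau_def)
  qed
  then show ?thesis by blast
next
  case False
  then obtain k x where k: "k \<in> {1..length nu}" "x \<in> set (g k)" "x \<noteq> k" by blast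
  have len: "length (g j) = part nu j" if "j \<in> {1..length nu}" for j
    using assms that by (simp add: normal_tableaux_def row_tableaux_def)
  have ge: "\<forall>y\<in>set (g j). j \<le> y" if "j \<in> {1..length nu}" for j
    using normal_tableaux_letters[OF assms] that by auto
  have le_sum: "length r * j \<le> sum_list r" if "\<forall>y\<in>set r. j \<le> y" for r :: "nat list" and j
    using that by (induction r) auto
  have less_sum: "length r * j < sum_list r" if "\<forall>y\<in>set r. j \<le> y" "x \<in> set r" "x \<noteq> j" for r :: "nat list" and j
    using that
  proof (induction r)
    case (Cons y r)
    show ?case
    proof (cases "x \<in> set r")
      case True
      then show ?thesis using Cons by fastforce
    next
      case False
      then show ?thesis using Cons le_sum[of r j] by fastforce
    qed
  qed simp
  have super: "sum_list (super_tableau nu j) = part nu j * j" for j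
    by (simp add: super_tableau_def sum_list_replicate)
  have "(\<Sum>j\<in>{1..length nu}. sum_list (super_tableau nu j)) < (\<Sum>j\<in>{1..length nu}. sum_list (g j))"
  proof (rule sum_strict_mono_ex1)
    show "\<forall>j\<in>{1..length nu}. sum_list (super_tableau nu j) \<le> sum_list (g j)"
      using le_sum ge len super by metis
    show "\<exists>j\<in>{1..length nu}. sum_list (super_tableau nu j) < sum_list (g j)"
      using less_sum[of "g k" k] ge len super k by metis
  qed simp
  then show ?thesis by (simp add: sum_list_rword)
qed

text \<open>Triangularity: a Schur function contains the highest weight monomial of
  \<open>ka\<close> only if its shape is \<open>ka\<close> or precedes \<open>ka\<close> in the
  order by letter sums.\<close>

lemma schur_function_super:
  assumes "is_partition nu" "is_partition ka"
    and "schur_function nu (mset (rword (length ka) (super_tableau ka))) \<noteq> 0"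
  shows "nu = ka \<or>
    sum_list (rword (length nu) (super_tableau nu)) < sum_list (rword (length ka) (super_tableau ka))"
proof -
  have "{g \<in> normal_tableaux nu. mset (rword (length nu) g) = mset (rword (length ka) (super_tableau ka))} \<noteq> {}"
    using assms(3) unfolding schur_function_eq_card[OF assms(1)] by (metis card.empty of_nat_0)
  then obtain g where g: "g \<in> normal_tableaux nu"
    "mset (rword (length nu) g) = mset (rword (length ka) (super_tableau ka))" by blast
  have "nu = ka" if "g = super_tableau nu"
  proof (rule partition_part_eqI[OF assms(1,2)])
    fix k :: nat
    assume "1 \<le> k"
    then show "part nu k = part ka k"
      using arg_cong[OF g(2), of "\<lambda>M. count M k"] that
      by (simp add: count_mset count_super_tableau)
  qed
  then show ?thesis
    using normal_tableaux_sum_list[OF g(1)] arg_cong[OF g(2), of sum_mset] by (auto simp: sum_mset_sum_list)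
qed

lemma schur_function_super_self:
  assumes "is_partition nu"
  shows "schur_function nu (mset (rword (length nu) (super_tableau nu))) = 1"
proof -
  have "{f \<in> normal_tableaux nu. mset (rword (length nu) f) = mset (rword (length nu) (super_tableau nu))} =
      {super_tableau nu}"
  proof (intro set_eqI iffI)
    fix g
    assume "g \<in> {f \<in> normal_tableaux nu. mset (rword (length nu) f) = mset (rword (length nu) (super_tableau nu))}"
    then have g: "g \<in> normal_tableaux nu" "mset (rword (length nu) g) = mset (rword (length nu) (super_tableau nu))"
      by auto
    have "sum_list (rword (length nu) g) = sum_list (rword (length nu) (super_tableau nu))"
      using g(2) by (metis sum_mset_sum_list)
    then show "g \<in> {super_tableau nu}" using normal_tableaux_sum_list[OF g(1)] by simp
  qed (use super_tableau_in[OF assms] in auto)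
  then show ?thesis using assms by (simp add: schur_function_eq_card)
qed

text \<open>At the highest weight monomial of a shape in the support with the smallest letter sum,
  all other terms vanish by triangularity.\<close>

lemma schur_functions_independent:
  assumes fin: "finite {nu. c nu \<noteq> 0}" and part: "\<And>nu. c nu \<noteq> 0 \<Longrightarrow> is_partition nu"
    and zero: "\<And>w. (\<Sum>nu | c nu \<noteq> 0. c nu * schur_function nu w) = 0"
  shows "c = (\<lambda>_. 0)"
proof (rule ccontr)
  assume "c \<noteq> (\<lambda>_. 0)"
  then have "{nu. c nu \<noteq> 0} \<noteq> {}" by auto
  then obtain ka where ka: "c ka \<noteq> 0" and
    min: "\<And>nu. c nu \<noteq> 0 \<Longrightarrow> sum_list (rword (length ka) (super_tableau ka)) \<le> sum_list (rword (length nu) (super_tableau nu))"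
    using ex_has_least_nat[of "\<lambda>nu. c nu \<noteq> 0" _ "\<lambda>nu. sum_list (rword (length nu) (super_tableau nu))"] by blast
  let ?w = "mset (rword (length ka) (super_tableau ka))"
  have "schur_function nu ?w = (if nu = ka then 1 else 0)" if "c nu \<noteq> 0" for nu
  proof (cases "nu = ka")
    case True
    then show ?thesis using schur_function_super_self[OF part[OF ka]] by simp
  next
    case False
    then show ?thesis
      using schur_function_super[OF part[OF that] part[OF ka]] min[OF that] by auto
  qed
  then have "(\<Sum>nu | c nu \<noteq> 0. c nu * schur_function nu ?w) = (\<Sum>nu | c nu \<noteq> 0. if nu = ka then c ka else 0)"
    by (intro sum.cong) auto
  then show False using zero[of ?w] fin ka by simp
qed

text \<open>The Yamanouchi counts for the product shape satisfy the equation that characterizes the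
  coefficients, and independence makes the solution unique.\<close>

theorem lr_coeff_eq_card:
  assumes "is_partition mu" "is_partition nu" "is_skew (lam, mu)"
  shows "lr_coeff mu nu lam = int (card (lr_tableaux (length lam) (part mu) (\<lambda>k. part lam k - part mu k) nu))"
proof -
  let ?a = "length mu" and ?n = "length nu"
  define m where "m = (\<lambda>k. if k \<le> ?a then part nu 1 else 0)"
  define l where "l = (\<lambda>k. if k \<le> ?a then part mu k else part nu (k - ?a))"
  have pt: "product_tableaux mu nu = row_tableaux (?a + ?n) m l"
    by (simp add: product_tableaux_def m_def l_def)
  define c where "c ka = (if is_partition ka then int (card (lr_tableaux (?a + ?n) m l ka)) else 0)" for ka
  have supp: "{ka. c ka \<noteq> 0} \<subseteq> {ka. is_partition ka \<and> sum_list ka = sum_list mu + sum_list nu}"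
  proof clarify
    fix ka
    assume "c ka \<noteq> 0"
    then have ka: "is_partition ka" and "lr_tableaux (?a + ?n) m l ka \<noteq> {}"
      by (auto simp: c_def split: if_splits)
    then obtain f where f: "f \<in> product_tableaux mu nu"
      "mset (rword (?a + ?n) f) = mset (rword (length ka) (super_tableau ka))"
      using lr_tableaux_iff[OF ka] pt by blast
    then obtain t u where tu: "f = stack_rows ?a (t, u)" "t \<in> normal_tableaux mu" "u \<in> normal_tableaux nu"
      using bij_betw_stack_rows[OF assms(1,2)] unfolding bij_betw_def by blast
    have "sum_list ka = sum_list mu + sum_list nu"
      using arg_cong[OF f(2), of size] tu length_rword_normal[OF super_tableau_in[OF ka]]
      by (simp add: rword_stack_rows length_rword_normal)
    then show "is_partition ka \<and> sum_list ka = sum_list mu + sum_list nu" using ka by simp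
  qed
  have fin: "finite {ka. c ka \<noteq> 0}" by (rule finite_subset[OF supp finite_partitions])
  have part: "is_partition ka" if "c ka \<noteq> 0" for ka using that by (auto simp: c_def split: if_splits)
  have expand: "series_mult (schur_function mu) (schur_function nu) w = (\<Sum>ka | c ka \<noteq> 0. c ka * schur_function ka w)" for w
  proof -
    define T where "T p = {t \<in> normal_tableaux mu. mset (rword ?a t) = p}" for p
    define V where "V q = {u \<in> normal_tableaux nu. mset (rword ?n u) = q}" for q
    have finTV: "finite (T p)" "finite (V q)" for p q
      by (simp_all add: T_def V_def normal_tableaux_def finite_row_tableaux_mset)
    have pairs: "finite {(p, q). p + q = w}"
    proof (rule finite_subset)
      show "{(p, q). p + q = w} \<subseteq> {p. p \<subseteq># w} \<times> {q. q \<subseteq># w}" by auto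
      have "finite {p. p \<subseteq># w}"
      proof (rule finite_subset)
        show "{p. p \<subseteq># w} \<subseteq> {p. set_mset p \<subseteq> set_mset w \<and> size p \<le> size w}"
          by (auto dest: mset_subset_eqD size_mset_mono)
        have "{p. set_mset p \<subseteq> set_mset w \<and> size p \<le> size w} \<subseteq> mset ` {xs. set xs \<subseteq> set_mset w \<and> length xs \<le> size w}"
          by (metis (mono_tags, lifting) ex_mset image_eqI mem_Collect_eq set_mset_mset size_mset subsetI)
        then show "finite {p. set_mset p \<subseteq> set_mset w \<and> size p \<le> size w}"
          by (rule finite_subset) (simp add: finite_lists_length_le)
      qed
      then show "finite ({p. p \<subseteq># w} \<times> {q. q \<subseteq># w})" by simp
    qed
    have "series_mult (schur_function mu) (schur_function nu) w = (\<Sum>pq | fst pq + snd pq = w. int (card (T (fst pq) \<times> V (snd pq))))"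
      by (simp add: series_mult_def schur_function_eq_card assms T_def V_def card_cartesian_product split_def)
    also have "\<dots> = int (card (\<Union>pq\<in>{pq. fst pq + snd pq = w}. T (fst pq) \<times> V (snd pq)))"
      using pairs finTV by (subst card_UN_disjoint) (auto simp: T_def V_def split_def)
    also have "(\<Union>pq\<in>{pq. fst pq + snd pq = w}. T (fst pq) \<times> V (snd pq)) =
        {p \<in> normal_tableaux mu \<times> normal_tableaux nu. mset (rword (?a + ?n) (stack_rows ?a p)) = w}"
      by (auto simp: T_def V_def rword_stack_rows add.commute)
    also have "card \<dots> = card {f \<in> product_tableaux mu nu. mset (rword (?a + ?n) f) = w}"
      using bij_betw_stack_rows[OF assms(1,2)]
      by (intro bij_betw_same_card[of "stack_rows ?a"]) (auto simp: bij_betw_def inj_on_def)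
    also have "int \<dots> = (\<Sum>ka | c ka \<noteq> 0. int (card (lr_tableaux (?a + ?n) m l ka)) * schur_function ka w)"
      unfolding pt
    proof (rule card_row_tableaux_mset[OF fin part])
      fix ka
      assume ka: "is_partition ka" and "lr_tableaux (?a + ?n) m l ka \<noteq> {}"
      moreover have "finite (lr_tableaux (?a + ?n) m l ka)"
        by (rule finite_subset[OF _ finite_row_tableaux_mset[of "?a + ?n" m l "mset (rword (length ka) (super_tableau ka))"]])
          (auto simp: lr_tableaux_iff[OF ka])
      ultimately show "ka \<in> {ka. c ka \<noteq> 0}" by (simp add: c_def)
    qed simp
    also have "\<dots> = (\<Sum>ka | c ka \<noteq> 0. c ka * schur_function ka w)"
      using part by (intro sum.cong) (auto simp: c_def)
    finally show ?thesis .
  qed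
  have "lr_coeff mu nu = c"
    unfolding lr_coeff_def
  proof (rule the_equality)
    show "finite {ka. c ka \<noteq> 0} \<and> (\<forall>ka. c ka \<noteq> 0 \<longrightarrow> is_partition ka) \<and>
      series_mult (schur_function mu) (schur_function nu) = (\<lambda>w. \<Sum>ka | c ka \<noteq> 0. c ka * schur_function ka w)"
      using fin part expand by auto
  next
    fix d
    assume d: "finite {ka. d ka \<noteq> 0} \<and> (\<forall>ka. d ka \<noteq> 0 \<longrightarrow> is_partition ka) \<and>
      series_mult (schur_function mu) (schur_function nu) = (\<lambda>w. \<Sum>ka | d ka \<noteq> 0. d ka * schur_function ka w)"
    define S where "S = {ka. c ka \<noteq> 0} \<union> {ka. d ka \<noteq> 0}"
    have "finite S" using fin d by (simp add: S_def)
    have extend: "(\<Sum>ka | e ka \<noteq> 0. e ka * schur_function ka w) = (\<Sum>ka\<in>S. e ka * schur_function ka w)"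
      if "{ka. e ka \<noteq> 0} \<subseteq> S" for e w
      by (rule sum.mono_neutral_left) (use that \<open>finite S\<close> in auto)
    have "(\<lambda>ka. d ka - c ka) = (\<lambda>_. 0)"
    proof (rule schur_functions_independent)
      have sub: "{ka. d ka - c ka \<noteq> 0} \<subseteq> S" by (auto simp: S_def)
      then show "finite {ka. d ka - c ka \<noteq> 0}" using \<open>finite S\<close> finite_subset by blast
      show "is_partition ka" if "d ka - c ka \<noteq> 0" for ka
        using that d part[of ka] by (cases "d ka = 0") auto
      fix w
      have "(\<Sum>ka\<in>S. d ka * schur_function ka w) = (\<Sum>ka\<in>S. c ka * schur_function ka w)"
        using extend[of d w] extend[of c w] expand[of w] d by (simp add: S_def fun_eq_iff)
      then show "(\<Sum>ka | d ka - c ka \<noteq> 0. (d ka - c ka) * schur_function ka w) = 0"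
        unfolding extend[OF sub] by (simp add: left_diff_distrib sum_subtractf)
    qed
    then show "d = c" by (simp add: fun_eq_iff)
  qed
  moreover have "is_partition lam" using assms(3) by (simp add: is_skew_def)
  ultimately show ?thesis
    using product_lr_card[OF assms(1,2) _ assms(3)] by (simp add: c_def lr_tableaux_def flip: pt)
qed

section \<open>Rectification\<close>

text \<open>A weakly increasing map respects Knuth equivalence if letters with the same image occur in
  increasing order; this covers strictly increasing maps as well as destandardization.\<close>

lemma knuth_equiv_map:
  assumes "knuth_equiv w w'" "mono_on (set w) g" "sorted_wrt (\<lambda>x y. g x = g y \<longrightarrow> x \<le> y) w"
  shows "knuth_equiv (map g w) (map g w') \<and> sorted_wrt (\<lambda>x y. g x = g y \<longrightarrow> x \<le> y) w'"
  using assms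
proof (induction rule: knuth_equiv_induct)
  case refl
  then show ?case by simp
next
  case (step u p q v)
  have IH: "knuth_equiv (map g w) (map g (u @ p @ v))" "sorted_wrt (\<lambda>x y. g x = g y \<longrightarrow> x \<le> y) (u @ p @ v)"
    using step by auto
  have "set (u @ p @ v) = set w" using knuth_equiv_mset[OF step.hyps(1)] mset_eq_setD by metis
  then have "set p \<subseteq> set w" by auto
  then have mono: "x \<le> y \<Longrightarrow> g x \<le> g y" if "x \<in> set p" "y \<in> set p" for x y
    using that step.prems(1) by (auto simp: mono_on_def)
  have "knuth_triple (map g p) (map g q) \<and> sorted_wrt (\<lambda>x y. g x = g y \<longrightarrow> x \<le> y) q \<and> set q = set p"
    using step.hyps(2)
  proof (cases rule: knuth_triple_cases)
    case (1 x y z)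
    have std: "g x = g y \<Longrightarrow> x \<le> y" "g x = g z \<Longrightarrow> x \<le> z" "g y = g z \<Longrightarrow> y \<le> z"
      using IH(2) by (simp_all add: 1 sorted_wrt_append)
    from 1(3) have "(g y < g x \<and> g x \<le> g z \<or> g z < g x \<and> g x \<le> g y)"
    proof
      assume "y < x \<and> x \<le> z"
      then have "g y < g x \<and> g x \<le> g z" using mono[of x y] mono[of x z] mono[of y x] mono[of z x] std 1(1) by (simp add: le_less) (metis less_irrefl not_le le_less)
      then show ?thesis by simp
    next
      assume "z < x \<and> x \<le> y"
      then have "g z < g x \<and> g x \<le> g y" using mono[of x y] mono[of x z] mono[of y x] mono[of z x] std 1(1) by (simp add: le_less) (metis less_irrefl not_le le_less)
      then show ?thesis by simp
    qed
    then show ?thesis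
      using std by (auto simp: 1(1,2) knuth_triple_iff)
  next
    case (2 x y z)
    have std: "g x = g y \<Longrightarrow> x \<le> y" "g x = g z \<Longrightarrow> x \<le> z" "g y = g z \<Longrightarrow> y \<le> z"
      using IH(2) by (simp_all add: 2 sorted_wrt_append)
    from 2(3) have "(g x \<le> g z \<and> g z < g y \<or> g y \<le> g z \<and> g z < g x)"
    proof
      assume "x \<le> z \<and> z < y"
      then have "g x \<le> g z \<and> g z < g y" using mono[of x z] mono[of z x] mono[of y z] mono[of z y] std 2(1) by (simp add: le_less) (metis less_irrefl not_le le_less)
      then show ?thesis by simp
    next
      assume "y \<le> z \<and> z < x"
      then have "g y \<le> g z \<and> g z < g x" using mono[of x z] mono[of z x] mono[of y z] mono[of z y] std 2(1) by (simp add: le_less) (metis less_irrefl not_le le_less)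
      then show ?thesis by simp
    qed
    then show ?thesis
      using std by (auto simp: 2(1,2) knuth_triple_iff)
  qed
  then show ?case
    using IH knuth_equiv_triple[of "map g p" "map g q" "map g u" "map g v"] knuth_equiv_trans
    by (auto simp: sorted_wrt_append)
qed

lemma knuth_equiv_map_strict:
  assumes "knuth_equiv w w'" "strict_mono_on (set w) g"
  shows "knuth_equiv (map g w) (map g w')"
proof -
  have "sorted_wrt (\<lambda>x y. g x = g y \<longrightarrow> x \<le> y) w"
    unfolding sorted_wrt_iff_nth_less
  proof (intro allI impI)
    fix i j
    assume "i < j" "j < length w" "g (w ! i) = g (w ! j)"
    then have "w ! i = w ! j"
      using inj_onD[OF strict_mono_on_imp_inj_on[OF assms(2)], of "w ! i" "w ! j"] by simp
    then show "w ! i \<le> w ! j" by simp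
  qed
  then show ?thesis using knuth_equiv_map[OF assms(1) strict_mono_on_imp_mono_on[OF assms(2)]] by blast
qed

text \<open>The reading order as a list, obtained as the row word of the identity filling. All row
  words are images of this list, so positions in words become boxes.\<close>

definition boxes :: "box set \<Rightarrow> box list" where
  "boxes D = row_word D (\<lambda>x. x)"

lemma row_word_eq_map: "row_word D L = map L (boxes D)"
  by (simp add: boxes_def row_word_def map_concat comp_def)

lemma finite_row: "finite D \<Longrightarrow> finite {j. (i :: 'b, j :: 'c) \<in> D}"
  by (rule finite_surj[where f = snd and A = D]) force+

lemma set_boxes [simp]: "finite D \<Longrightarrow> set (boxes D) = D"
  by (force simp: boxes_def row_word_def finite_row)

definition reads_before :: "box \<Rightarrow> box \<Rightarrow> bool" where
  "reads_before x y \<longleftrightarrow> fst y < fst x \<or> fst x = fst y \<and> snd x < snd y"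

lemma sorted_boxes: "finite D \<Longrightarrow> sorted_wrt reads_before (boxes D)"
proof -
  assume fin: "finite D"
  have rows: "sorted_wrt reads_before (map (Pair i) (sorted_list_of_set {j. (i, j) \<in> D}))" for i
    using strict_sorted_iff[of "sorted_list_of_set {j. (i, j) \<in> D}"]
    by (simp add: sorted_wrt_map reads_before_def)
  have "sorted_wrt reads_before (concat (map (\<lambda>i. map (Pair i) (sorted_list_of_set {j. (i, j) \<in> D})) is))"
    if "sorted_wrt (>) is" for "is"
    using that rows by (induction "is") (auto simp: sorted_wrt_append reads_before_def)
  moreover have "sorted_wrt (>) (rev (sorted_list_of_set (fst ` D)))"
    using strict_sorted_iff[of "sorted_list_of_set (fst ` D)"] by (simp add: sorted_wrt_rev)
  ultimately show ?thesis by (simp add: boxes_def row_word_def)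
qed

lemma distinct_boxes: "finite D \<Longrightarrow> distinct (boxes D)"
proof -
  have "distinct bs" if "sorted_wrt reads_before bs" for bs
    using that by (induction bs) (auto simp: reads_before_def)
  then show "finite D \<Longrightarrow> distinct (boxes D)" using sorted_boxes by blast
qed

lemma set_row_word [simp]: "finite D \<Longrightarrow> set (row_word D L) = L ` D"
  by (simp add: row_word_eq_map[of D L])

lemma row_word_restrict:
  "finite D \<Longrightarrow> row_word D (\<lambda>x\<in>D. g (L x)) = map g (row_word D L)"
  by (simp add: row_word_eq_map[of D])

lemma SSYT_map_strict:
  assumes "L \<in> SSYT D X" "strict_mono_on (L ` D) g" "g ` L ` D \<subseteq> Y"
  shows "(\<lambda>x\<in>D. g (L x)) \<in> SSYT D Y"
proof -
  have "g a < g b" if "a \<in> L ` D" "b \<in> L ` D" "a < b" for a b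
    using assms(2) that by (auto simp: strict_mono_on_def)
  moreover from this have "g a \<le> g b" if "a \<in> L ` D" "b \<in> L ` D" "a \<le> b" for a b
    using that by (cases "a = b") (auto simp: le_less)
  ultimately show ?thesis
    using assms(1,3) by (auto simp: SSYT_def)
qed

lemma SSYT_subset: "L \<in> SSYT D X \<Longrightarrow> L ` D \<subseteq> Y \<Longrightarrow> L \<in> SSYT D Y"
  by (auto simp: SSYT_def PiE_def Pi_def)

text \<open>Knuth moves and semi-standardness only see the relative order of the letters. Passing to
  ranks transports the results for positive integers to any linear order, in particular to
  labels.\<close>

definition rank :: "'a::linorder set \<Rightarrow> 'a \<Rightarrow> nat" where
  "rank S x = card {y \<in> S. y \<le> x}"

lemma strict_mono_on_rank: "finite S \<Longrightarrow> strict_mono_on S (rank S)"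
  unfolding rank_def by (intro strict_mono_onI psubset_card_mono) (auto simp: less_le_not_le)

lemma rank_pos: "finite S \<Longrightarrow> x \<in> S \<Longrightarrow> 1 \<le> rank S x"
  unfolding rank_def Suc_le_eq One_nat_def card_gt_0_iff by auto

lemma finite_young [simp]: "finite (young nu)"
  using finite_diagram[of "(nu, [])"] by simp

theorem normal_SSYT_unique:
  fixes R R' :: "box \<Rightarrow> 'a::linorder"
  assumes nu: "is_partition nu" "is_partition nu'"
    and R: "R \<in> SSYT (young nu) UNIV" and R': "R' \<in> SSYT (young nu') UNIV"
    and equiv: "knuth_equiv (row_word (young nu) R) (row_word (young nu') R')"
  shows "nu = nu' \<and> R = R'"
proof -
  define S where "S = R ` young nu"
  have "set (row_word (young nu) R) = set (row_word (young nu') R')"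
    using knuth_equiv_mset[OF equiv] mset_eq_setD by blast
  then have S': "S = R' ` young nu'" by (simp add: S_def)
  have finS: "finite S" by (simp add: S_def)
  define g where "g = rank S"
  have g: "strict_mono_on S g" unfolding g_def by (rule strict_mono_on_rank[OF finS])
  have gpos: "g ` S \<subseteq> {1..}" using rank_pos[OF finS] by (auto simp: g_def)
  define Q where "Q = (\<lambda>x\<in>young nu. g (R x))"
  define Q' where "Q' = (\<lambda>x\<in>young nu'. g (R' x))"
  have Q: "Q \<in> SSYT (young nu) {1..}" unfolding Q_def
    by (rule SSYT_map_strict[OF R]) (use g gpos in \<open>simp_all add: S_def\<close>)
  have Q': "Q' \<in> SSYT (young nu') {1..}" unfolding Q'_def
    by (rule SSYT_map_strict[OF R']) (use g gpos in \<open>simp_all add: S'\<close>)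
  have wQ: "rword (length nu) (diagram_rows (nu, []) Q) = map g (row_word (young nu) R)"
    using row_word_diagram[of nu "[]" Q] row_word_restrict[OF finite_young, of nu g] by (simp add: Q_def)
  have wQ': "rword (length nu') (diagram_rows (nu', []) Q') = map g (row_word (young nu') R')"
    using row_word_diagram[of nu' "[]" Q'] row_word_restrict[OF finite_young, of nu' g] by (simp add: Q'_def)
  have "nu = nu' \<and> diagram_rows (nu, []) Q = diagram_rows (nu', []) Q'"
  proof (rule normal_tableau_unique[OF nu])
    show "diagram_rows (nu, []) Q \<in> normal_tableaux nu" "diagram_rows (nu', []) Q' \<in> normal_tableaux nu'"
      using SSYT_normal_bij[OF nu(1)] SSYT_normal_bij[OF nu(2)] Q Q' by (auto simp: bij_betw_def)
    show "knuth_equiv (rword (length nu) (diagram_rows (nu, []) Q)) (rword (length nu') (diagram_rows (nu', []) Q'))"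
      unfolding wQ wQ' by (rule knuth_equiv_map_strict[OF equiv]) (use g in \<open>simp add: S_def\<close>)
  qed
  then have eq: "nu = nu'" "Q = Q'"
    using SSYT_normal_bij[OF nu(1)] Q Q' by (auto simp: bij_betw_def inj_on_def)
  have "R x = R' x" if "x \<in> young nu" for x
  proof -
    have "g (R x) = g (R' x)" using fun_cong[OF eq(2), of x] that eq(1) by (simp add: Q_def Q'_def)
    moreover have "R x \<in> S" using that unfolding S_def by (rule imageI)
    moreover have "R' x \<in> S" using that eq(1) unfolding S' by blast
    ultimately show ?thesis using strict_mono_on_imp_inj_on[OF g] by (auto simp: inj_on_def)
  qed
  then have "R = R'"
    using R R' eq(1) by (intro PiE_ext[of R "young nu" "\<lambda>_. UNIV" R']) (auto simp: SSYT_def)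
  then show ?thesis using eq(1) by simp
qed

theorem normal_SSYT_exists:
  fixes w :: "'a::linorder list"
  shows "\<exists>nu R. is_partition nu \<and> R \<in> SSYT (young nu) UNIV \<and> knuth_equiv (row_word (young nu) R) w"
proof -
  define g where "g = rank (set w)"
  define h where "h = inv_into (set w) g"
  have g: "strict_mono_on (set w) g" unfolding g_def by (rule strict_mono_on_rank) simp
  have inj: "inj_on g (set w)" by (rule strict_mono_on_imp_inj_on[OF g])
  have h: "strict_mono_on (g ` set w) h"
  proof (rule strict_mono_onI)
    fix a b
    assume "a \<in> g ` set w" "b \<in> g ` set w" "a < b"
    then obtain x y where xy: "x \<in> set w" "y \<in> set w" "a = g x" "b = g y" "g x < g y" by auto
    then have "x < y" using g by (metis linorder_neqE order.asym strict_mono_onD less_irrefl)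
    then show "h a < h b" using xy inj by (simp add: h_def)
  qed
  have "set (map g w) \<subseteq> {1..}" using rank_pos[of "set w"] by (auto simp: g_def)
  then obtain nu f where nu: "is_partition nu" "f \<in> normal_tableaux nu" "knuth_equiv (rword (length nu) f) (map g w)"
    using normal_tableau_exists by blast
  then obtain Q where Q: "Q \<in> SSYT (young nu) {1..}" "f = diagram_rows (nu, []) Q"
    using SSYT_normal_bij[OF nu(1)] unfolding bij_betw_def by blast
  have equiv: "knuth_equiv (row_word (young nu) Q) (map g w)"
    using nu(3) row_word_diagram[of nu "[]" Q] by (simp add: Q(2))
  then have "set (row_word (young nu) Q) = set (map g w)" using knuth_equiv_mset mset_eq_setD by blast
  then have setQ: "Q ` young nu = g ` set w" by simp
  define R where "R = (\<lambda>x\<in>young nu. h (Q x))"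
  have "R \<in> SSYT (young nu) UNIV" unfolding R_def
    by (rule SSYT_map_strict[OF Q(1)]) (use h setQ in simp_all)
  moreover have "row_word (young nu) R = map h (row_word (young nu) Q)"
    by (simp add: R_def row_word_restrict)
  moreover have "knuth_equiv (map h (row_word (young nu) Q)) (map h (map g w))"
    by (rule knuth_equiv_map_strict[OF equiv]) (use h setQ in simp)
  moreover have "map h (map g w) = w" using inj by (simp add: h_def map_idI)
  ultimately show ?thesis using nu(1) by metis
qed

lemma Rect_eqI:
  assumes "is_partition nu" "R \<in> SSYT (young nu) UNIV" "knuth_equiv (row_word (young nu) R) (row_word D L)"
  shows "Rect D L = (nu, R)"
  unfolding Rect_def
proof (rule the_equality)
  fix p
  assume "case p of (nu, R) \<Rightarrow> is_partition nu \<and> R \<in> SSYT (young nu) UNIV \<and>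
     knuth_equiv (row_word (young nu) R) (row_word D L)"
  then show "p = (nu, R)"
    using normal_SSYT_unique[of "fst p" nu "snd p" R] assms knuth_equiv_sym knuth_equiv_trans
    by (cases p) (simp, blast)
qed (use assms in auto)

lemma Rect_cases:
  obtains nu R where "Rect D L = (nu, R)" "is_partition nu" "R \<in> SSYT (young nu) UNIV"
    "knuth_equiv (row_word (young nu) R) (row_word D L)"
  using normal_SSYT_exists[of "row_word D L"] Rect_eqI by metis

section \<open>Standardization\<close>

fun label_val :: "label \<Rightarrow> nat" where
  "label_val (Lab k l) = k"

lemma mono_label_val: "x \<le> y \<Longrightarrow> label_val x \<le> label_val y"
  by (cases x; cases y) auto

lemma phi_T_eq:
  assumes "x \<in> D"
  shows "phi_T D L x = Lab (L x) (card {y \<in> D. L y = L x \<and> \<not> reads_before x y})"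
proof -
  obtain i j where x: "x = (i, j)" by fastforce
  have "{(i', j') \<in> D. L (i', j') = L (i, j) \<and> (i < i' \<or> i' = i \<and> j' \<le> j)} =
      {y \<in> D. L y = L x \<and> \<not> reads_before x y}"
    by (auto simp: x reads_before_def)
  then show ?thesis using assms by (simp add: phi_T_def x)
qed

lemma label_val_phi_T [simp]: "x \<in> D \<Longrightarrow> label_val (phi_T D L x) = L x"
  by (simp add: phi_T_eq)

lemma phi_T_strict:
  assumes "finite D" "x \<in> D" "y \<in> D" "L x < L y \<or> L x = L y \<and> reads_before x y"
  shows "phi_T D L x < phi_T D L y"
proof (cases "L x < L y")
  case False
  then have xy: "L x = L y" "reads_before x y" using assms by auto
  have "{z \<in> D. L z = L x \<and> \<not> reads_before x z} \<subset> {z \<in> D. L z = L y \<and> \<not> reads_before y z}"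
  proof
    show "{z \<in> D. L z = L x \<and> \<not> reads_before x z} \<subseteq> {z \<in> D. L z = L y \<and> \<not> reads_before y z}"
      using xy by (auto simp: reads_before_def)
    have "y \<in> {z \<in> D. L z = L y \<and> \<not> reads_before y z}" "y \<notin> {z \<in> D. L z = L x \<and> \<not> reads_before x z}"
      using xy assms by (auto simp: reads_before_def)
    then show "{z \<in> D. L z = L x \<and> \<not> reads_before x z} \<noteq> {z \<in> D. L z = L y \<and> \<not> reads_before y z}" by blast
  qed
  then have "card {z \<in> D. L z = L x \<and> \<not> reads_before x z} < card {z \<in> D. L z = L y \<and> \<not> reads_before y z}"
    using assms(1) by (intro psubset_card_mono) auto
  then show ?thesis using xy assms by (simp add: phi_T_eq)
qed (use assms in \<open>simp add: phi_T_eq\<close>)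

lemma reads_before_linear: "x \<noteq> y \<Longrightarrow> reads_before x y \<or> reads_before y x"
  by (auto simp: reads_before_def prod_eq_iff)

lemma inj_on_phi_T: "finite D \<Longrightarrow> inj_on (phi_T D L) D"
proof (rule inj_onI, rule ccontr)
  fix x y
  assume "finite D" "x \<in> D" "y \<in> D" "phi_T D L x = phi_T D L y" "x \<noteq> y"
  then show False
    using phi_T_strict[of D x y L] phi_T_strict[of D y x L] reads_before_linear[of x y]
    by (metis less_irrefl linorder_neqE_nat)
qed

lemma phi_T_SSYT: "finite D \<Longrightarrow> L \<in> SSYT D X \<Longrightarrow> phi_T D L \<in> SSYT D UNIV"
  unfolding SSYT_def
proof (intro CollectI conjI allI impI)
  show "phi_T D L \<in> D \<rightarrow>\<^sub>E UNIV" by (auto simp: phi_T_def)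
next
  fix i j j'
  assume *: "finite D" "(i, j) \<in> D \<and> (i, j') \<in> D \<and> j < j'"
    "L \<in> {M \<in> D \<rightarrow>\<^sub>E X. (\<forall>i j j'. (i, j) \<in> D \<and> (i, j') \<in> D \<and> j < j' \<longrightarrow> M (i, j) \<le> M (i, j')) \<and>
       (\<forall>i i' j. (i, j) \<in> D \<and> (i', j) \<in> D \<and> i < i' \<longrightarrow> M (i, j) < M (i', j))}"
  then have "L (i, j) \<le> L (i, j')" by blast
  moreover have "reads_before (i, j) (i, j')" using * by (simp add: reads_before_def)
  ultimately have "L (i, j) < L (i, j') \<or> L (i, j) = L (i, j') \<and> reads_before (i, j) (i, j')"
    using le_neq_implies_less by blast
  then show "phi_T D L (i, j) \<le> phi_T D L (i, j')"
    using * by (intro less_imp_le phi_T_strict) blast+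
next
  fix i i' j
  assume *: "finite D" "(i, j) \<in> D \<and> (i', j) \<in> D \<and> i < i'"
    "L \<in> {M \<in> D \<rightarrow>\<^sub>E X. (\<forall>i j j'. (i, j) \<in> D \<and> (i, j') \<in> D \<and> j < j' \<longrightarrow> M (i, j) \<le> M (i, j')) \<and>
       (\<forall>i i' j. (i, j) \<in> D \<and> (i', j) \<in> D \<and> i < i' \<longrightarrow> M (i, j) < M (i', j))}"
  then show "phi_T D L (i, j) < phi_T D L (i', j)"
    by (intro phi_T_strict) auto
qed

text \<open>Rectification commutes with standardization. Forgetting subscripts keeps rows weakly
  increasing. Columns stay strict because Knuth moves preserve the increasing order of letters of
  equal value, whereas in a column the larger letter is read first.\<close>

lemma Rect_phi_T:
  assumes "finite D" "Rect D (phi_T D L) = (nu, R)"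
  shows "Rect D L = (nu, \<lambda>y\<in>young nu. label_val (R y))"
proof -
  have R: "is_partition nu" "R \<in> SSYT (young nu) UNIV"
    "knuth_equiv (row_word (young nu) R) (row_word D (phi_T D L))"
    using Rect_cases[of D "phi_T D L"] assms(2) by (metis prod.inject)+
  define w where "w = row_word D (phi_T D L)"
  have "sorted_wrt (\<lambda>x y. label_val x = label_val y \<longrightarrow> x \<le> y) w"
    unfolding w_def row_word_eq_map[of D "phi_T D L"] sorted_wrt_map
    by (rule sorted_wrt_mono_rel[OF _ sorted_boxes[OF assms(1)]])
      (use assms(1) in \<open>auto intro!: less_imp_le phi_T_strict\<close>)
  then have equiv: "knuth_equiv (map label_val w) (map label_val (row_word (young nu) R))"
    and std: "sorted_wrt (\<lambda>x y. label_val x = label_val y \<longrightarrow> x \<le> y) (row_word (young nu) R)"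
    using knuth_equiv_map[OF knuth_equiv_sym[OF R(3)], of label_val] mono_label_val
    by (auto simp: w_def mono_on_def)
  have strict: "label_val (R (i, j)) < label_val (R (i', j))"
    if "(i, j) \<in> young nu" "(i', j) \<in> young nu" "i < i'" for i i' j
  proof -
    have lt: "R (i, j) < R (i', j)" using R(2) that by (simp add: SSYT_def)
    have "sorted_wrt (\<lambda>x y. label_val (R x) = label_val (R y) \<longrightarrow> R x \<le> R y) (boxes (young nu))"
      using std by (simp add: row_word_eq_map[of "young nu" R] sorted_wrt_map)
    then have st: "\<And>s t. s < t \<Longrightarrow> t < length (boxes (young nu)) \<Longrightarrow>
        label_val (R (boxes (young nu) ! s)) = label_val (R (boxes (young nu) ! t)) \<Longrightarrow>
        R (boxes (young nu) ! s) \<le> R (boxes (young nu) ! t)"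
      by (simp add: sorted_wrt_iff_nth_less)
    have "(i', j) \<in> set (boxes (young nu))" "(i, j) \<in> set (boxes (young nu))" using that by simp_all
    then obtain s t where s: "s < length (boxes (young nu))" "boxes (young nu) ! s = (i', j)"
      and t: "t < length (boxes (young nu))" "boxes (young nu) ! t = (i, j)"
      unfolding in_set_conv_nth by blast
    have "s < t"
    proof (rule ccontr)
      assume "\<not> s < t"
      moreover have "s \<noteq> t" using s t that by auto
      ultimately have "t < s" by simp
      then have "reads_before (i, j) (i', j)"
        using sorted_wrt_nth_less[OF sorted_boxes[OF finite_young[of nu]], of t s] s t by simp
      then show False using that by (simp add: reads_before_def)
    qed
    then have "label_val (R (i, j)) \<noteq> label_val (R (i', j))" using st[of s t] s t lt by auto
    then show ?thesis using mono_label_val[OF less_imp_le[OF lt]] by simp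
  qed
  show ?thesis
  proof (rule Rect_eqI[OF R(1)])
    show "(\<lambda>y\<in>young nu. label_val (R y)) \<in> SSYT (young nu) UNIV"
      using R(2) strict mono_label_val by (auto simp: SSYT_def)
    have "row_word (young nu) (\<lambda>y\<in>young nu. label_val (R y)) = map label_val (row_word (young nu) R)"
      by (simp add: row_word_restrict)
    moreover have "row_word D L = map label_val w"
      using assms(1) by (simp add: w_def row_word_eq_map[of D])
    ultimately show "knuth_equiv (row_word (young nu) (\<lambda>y\<in>young nu. label_val (R y))) (row_word D L)"
      using knuth_equiv_sym[OF equiv] by simp
  qed
qed

lemma inj_on_Rect:
  assumes "finite D" "inj_on T D" "knuth_equiv (row_word (young nu) R) (row_word D T)"
  shows "inj_on R (young nu) \<and> R ` young nu = T ` D"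
proof -
  have "mset (row_word (young nu) R) = mset (row_word D T)" by (rule knuth_equiv_mset[OF assms(3)])
  moreover have "distinct (row_word D T)"
    using assms distinct_boxes[OF assms(1)] by (simp add: row_word_eq_map[of D T] distinct_map)
  ultimately have "distinct (row_word (young nu) R)" "set (row_word (young nu) R) = set (row_word D T)"
    using mset_eq_imp_distinct_iff mset_eq_setD by blast+
  then show ?thesis using assms(1) by (simp add: row_word_eq_map[of "young nu" R] distinct_map)
qed

lemma rho_properties:
  assumes "finite D" "Rect D (phi_T D L) = (nu, R)"
  shows "bij_betw (rho D L) D (young nu)" and "x \<in> D \<Longrightarrow> R (rho D L x) = phi_T D L x"
proof -
  have "knuth_equiv (row_word (young nu) R) (row_word D (phi_T D L))"
    using Rect_cases[of D "phi_T D L"] assms(2) by (metis prod.inject)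
  from inj_on_Rect[OF assms(1) inj_on_phi_T[OF assms(1)] this]
  have inj: "inj_on R (young nu)" and im: "R ` young nu = phi_T D L ` D" by auto
  have ex: "\<exists>!y. y \<in> young nu \<and> R y = phi_T D L x" if "x \<in> D" for x
  proof -
    have "phi_T D L x \<in> R ` young nu" using that im by blast
    then obtain y where y: "y \<in> young nu" "R y = phi_T D L x" by auto
    moreover have "y' = y" if "y' \<in> young nu" "R y' = phi_T D L x" for y'
      using inj_onD[OF inj, of y' y] that y by simp
    ultimately show ?thesis by blast
  qed
  have rho: "rho D L x \<in> young nu \<and> R (rho D L x) = phi_T D L x" if "x \<in> D" for x
    using theI'[OF ex[OF that]] by (simp add: rho_def assms(2))
  then show "x \<in> D \<Longrightarrow> R (rho D L x) = phi_T D L x" by blast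
  show "bij_betw (rho D L) D (young nu)"
  proof (rule bij_betw_imageI)
    show "inj_on (rho D L) D"
    proof (rule inj_onI)
      fix x y
      assume "x \<in> D" "y \<in> D" "rho D L x = rho D L y"
      then have "phi_T D L x = phi_T D L y" using rho[of x] rho[of y] by simp
      then show "x = y" using inj_onD[OF inj_on_phi_T[OF assms(1)]] \<open>x \<in> D\<close> \<open>y \<in> D\<close> by blast
    qed
    have "y \<in> rho D L ` D" if "y \<in> young nu" for y
    proof -
      have "R y \<in> phi_T D L ` D" using im that by blast
      then obtain x where "x \<in> D" "R y = phi_T D L x" by blast
      then have "rho D L x = y" using ex[of x] rho[of x] \<open>y \<in> young nu\<close> by blast
      then show ?thesis using \<open>x \<in> D\<close> by blast
    qed
    then show "rho D L ` D = young nu" using rho by auto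
  qed
qed

section \<open>Chains of boxes and the arms\<close>

lemma subseq_triple: "subseq xs [x, y, z] \<longleftrightarrow>
    xs \<in> {[], [x], [y], [z], [x, y], [x, z], [y, z], [x, y, z]}"
proof -
  have "subseqs [x, y, z] = [[x, y, z], [x, y], [x, z], [x], [y, z], [y], [z], []]"
    by (simp add: Let_def)
  then have "set (subseqs [x, y, z]) = {[], [x], [y], [z], [x, y], [x, z], [y, z], [x, y, z]}" by auto
  then show ?thesis using in_set_subseqs[of xs "[x, y, z]"] by blast
qed

text \<open>The lengths of weakly increasing (strictly decreasing) subsequences with letters in a
  down-closed set are invariant under Knuth equivalence: a pair that the step destroys is
  replaced by a pair containing the witness of the step.\<close>

lemma knuth_equiv_subseq:
  fixes w :: "'a::linorder list"
  assumes "knuth_equiv w w'" and r: "r = (\<le>) \<or> r = (>)"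
    and "subseq xs w" "sorted_wrt r xs" "set xs \<subseteq> A"
    and down: "\<And>x y. x \<in> A \<Longrightarrow> y \<le> x \<Longrightarrow> y \<in> A"
  shows "\<exists>ys. subseq ys w' \<and> sorted_wrt r ys \<and> set ys \<subseteq> A \<and> length ys = length xs"
  using assms(1,3-5)
proof (induction rule: knuth_equiv_induct)
  case refl
  then show ?case by blast
next
  case (step u p q v)
  then obtain ys where ys: "subseq ys (u @ p @ v)" "sorted_wrt r ys" "set ys \<subseteq> A" "length ys = length xs"
    by blast
  then obtain yu yp yv where split: "ys = yu @ yp @ yv" "subseq yu u" "subseq yp p" "subseq yv v"
    by (metis subseq_appendE)
  have srt: "sorted_wrt r yu" "sorted_wrt r yp" "sorted_wrt r yv" "\<And>a b. a \<in> set yu \<Longrightarrow> b \<in> set yp \<union> set yv \<Longrightarrow> r a b"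
    "\<And>a b. a \<in> set yp \<Longrightarrow> b \<in> set yv \<Longrightarrow> r a b"
    using ys(2) by (auto simp: split sorted_wrt_append)
  have "\<exists>zp. subseq zp q \<and> length zp = length yp \<and> set zp \<subseteq> A \<and> sorted_wrt r zp \<and>
      (\<forall>a\<in>set yu. \<forall>b\<in>set zp. r a b) \<and> (\<forall>a\<in>set zp. \<forall>b\<in>set yv. r a b)"
  proof (cases "subseq yp q")
    case True
    then show ?thesis using ys(3) srt split(1) by (intro exI[of _ yp]) auto
  next
    case False
    show ?thesis
      using step.hyps(2)
    proof (cases rule: knuth_triple_cases)
      case (1 x y z)
      have "yp = [y, z] \<or> yp = [x, y, z]" using False split(3) unfolding 1 subseq_triple by auto
      moreover have "yp \<noteq> [x, y, z]" using srt(2) 1(3) r by auto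
      ultimately have yp: "yp = [y, z]" by simp
      have yz: "r y z" "y \<in> A" "z \<in> A" using srt(2) ys(3) by (auto simp: yp split)
      have xz: "r x z" "x \<in> A" using r 1(3) yz down by auto
      have yu: "r a x" if "a \<in> set yu" for a
      proof -
        have "r a y" "r a z" using srt(4)[OF that] by (auto simp: yp)
        then show ?thesis using r 1(3) yz by auto
      qed
      have yv: "r x b" if "b \<in> set yv" for b
      proof -
        have "r y b" "r z b" using srt(5)[OF _ that] by (auto simp: yp)
        then show ?thesis using r 1(3) yz by auto
      qed
      show ?thesis
        using xz yz srt yp yu yv by (intro exI[of _ "[x, z]"]) (auto simp: 1 subseq_triple)
    next
      case (2 x y z)
      have "yp = [x, y] \<or> yp = [x, y, z]" using False split(3) unfolding 2 subseq_triple by auto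
      moreover have "yp \<noteq> [x, y, z]" using srt(2) 2(3) r by auto
      ultimately have yp: "yp = [x, y]" by simp
      have xy: "r x y" "x \<in> A" "y \<in> A" using srt(2) ys(3) by (auto simp: yp split)
      have xz: "r x z" "z \<in> A" using r 2(3) xy down by auto
      have yv: "r z b" if "b \<in> set yv" for b
      proof -
        have "r x b" "r y b" using srt(5)[OF _ that] by (auto simp: yp)
        then show ?thesis using r 2(3) xy by auto
      qed
      have yu: "r a z" if "a \<in> set yu" for a
      proof -
        have "r a x" "r a y" using srt(4)[OF that] by (auto simp: yp)
        then show ?thesis using r 2(3) xy by auto
      qed
      show ?thesis
        using xz xy srt yp yv yu by (intro exI[of _ "[x, z]"]) (auto simp: 2 subseq_triple)
    qed
  qed
  then obtain zp where zp: "subseq zp q" "length zp = length yp" "set zp \<subseteq> A" "sorted_wrt r zp"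
      "\<forall>a\<in>set yu. \<forall>b\<in>set zp. r a b" "\<forall>a\<in>set zp. \<forall>b\<in>set yv. r a b" by blast
  have "subseq (yu @ zp @ yv) (u @ q @ v)" using split zp(1) by (intro list_emb_append_mono) auto
  moreover have "sorted_wrt r (yu @ zp @ yv)" using srt zp by (auto simp: sorted_wrt_append)
  moreover have "set (yu @ zp @ yv) \<subseteq> A" using zp(3) ys(3) split(1) by auto
  moreover have "length (yu @ zp @ yv) = length xs" using zp(2) ys(4) split(1) by simp
  ultimately show ?case by blast
qed

text \<open>An increasing or decreasing subword, recorded by its set of boxes, so that its length
  can be bounded by counting columns or rows.\<close>

definition box_chain :: "('a \<Rightarrow> 'a \<Rightarrow> bool) \<Rightarrow> box set \<Rightarrow> (box \<Rightarrow> 'a) \<Rightarrow> box set \<Rightarrow> bool" where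
  "box_chain r D T C \<longleftrightarrow> C \<subseteq> D \<and> (\<forall>c\<in>C. \<forall>d\<in>C. reads_before c d \<longrightarrow> r (T c) (T d))"

lemma box_chain_subset: "box_chain r D T C \<Longrightarrow> c \<in> C \<Longrightarrow> c \<in> D"
  by (auto simp: box_chain_def)

lemma box_chain_insert_last:
  assumes "box_chain r D T C" "x \<in> D" "\<And>c. c \<in> C \<Longrightarrow> \<not> reads_before x c \<and> r (T c) (T x)"
  shows "box_chain r D T (insert x C)"
proof -
  have "\<not> reads_before x x" by (simp add: reads_before_def)
  then show ?thesis using assms unfolding box_chain_def by blast
qed

lemma box_chain_insert_first:
  assumes "box_chain r D T C" "x \<in> D" "\<And>c. c \<in> C \<Longrightarrow> \<not> reads_before c x \<and> r (T x) (T c)"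
  shows "box_chain r D T (insert x C)"
proof -
  have "\<not> reads_before x x" by (simp add: reads_before_def)
  then show ?thesis using assms unfolding box_chain_def by blast
qed

lemma box_chain_subseq:
  assumes "finite D" "box_chain r D T C"
  shows "\<exists>xs. subseq xs (row_word D T) \<and> sorted_wrt r xs \<and> set xs = T ` C \<and> length xs = card C"
proof -
  define bs where "bs = filter (\<lambda>x. x \<in> C) (boxes D)"
  have set: "set bs = C" using assms by (auto simp: bs_def box_chain_def)
  have "sorted_wrt reads_before bs" using sorted_boxes[OF assms(1)] by (simp add: bs_def sorted_wrt_filter)
  then have "sorted_wrt (\<lambda>x y. r (T x) (T y)) bs"
    by (rule sorted_wrt_mono_rel[rotated]) (use assms(2) set in \<open>auto simp: box_chain_def\<close>)
  moreover have "length bs = card C"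
    using distinct_card[of bs] distinct_boxes[OF assms(1)] set by (simp add: bs_def)
  ultimately show ?thesis
    using set by (intro exI[of _ "map T bs"]) (auto simp: row_word_eq_map[of D T] sorted_wrt_map bs_def subseq_map)
qed

lemma subseq_box_chain:
  assumes "finite D" "subseq xs (row_word D T)" "sorted_wrt r xs"
  shows "\<exists>C. box_chain r D T C \<and> set xs = T ` C \<and> card C = length xs"
proof -
  obtain N where N: "xs = nths (map T (boxes D)) N"
    using assms(2) by (auto simp: row_word_eq_map[of D T] subseq_conv_nths)
  define bs where "bs = nths (boxes D) N"
  have xs: "xs = map T bs" by (simp add: N bs_def nths_map)
  have sub: "subseq bs (boxes D)" by (auto simp: bs_def subseq_conv_nths)
  have sorted_sub: "sorted_wrt P as" if "subseq as cs" "sorted_wrt P cs" for P and as cs :: "box list"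
    using that by (induction rule: list_emb.induct) (auto dest: list_emb_set)
  have dist: "distinct bs" using distinct_boxes[OF assms(1)] by (simp add: bs_def distinct_nthsI)
  have "sorted_wrt reads_before bs" by (rule sorted_sub[OF sub sorted_boxes[OF assms(1)]])
  moreover have "sorted_wrt (\<lambda>c d. r (T c) (T d)) bs" using assms(3) by (simp add: xs sorted_wrt_map)
  ultimately have *: "\<forall>c\<in>set bs. \<forall>d\<in>set bs. reads_before c d \<longrightarrow> r (T c) (T d)"
    using dist
  proof (induction bs)
    case (Cons b bs)
    have "\<not> reads_before c b" if "c \<in> set bs" for c
      using Cons.prems(1) that by (auto simp: reads_before_def)
    moreover have "\<not> reads_before b b" by (simp add: reads_before_def)
    ultimately show ?case using Cons by auto
  qed simp
  have "set bs \<subseteq> D" using set_nths_subset[of "boxes D" N] assms(1) by (simp add: bs_def)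
  then show ?thesis using * dist by (intro exI[of _ "set bs"]) (simp add: box_chain_def xs distinct_card)
qed

lemma box_chain_transfer:
  assumes "finite D" "finite D'" "knuth_equiv (row_word D T) (row_word D' T')"
    and "r = (\<le>) \<or> r = (>)" "box_chain r D T C" "T ` C \<subseteq> A" "\<And>x y. x \<in> A \<Longrightarrow> y \<le> x \<Longrightarrow> y \<in> A"
  obtains C' where "box_chain r D' T' C'" "T' ` C' \<subseteq> A" "card C' = card C"
proof -
  obtain xs where "subseq xs (row_word D T)" "sorted_wrt r xs" "set xs = T ` C" "length xs = card C"
    using box_chain_subseq[OF assms(1,5)] by blast
  then obtain ys where "subseq ys (row_word D' T')" "sorted_wrt r ys" "set ys \<subseteq> A" "length ys = card C"
    using knuth_equiv_subseq[OF assms(3,4), of xs A] assms(6,7) by metis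
  then show thesis using subseq_box_chain[OF assms(2), of ys T' r] that by metis
qed

text \<open>In the rectified tableau the longest chain with letters in a down-set is the part of the
  edge \<open>E\<close> lying in it. A longest chain below \<open>T x\<close> in \<open>D\<close>
  can be extended by \<open>x\<close>; back in the rectified tableau the edge must therefore gain a
  letter between the thresholds below \<open>T x\<close> and up to \<open>T x\<close>, and this
  letter is \<open>T x\<close>.\<close>

lemma box_chain_edge:
  assumes fin: "finite D" and equiv: "knuth_equiv (row_word (young nu) R) (row_word D T)"
    and r: "r = (\<le>) \<or> r = (>)" and edge: "box_chain r (young nu) R E"
    and bound: "\<And>A C. box_chain r (young nu) R C \<Longrightarrow> R ` C \<subseteq> A \<Longrightarrow>
      (\<And>x y. x \<in> A \<Longrightarrow> y \<le> x \<Longrightarrow> y \<in> A) \<Longrightarrow> card C \<le> card {e \<in> E. R e \<in> A}"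
    and x: "x \<in> D"
    and ext: "\<And>C. box_chain r D T C \<Longrightarrow> T ` C \<subseteq> {..<T x} \<Longrightarrow> box_chain r D T (insert x C)"
  shows "\<exists>e\<in>E. R e = T x"
proof (rule ccontr)
  assume no: "\<not> (\<exists>e\<in>E. R e = T x)"
  let ?E = "{e \<in> E. R e < T x}"
  have "box_chain r (young nu) R ?E" using edge by (auto simp: box_chain_def)
  then obtain C where C: "box_chain r D T C" "T ` C \<subseteq> {..<T x}" "card C = card ?E"
    by (rule box_chain_transfer[OF finite_young fin equiv r, of _ "{..<T x}"]) auto
  have "finite C" using C(1) fin finite_subset by (auto simp: box_chain_def)
  moreover have "x \<notin> C" using C(2) by auto
  ultimately have card: "card (insert x C) = Suc (card ?E)" using C(3) by simp
  obtain C' where C': "box_chain r (young nu) R C'" "R ` C' \<subseteq> {..T x}" "card C' = card (insert x C)"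
    by (rule box_chain_transfer[OF fin finite_young knuth_equiv_sym[OF equiv] r ext[OF C(1,2)], of "{..T x}"])
      (use C(2) in auto)
  have "card C' \<le> card {e \<in> E. R e \<in> {..T x}}" by (rule bound[OF C'(1,2)]) auto
  also have "{e \<in> E. R e \<in> {..T x}} = ?E" using no by (auto simp: le_less)
  finally show False using C'(3) card by simp
qed

text \<open>If \<open>T y\<close> were on the edge, admitting the letter \<open>T y\<close> would
  lengthen the longest chain, and a longest chain would have to use \<open>y\<close>. But chains
  using \<open>y\<close> as their largest letter are no longer than \<open>M\<close>, which avoids
  it.\<close>

lemma box_chain_not_edge:
  assumes fin: "finite D" and equiv: "knuth_equiv (row_word (young nu) R) (row_word D T)"
    and r: "r = (\<le>) \<or> r = (>)" and edge: "box_chain r (young nu) R E"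
    and bound: "\<And>A C. box_chain r (young nu) R C \<Longrightarrow> R ` C \<subseteq> A \<Longrightarrow>
      (\<And>x y. x \<in> A \<Longrightarrow> y \<le> x \<Longrightarrow> y \<in> A) \<Longrightarrow> card C \<le> card {e \<in> E. R e \<in> A}"
    and inj: "inj_on T D" and y: "y \<in> D"
    and M: "box_chain r D T M" "T ` M \<subseteq> {..<T y}"
    and C: "\<And>C. box_chain r D T C \<Longrightarrow> y \<in> C \<Longrightarrow> T ` C \<subseteq> {..T y} \<Longrightarrow> card C \<le> card M"
  shows "T y \<notin> R ` E"
proof
  assume "T y \<in> R ` E"
  then obtain e where e: "e \<in> E" "R e = T y" by auto
  let ?E = "{e \<in> E. R e \<in> {..<T y}}" and ?E' = "{e \<in> E. R e \<in> {..T y}}"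
  have finE: "finite E" using edge by (auto simp: box_chain_def intro: finite_subset[OF _ finite_young])
  have "insert e ?E \<subseteq> ?E'" using e by auto
  then have "card (insert e ?E) \<le> card ?E'" using finE by (intro card_mono) auto
  moreover have "e \<notin> ?E" using e by simp
  ultimately have lt: "card ?E < card ?E'" using finE by simp
  have "box_chain r (young nu) R ?E'" using edge by (auto simp: box_chain_def)
  then obtain C where C': "box_chain r D T C" "T ` C \<subseteq> {..T y}" "card C = card ?E'"
    by (rule box_chain_transfer[OF finite_young fin equiv r, of _ "{..T y}"]) auto
  have lift_back: "card C \<le> card ?E" if C1: "box_chain r D T C" "T ` C \<subseteq> {..<T y}" for C
  proof -
    obtain C2 where "box_chain r (young nu) R C2" "R ` C2 \<subseteq> {..<T y}" "card C2 = card C"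
      by (rule box_chain_transfer[OF fin finite_young knuth_equiv_sym[OF equiv] r C1]) auto
    then show ?thesis using bound[of C2 "{..<T y}"] by auto
  qed
  have "y \<in> C"
  proof (rule ccontr)
    assume "y \<notin> C"
    moreover have "C \<subseteq> D" using C'(1) by (simp add: box_chain_def)
    ultimately have "T c \<noteq> T y" if "c \<in> C" for c using that inj_onD[OF inj, of c y] y by auto
    then have "T ` C \<subseteq> {..<T y}" using C'(2) by (force simp: le_less)
    then show False using lift_back[OF C'(1)] C'(3) lt by simp
  qed
  then have "card C \<le> card M" using C C' by blast
  moreover have "card M \<le> card ?E" by (rule lift_back[OF M])
  ultimately show False using C'(3) lt by simp
qed

section \<open>The first row and the first column as longest chains\<close>

lemma SSYT_row: "T \<in> SSYT D X \<Longrightarrow> (i, j) \<in> D \<Longrightarrow> (i, j') \<in> D \<Longrightarrow> j \<le> j' \<Longrightarrow> T (i, j) \<le> T (i, j')"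
  by (cases "j = j'") (auto simp: SSYT_def)

lemma SSYT_col: "T \<in> SSYT D X \<Longrightarrow> (i, j) \<in> D \<Longrightarrow> (i', j) \<in> D \<Longrightarrow> i < i' \<Longrightarrow> T (i, j) < T (i', j)"
  by (auto simp: SSYT_def)

text \<open>In a column the lower box is read first and holds the larger entry.\<close>

lemma increasing_chain_columns:
  assumes "T \<in> SSYT D X" "box_chain (\<le>) D T C"
  shows "inj_on snd C"
proof (rule inj_onI, rule ccontr)
  fix c d
  assume cd: "c \<in> C" "d \<in> C" "snd c = snd d" "c \<noteq> d"
  have *: False if "c \<in> C" "d \<in> C" "snd c = snd d" "fst d < fst c" for c d
  proof -
    have "T c \<le> T d" using assms(2) that by (auto simp: box_chain_def reads_before_def)
    moreover have "T d < T c"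
      using SSYT_col[OF assms(1), of "fst d" "snd d" "fst c"] that assms(2)
      by (metis box_chain_def prod.collapse subsetD)
    ultimately show False by simp
  qed
  have "fst c \<noteq> fst d" using cd by (simp add: prod_eq_iff)
  then show False using *[of c d] *[of d c] cd by (metis linorder_neqE)
qed

lemma decreasing_chain_rows:
  assumes "T \<in> SSYT D X" "box_chain (>) D T C"
  shows "inj_on fst C"
proof (rule inj_onI, rule ccontr)
  fix c d
  assume cd: "c \<in> C" "d \<in> C" "fst c = fst d" "c \<noteq> d"
  have *: False if "c \<in> C" "d \<in> C" "fst c = fst d" "snd c < snd d" for c d
  proof -
    have "T d < T c" using assms(2) that by (auto simp: box_chain_def reads_before_def)
    moreover have "T c \<le> T d"
      using SSYT_row[OF assms(1), of "fst c" "snd c" "snd d"] that assms(2)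
      by (metis box_chain_def prod.collapse subsetD less_imp_le)
    ultimately show False by simp
  qed
  have "snd c \<noteq> snd d" using cd by (simp add: prod_eq_iff)
  then show False using *[of c d] *[of d c] cd by (metis linorder_neqE)
qed

lemma young_iff: "(i, j) \<in> young nu \<longleftrightarrow> (\<exists>k c. i = int k \<and> j = int c \<and> 1 \<le> c \<and> c \<le> part nu k)"
  using diagram_iff[of i j nu "[]"] by (auto simp: Suc_le_eq)

lemma young_first_row: "is_partition nu \<Longrightarrow> (i, j) \<in> young nu \<Longrightarrow> (1, j) \<in> young nu"
proof -
  assume nu: "is_partition nu" and "(i, j) \<in> young nu"
  then obtain k c where kc: "i = int k" "j = int c" "1 \<le> c" "c \<le> part nu k" by (auto simp: young_iff)
  then have "1 \<le> k" by (cases k) auto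
  then have "c \<le> part nu 1" using part_antimono[OF nu, of 1 k] kc(4) by simp
  then show "(1, j) \<in> young nu" unfolding young_iff using kc by (intro exI[of _ 1] exI[of _ c]) simp
qed

lemma young_first_column: "(i, j) \<in> young nu \<Longrightarrow> (i, 1) \<in> young nu"
  unfolding young_iff
proof -
  assume "\<exists>k c. i = int k \<and> j = int c \<and> 1 \<le> c \<and> c \<le> part nu k"
  then obtain k c where "i = int k" "1 \<le> c" "c \<le> part nu k" by blast
  then show "\<exists>k c. i = int k \<and> 1 = int c \<and> 1 \<le> c \<and> c \<le> part nu k"
    by (intro exI[of _ k] exI[of _ 1]) simp
qed

text \<open>Moving each box of a chain up to the first row does not increase its entry, hence stays
  in the down-set, and it merges no boxes because they lie in different columns.\<close>

lemma first_row_edge: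
  assumes nu: "is_partition nu" and R: "R \<in> SSYT (young nu) X"
  shows "box_chain (\<le>) (young nu) R {e \<in> young nu. fst e = 1}"
    and "box_chain (\<le>) (young nu) R C \<Longrightarrow> R ` C \<subseteq> A \<Longrightarrow> (\<And>x y. x \<in> A \<Longrightarrow> y \<le> x \<Longrightarrow> y \<in> A) \<Longrightarrow>
      card C \<le> card {e \<in> {e \<in> young nu. fst e = 1}. R e \<in> A}"
proof -
  show "box_chain (\<le>) (young nu) R {e \<in> young nu. fst e = 1}"
    using SSYT_row[OF R] by (auto simp: box_chain_def reads_before_def)
  assume C: "box_chain (\<le>) (young nu) R C" "R ` C \<subseteq> A" and down: "\<And>x y. x \<in> A \<Longrightarrow> y \<le> x \<Longrightarrow> y \<in> A"
  show "card C \<le> card {e \<in> {e \<in> young nu. fst e = 1}. R e \<in> A}"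
  proof (rule card_inj_on_le[where f = "\<lambda>c. (1, snd c)"])
    show "inj_on (\<lambda>c. (1 :: int, snd c)) C" using increasing_chain_columns[OF R C(1)] by (auto simp: inj_on_def)
    have "(1, snd c) \<in> young nu \<and> R (1, snd c) \<in> A" if "c \<in> C" for c
    proof -
      obtain i j where c: "c = (i, j)" by fastforce
      have y: "(i, j) \<in> young nu" using C(1) that by (auto simp: box_chain_def c)
      have 1: "(1, j) \<in> young nu" by (rule young_first_row[OF nu y])
      have "i \<ge> 1"
      proof -
        obtain k d where "i = int k" "1 \<le> d" "d \<le> part nu k" using y by (auto simp: young_iff)
        then show ?thesis by (cases k) auto
      qed
      then have "R (1, j) \<le> R (i, j)" using SSYT_col[OF R 1 y] by (cases "i = 1") auto
      then show ?thesis using 1 down[of "R (i, j)" "R (1, j)"] C(2) that c by auto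
    qed
    then show "(\<lambda>c. (1, snd c)) ` C \<subseteq> {e \<in> {e \<in> young nu. fst e = 1}. R e \<in> A}" by auto
  qed simp
qed

lemma first_column_edge:
  assumes R: "R \<in> SSYT (young nu) X"
  shows "box_chain (>) (young nu) R {e \<in> young nu. snd e = 1}"
    and "box_chain (>) (young nu) R C \<Longrightarrow> R ` C \<subseteq> A \<Longrightarrow> (\<And>x y. x \<in> A \<Longrightarrow> y \<le> x \<Longrightarrow> y \<in> A) \<Longrightarrow>
      card C \<le> card {e \<in> {e \<in> young nu. snd e = 1}. R e \<in> A}"
proof -
  show "box_chain (>) (young nu) R {e \<in> young nu. snd e = 1}"
    using SSYT_col[OF R] by (auto simp: box_chain_def reads_before_def)
  assume C: "box_chain (>) (young nu) R C" "R ` C \<subseteq> A" and down: "\<And>x y. x \<in> A \<Longrightarrow> y \<le> x \<Longrightarrow> y \<in> A"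
  show "card C \<le> card {e \<in> {e \<in> young nu. snd e = 1}. R e \<in> A}"
  proof (rule card_inj_on_le[where f = "\<lambda>c. (fst c, 1)"])
    show "inj_on (\<lambda>c. (fst c, 1 :: int)) C" using decreasing_chain_rows[OF R C(1)] by (auto simp: inj_on_def)
    have "(fst c, 1) \<in> young nu \<and> R (fst c, 1) \<in> A" if "c \<in> C" for c
    proof -
      obtain i j where c: "c = (i, j)" by fastforce
      have y: "(i, j) \<in> young nu" using C(1) that by (auto simp: box_chain_def c)
      have 1: "(i, 1) \<in> young nu" by (rule young_first_column[OF y])
      have "j \<ge> 1" using y by (auto simp: young_iff)
      then have "R (i, 1) \<le> R (i, j)" using SSYT_row[OF R 1 y] by simp
      then show ?thesis using 1 down[of "R (i, j)" "R (i, 1)"] C(2) that c by auto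
    qed
    then show "(\<lambda>c. (fst c, 1)) ` C \<subseteq> {e \<in> {e \<in> young nu. snd e = 1}. R e \<in> A}" by auto
  qed simp
qed


section \<open>Conjugate shapes and the bounds that define the arms\<close>

lemma part_map_upt: "1 \<le> j \<Longrightarrow> j \<le> p \<Longrightarrow> part (map h [1..<Suc p]) j = h j"
  unfolding part_def by (simp add: nth_append del: upt_Suc)

text \<open>Both sides say that the box in row \<open>k\<close> and column \<open>j\<close> belongs
  to the shape. The rows counted by the conjugate form an initial segment since the parts
  decrease.\<close>

lemma part_conjugate_iff:
  assumes "is_partition lam" "1 \<le> j" "1 \<le> k"
  shows "k \<le> part (conjugate lam) j \<longleftrightarrow> j \<le> part lam k"
proof -
  define S where "S = {i. 1 \<le> i \<and> j \<le> part lam i}"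
  have "S \<subseteq> {1..length lam}"
  proof
    fix i
    assume "i \<in> S"
    then have "part lam i \<noteq> 0" using assms(2) by (auto simp: S_def)
    then show "i \<in> {1..length lam}" by (metis part_eq_0)
  qed
  then have fin: "finite S" using finite_subset by blast
  have down: "{1..i} \<subseteq> S" if "i \<in> S" for i
    using part_antimono[OF assms(1)] that by (fastforce simp: S_def intro: order_trans)
  have "S = {1..card S}"
  proof (cases "S = {}")
    case False
    have "S = {1..Max S}"
      using down[OF Max_in[OF fin False]] Max_ge[OF fin] by (auto simp: S_def)
    then show ?thesis by (metis card_atLeastAtMost diff_Suc_1)
  qed simp
  have "part (conjugate lam) j = card S"
  proof (cases "j \<le> part lam 1")
    case True
    then have "part (conjugate lam) j = card {i. 1 \<le> i \<and> j \<le> part lam i}"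
      unfolding conjugate_def by (rule part_map_upt[OF assms(2)])
    then show ?thesis by (simp add: S_def)
  next
    case False
    then have "S = {}" using part_antimono[OF assms(1), of 1] by (force simp: S_def)
    moreover have "part (conjugate lam) j = 0" using False by (simp add: part_def conjugate_def)
    ultimately show ?thesis by simp
  qed
  moreover have "k \<in> S \<longleftrightarrow> k \<le> card S" using \<open>S = {1..card S}\<close> assms(3) by (metis atLeastAtMost_iff)
  ultimately show ?thesis using assms(3) by (simp add: S_def)
qed

lemma part_conjugate_1: "is_partition lam \<Longrightarrow> part (conjugate lam) 1 = length lam"
proof -
  assume lam: "is_partition lam"
  have "k \<le> part (conjugate lam) 1 \<longleftrightarrow> k \<le> length lam" if "1 \<le> k" for k
    using part_conjugate_iff[OF lam _ that, of 1] part_pos[OF lam that] by simp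
  from this[of "part (conjugate lam) 1"] this[of "length lam"]
  have "part (conjugate lam) 1 \<le> length lam" "length lam \<le> part (conjugate lam) 1"
    by linarith+
  then show ?thesis by simp
qed

lemma is_partition_conjugate:
  assumes "is_partition lam"
  shows "is_partition (conjugate lam)"
proof -
  let ?h = "\<lambda>j. card {i. 1 \<le> i \<and> j \<le> part lam i}"
  have fin: "finite {i. 1 \<le> i \<and> j \<le> part lam i}" if "1 \<le> j" for j
  proof (rule finite_subset)
    show "{i. 1 \<le> i \<and> j \<le> part lam i} \<subseteq> {1..length lam}"
    proof
      fix i
      assume "i \<in> {i. 1 \<le> i \<and> j \<le> part lam i}"
      then have "part lam i \<noteq> 0" using that by auto
      then show "i \<in> {1..length lam}" by (metis part_eq_0)
    qed
  qed simp
  have "?h j \<le> ?h i" if "1 \<le> i" "i \<le> j" for i j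
    by (rule card_mono[OF fin[OF that(1)]]) (use that in auto)
  then have "sorted_wrt (\<lambda>i j. ?h j \<le> ?h i) [1..<Suc (part lam 1)]"
    by (auto simp: sorted_wrt_iff_nth_less simp del: upt_Suc)
  moreover have "?h j \<noteq> 0" if "1 \<le> j" "j \<le> part lam 1" for j
    using fin[OF that(1)] that by (auto simp: card_eq_0_iff)
  ultimately show ?thesis
    unfolding is_partition_def conjugate_def by (force simp: sorted_wrt_map less_Suc_eq_le simp del: upt_Suc)
qed

lemma diagram_conjugate:
  assumes "is_partition lam" "is_partition mu"
  shows "(i, j) \<in> diagram (conjugate_skew (lam, mu)) \<longleftrightarrow> (j, i) \<in> diagram (lam, mu)"
proof -
  have "(i, j) \<in> young (conjugate ka) \<longleftrightarrow> (j, i) \<in> young ka" if ka: "is_partition ka" for ka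
  proof -
    have pos: "1 \<le> k" if "1 \<le> c" "c \<le> part p k" for p k c
      using that by (cases k) auto
    show ?thesis
      using part_conjugate_iff[OF ka] pos unfolding young_iff by metis
  qed
  then show ?thesis using assms by (simp add: diagram_def conjugate_skew_def)
qed

text \<open>The meaning of the arm bound: it is the smaller of two upper bounds for the number of
  columns met below the first row, namely the length of the second row of \<open>lam\<close> and the
  number of boxes there.\<close>

lemma card_columns_arm_bound:
  assumes lam: "is_partition lam"
  shows "finite {j. \<exists>i\<ge>2. (i, j) \<in> diagram (lam, mu)} \<and>
    card {j. \<exists>i\<ge>2. (i, j) \<in> diagram (lam, mu)} \<le> arm_bound (lam, mu)"
proof -
  let ?J = "{j. \<exists>i\<ge>2. (i, j) \<in> diagram (lam, mu)}"
  have J: "\<exists>k c. j = int c \<and> 2 \<le> k \<and> k \<le> length lam \<and> part mu k < c \<and> c \<le> part lam k" if "j \<in> ?J" for j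
  proof -
    obtain k c where kc: "2 \<le> k" "j = int c" "part mu k < c" "c \<le> part lam k"
      using \<open>j \<in> ?J\<close> by (auto simp: diagram_iff)
    then have "part lam k \<noteq> 0" by simp
    then show ?thesis using kc part_eq_0[of k lam] by (intro exI[of _ k] exI[of _ c]) auto
  qed
  have "?J \<subseteq> int ` {1..part lam 2}"
  proof
    fix j
    assume "j \<in> ?J"
    then obtain k c where "j = int c" "2 \<le> k" "part mu k < c" "c \<le> part lam k" using J by blast
    then show "j \<in> int ` {1..part lam 2}" using part_antimono[OF lam, of 2 k] by auto
  qed
  from card_mono[OF _ this] finite_subset[OF this]
  have 1: "finite ?J" "card ?J \<le> part lam 2" by (simp_all add: card_image)
  have "?J \<subseteq> (\<Union>k\<in>{2..length lam}. int ` {part mu k<..part lam k})"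
    using J by fastforce
  then have "card ?J \<le> card (\<Union>k\<in>{2..length lam}. int ` {part mu k<..part lam k})" by (rule card_mono[rotated]) auto
  also have "\<dots> \<le> (\<Sum>k\<in>{2..length lam}. card (int ` {part mu k<..part lam k}))" by (rule card_UN_le) simp
  also have "\<dots> = (\<Sum>k\<in>{2..length lam}. part lam k - part mu k)" by (simp add: card_image)
  finally show ?thesis using 1 by (simp add: arm_bound_def)
qed

lemma card_rows_arm_bound:
  assumes "is_partition lam" "is_partition mu"
  shows "finite {i. \<exists>j\<ge>2. (i, j) \<in> diagram (lam, mu)} \<and>
    card {i. \<exists>j\<ge>2. (i, j) \<in> diagram (lam, mu)} \<le> arm_bound (conjugate_skew (lam, mu))"
  using card_columns_arm_bound[OF is_partition_conjugate[OF assms(1)], of "conjugate mu"]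
    diagram_conjugate[OF assms]
  by (simp add: conjugate_skew_def)

lemma is_partition_Nil [simp]: "is_partition []"
  by (simp add: is_partition_def)

lemma diagram_row_1_iff: "(1, i) \<in> diagram (lam, mu) \<longleftrightarrow> int (part mu 1) < i \<and> i \<le> int (part lam 1)"
proof
  assume "(1, i) \<in> diagram (lam, mu)"
  then obtain k c where kc: "(1 :: int) = int k" "i = int c" "part mu k < c" "c \<le> part lam k"
    unfolding diagram_iff by (elim exE conjE)
  then have "k = 1" by simp
  then show "int (part mu 1) < i \<and> i \<le> int (part lam 1)" using kc by simp
next
  assume *: "int (part mu 1) < i \<and> i \<le> int (part lam 1)"
  then have "0 \<le> i" by linarith
  then obtain c where c: "i = int c" by (rule nonneg_int_cases)
  have "(int 1, int c) \<in> diagram (lam, mu)" unfolding diagram_int_iff using * c by simp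
  then show "(1, i) \<in> diagram (lam, mu)" using c by simp
qed

lemma diagram_column_1_iff:
  assumes lam: "is_partition lam" and mu: "is_partition mu"
  shows "(i, 1) \<in> diagram (lam, mu) \<longleftrightarrow> int (length mu) < i \<and> i \<le> int (length lam)"
proof
  assume "(i, 1) \<in> diagram (lam, mu)"
  then obtain k c where kc: "i = int k" "(1 :: int) = int c" "part mu k < c" "c \<le> part lam k"
    unfolding diagram_iff by (elim exE conjE)
  have "c = 1" using kc(2) by simp
  moreover have "1 \<le> k" using kc by (cases k) auto
  ultimately show "int (length mu) < i \<and> i \<le> int (length lam)"
    using kc part_pos[OF lam, of k] part_pos[OF mu, of k] by simp
next
  assume *: "int (length mu) < i \<and> i \<le> int (length lam)"
  then have "0 < i" by linarith
  then obtain k where "i = int k" "0 < k" by (rule pos_int_cases)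
  with * have k: "i = int k" "1 \<le> k" "length mu < k" "k \<le> length lam" by auto
  then have "(int k, int 1) \<in> diagram (lam, mu)"
    unfolding diagram_int_iff using part_pos[OF lam k(2)] part_pos[OF mu k(2)] by auto
  then show "(i, 1) \<in> diagram (lam, mu)" using k(1) by simp
qed

lemma diagram_fst_pos: "x \<in> diagram d \<Longrightarrow> 1 \<le> fst x"
  and diagram_snd_pos: "x \<in> diagram d \<Longrightarrow> 1 \<le> snd x"
proof -
  assume "x \<in> diagram d"
  then have "(fst x, snd x) \<in> diagram (fst d, snd d)" by simp
  then obtain k c where kc: "fst x = int k" "snd x = int c" "part (snd d) k < c" "c \<le> part (fst d) k"
    unfolding diagram_iff by (elim exE conjE)
  then show "1 \<le> fst x" "1 \<le> snd x" by (cases k; simp)+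
qed

lemma right_arm_iff:
  "(i, j) \<in> right_arm (lam, mu) \<longleftrightarrow> (i, j) \<in> diagram (lam, mu) \<and> i = 1 \<and>
     int (arm_bound (lam, mu) + part mu 1) \<le> j \<and> j \<le> int (part lam 1)"
  by (simp add: right_arm_def)

lemma left_arm_iff:
  assumes "is_partition mu" "is_partition lam"
  shows "(i, j) \<in> left_arm (lam, mu) \<longleftrightarrow> (i, j) \<in> diagram (lam, mu) \<and> j = 1 \<and>
     int (arm_bound (conjugate_skew (lam, mu)) + length mu) \<le> i \<and> i \<le> int (length lam)"
  unfolding left_arm_def fst_conv snd_conv part_conjugate_1[OF assms(1)] part_conjugate_1[OF assms(2)]
  by simp

text \<open>All entries of the first row of the diagram stay in the first row of \<open>R\<close>,
  and from the arm entry \<open>T (1, j)\<close> on no larger entry from a lower row joins them. So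
  the entries to the right of it are the same in both rows, and counting from the right end locates
  it.\<close>

theorem right_arm_rectified:
  assumes skew: "is_skew (lam, mu)" and T: "T \<in> SSYT (diagram (lam, mu)) UNIV" "inj_on T (diagram (lam, mu))"
    and nu: "is_partition nu" and R: "R \<in> SSYT (young nu) UNIV"
    and equiv: "knuth_equiv (row_word (young nu) R) (row_word (diagram (lam, mu)) T)"
    and j: "(1, j) \<in> right_arm (lam, mu)"
  shows "(1, j + int (part nu 1) - int (part lam 1)) \<in> young nu \<and>
    R (1, j + int (part nu 1) - int (part lam 1)) = T (1, j)"
proof -
  let ?D = "diagram (lam, mu)" and ?m = "arm_bound (lam, mu)" and ?E = "{e \<in> young nu. fst e = 1}"
  note edge = first_row_edge[OF nu R]
  have lam: "is_partition lam" using skew by (simp add: is_skew_def)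
  have injR: "inj_on R (young nu)" and im: "R ` young nu = T ` ?D"
    using inj_on_Rect[OF finite_diagram T(2) equiv] by simp_all
  have jD: "(1, j) \<in> ?D" and jm: "int (?m + part mu 1) \<le> j" using right_arm_iff[THEN iffD1, OF j] by simp_all
  note row1 = diagram_row_1_iff[of _ lam mu] and fst_pos = diagram_fst_pos[of _ "(lam, mu)"]
  have inE': "\<exists>e\<in>?E. R e = T (1, i)" if i: "(1, i) \<in> ?D" for i
  proof (rule box_chain_edge[OF finite_diagram equiv disjI1[OF refl] edge i])
    fix C
    assume C: "box_chain (\<le>) ?D T C" "T ` C \<subseteq> {..<T (1, i)}"
    show "box_chain (\<le>) ?D T (insert (1, i) C)"
    proof (rule box_chain_insert_last[OF C(1) i])
      fix c
      assume c: "c \<in> C"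
      have cD: "c \<in> ?D" by (rule box_chain_subset[OF C(1) c])
      have lt: "T c < T (1, i)" using subsetD[OF C(2) imageI[OF c]] by simp
      have "\<not> reads_before (1, i) c"
      proof
        assume "reads_before (1, i) c"
        \<comment> \<open>What is read after a box of the first row lies to its right in the same
          row and is at least as large, so the box can be appended to any chain of smaller
          letters.\<close>
        then have "fst c = 1 \<and> i < snd c" using fst_pos[OF cD] unfolding reads_before_def fst_conv snd_conv by linarith
        then obtain b where b: "c = (1, b)" "i < b" by (cases c) simp
        then have "T (1, i) \<le> T (1, b)" using SSYT_row[OF T(1) i, of b] cD by simp
        then show False using lt b(1) by simp
      qed
      then show "\<not> reads_before (1, i) c \<and> T c \<le> T (1, i)" using lt by simp
    qed
  qed auto
  have inE: "\<exists>q. (1, q) \<in> young nu \<and> R (1, q) = T (1, i)" if i: "(1, i) \<in> ?D" for i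
    using inE'[OF i] unfolding Bex_def mem_Collect_eq split_paired_Ex fst_conv by blast
  have notE: "T y \<notin> R ` ?E" if y: "y \<in> ?D" "2 \<le> fst y" "T (1, j) < T y" for y
  proof -
    \<comment> \<open>The first \<open>?m\<close> boxes of the first row. An arm box has at least
      that many boxes up to and including itself, so none of them lies to the right of
      \<open>j\<close>.\<close>
    define M where "M = (\<lambda>c. (1 :: int, int c)) ` {part mu 1<..part mu 1 + ?m}"
    have M: "M \<subseteq> ?D" "\<And>c. c \<in> M \<Longrightarrow> fst c = 1 \<and> snd c \<le> j"
      using jm jD row1[of j] by (auto simp: M_def row1)
    have chain: "box_chain (\<le>) ?D T M"
      unfolding box_chain_def
    proof (intro conjI ballI impI M(1))
      fix c d
      assume cd: "c \<in> M" "d \<in> M" "reads_before c d"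
      then obtain b b' where "c = (1, b)" "d = (1, b')" "b < b'"
        using M(2)[OF cd(1)] M(2)[OF cd(2)] by (cases c; cases d) (auto simp: reads_before_def)
      then show "T c \<le> T d"
        using SSYT_row[OF T(1), of 1 b b'] subsetD[OF M(1) cd(1)] subsetD[OF M(1) cd(2)] by simp
    qed
    have below: "T ` M \<subseteq> {..<T y}"
    proof (rule image_subsetI)
      fix c
      assume c: "c \<in> M"
      obtain b where c1: "c = (1, b)" using M(2)[OF c] by (cases c) auto
      have "T (1, b) \<le> T (1, j)"
        using SSYT_row[OF T(1), of 1 b j] M(2)[OF c] subsetD[OF M(1) c] c1 jD by simp
      then show "T c \<in> {..<T y}" using y(3) c1 by simp
    qed
    have Cbound: "card C \<le> card M" if C: "box_chain (\<le>) ?D T C" "y \<in> C" "T ` C \<subseteq> {..T y}" for C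
    proof -
    have sub: "C \<subseteq> ?D" using C(1) by (simp add: box_chain_def)
    \<comment> \<open>As \<open>T y\<close> is the largest letter of the chain, \<open>y\<close> is
      read last; the other boxes are read earlier and lie in the row of \<open>y\<close> or below
      it.\<close>
    have "fst c \<ge> 2" if "c \<in> C" for c
    proof (cases "reads_before y c")
      case True
      then have "T y \<le> T c" using C(1,2) that by (auto simp: box_chain_def)
      then have "T c = T y" using C(3) that by force
      then have "c = y" using inj_onD[OF T(2)] sub that y(1) by blast
      then show ?thesis using y(2) by simp
    next
      case False
      then show ?thesis using y(2) by (auto simp: reads_before_def)
    qed
    then have "snd ` C \<subseteq> {j. \<exists>i\<ge>2. (i, j) \<in> ?D}" using sub by force
    then have "card (snd ` C) \<le> ?m"
      using card_columns_arm_bound[OF lam, of mu] card_mono[of "{j. \<exists>i\<ge>2. (i, j) \<in> ?D}" "snd ` C"] by linarith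
    moreover have "card (snd ` C) = card C" by (rule card_image[OF increasing_chain_columns[OF T(1) C(1)]])
    moreover have "card M = ?m" unfolding M_def by (subst card_image) (auto simp: inj_on_def)
    ultimately show "card C \<le> card M" by simp
    qed
    show ?thesis
      by (rule box_chain_not_edge[OF finite_diagram equiv disjI1[OF refl] edge T(2) y(1) chain below Cbound]) assumption+
  qed
  obtain q where q: "(1, q) \<in> young nu" "R (1, q) = T (1, j)"
    using inE[OF jD] by (elim exE conjE)
  note rowE = diagram_row_1_iff[of _ nu "[]", unfolded diagram_normal]
  have "R ` ((\<lambda>i. (1, i)) ` {q<..int (part nu 1)}) = T ` ((\<lambda>i. (1, i)) ` {j<..int (part lam 1)})" (is "?A = ?B")
  proof
    show "?A \<subseteq> ?B"
    proof clarify
      fix i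
      assume i: "i \<in> {q<..int (part nu 1)}"
      then have iY: "(1, i) \<in> young nu" using q(1) rowE[of q] rowE[of i] by simp
      have "R (1, q) \<le> R (1, i)" using SSYT_row[OF R q(1) iY] i by simp
      moreover have "R (1, q) \<noteq> R (1, i)" using inj_onD[OF injR _ q(1) iY] i by auto
      ultimately have lt: "T (1, j) < R (1, i)" using q(2) by simp
      have "R (1, i) \<in> T ` ?D" using imageI[OF iY, of R] im by simp
      then obtain y where y: "R (1, i) = T y" "y \<in> ?D" by (rule imageE)
      have "R (1, i) \<in> R ` ?E" using iY by (intro imageI) simp
      then have "\<not> 2 \<le> fst y" using notE[OF y(2)] lt y(1) by auto
      then have "fst y = 1" using fst_pos[OF y(2)] by simp
      then obtain c where y1: "y = (1, c)" by (cases y) auto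
      have "j < c"
      proof (rule ccontr)
        assume "\<not> j < c"
        then have "T y \<le> T (1, j)" using SSYT_row[OF T(1), of 1 c j] y(2) y1 jD by simp
        then show False using lt y(1) by simp
      qed
      moreover have "c \<le> int (part lam 1)" using y(2) y1 row1[of c] by simp
      ultimately have "T (1, c) \<in> ?B" by (intro imageI) simp
      then show "R (1, i) \<in> ?B" using y(1) y1 by simp
    qed
    show "?B \<subseteq> ?A"
    proof clarify
      fix i
      assume i: "i \<in> {j<..int (part lam 1)}"
      then have iD: "(1, i) \<in> ?D" using jD by (simp add: row1)
      have "T (1, j) \<le> T (1, i)" using SSYT_row[OF T(1) jD iD] i by simp
      moreover have "T (1, j) \<noteq> T (1, i)" using inj_onD[OF T(2), of "(1, j)" "(1, i)"] jD iD i by auto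
      ultimately have lt: "R (1, q) < T (1, i)" using q(2) by simp
      obtain c where c: "(1, c) \<in> young nu" "R (1, c) = T (1, i)"
        using inE[OF iD] by (elim exE conjE)
      have "q < c"
      proof (rule ccontr)
        assume "\<not> q < c"
        then have "R (1, c) \<le> R (1, q)" using SSYT_row[OF R c(1) q(1)] by simp
        then show False using lt c(2) by simp
      qed
      moreover have "c \<le> int (part nu 1)" using c(1) rowE[of c] by simp
      ultimately have "R (1, c) \<in> ?A" by (intro imageI) simp
      then show "T (1, i) \<in> ?A" using c(2) by simp
    qed
  qed
  then have "card ?A = card ?B" by (rule arg_cong)
  moreover have "card ?A = nat (int (part nu 1) - q)"
  proof -
    have "(\<lambda>i. (1, i)) ` {q<..int (part nu 1)} \<subseteq> young nu"
    proof (rule image_subsetI)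
      fix i
      assume "i \<in> {q<..int (part nu 1)}"
      then show "(1, i) \<in> young nu" using q(1) rowE[of q] rowE[of i] by simp
    qed
    then have "card ?A = card ((\<lambda>i. (1, i) :: box) ` {q<..int (part nu 1)})"
      using card_image[OF inj_on_subset[OF injR]] by blast
    also have "\<dots> = card {q<..int (part nu 1)}" by (rule card_image) (simp add: inj_on_def)
    finally show ?thesis unfolding card_greaterThanAtMost_int .
  qed
  moreover have "card ?B = nat (int (part lam 1) - j)"
  proof -
    have "(\<lambda>i. (1, i)) ` {j<..int (part lam 1)} \<subseteq> ?D"
    proof (rule image_subsetI)
      fix i
      assume "i \<in> {j<..int (part lam 1)}"
      then show "(1, i) \<in> ?D" using jD row1[of j] row1[of i] by simp
    qed
    then have "card ?B = card ((\<lambda>i. (1, i) :: box) ` {j<..int (part lam 1)})"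
      using card_image[OF inj_on_subset[OF T(2)]] by blast
    also have "\<dots> = card {j<..int (part lam 1)}" by (rule card_image) (simp add: inj_on_def)
    finally show ?thesis unfolding card_greaterThanAtMost_int .
  qed
  ultimately have "nat (int (part nu 1) - q) = nat (int (part lam 1) - j)" by (simp only:)
  moreover have "q \<le> int (part nu 1)" "j \<le> int (part lam 1)"
    using jD row1[of j] q(1) rowE[of q] by simp_all
  ultimately have "j + int (part nu 1) - int (part lam 1) = q" by linarith
  then show ?thesis using q by (simp only:)
qed

text \<open>Decreasing chains now run upwards, so a box of the first column is put at the front of a
  chain and \<open>y\<close> is the first box of a chain in which it is the largest.\<close>

theorem left_arm_rectified:
  assumes skew: "is_skew (lam, mu)" and T: "T \<in> SSYT (diagram (lam, mu)) UNIV" "inj_on T (diagram (lam, mu))"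
    and nu: "is_partition nu" and R: "R \<in> SSYT (young nu) UNIV"
    and equiv: "knuth_equiv (row_word (young nu) R) (row_word (diagram (lam, mu)) T)"
    and i: "(i, 1) \<in> left_arm (lam, mu)"
  shows "(i + int (length nu) - int (length lam), 1) \<in> young nu \<and>
    R (i + int (length nu) - int (length lam), 1) = T (i, 1)"
proof -
  let ?D = "diagram (lam, mu)" and ?n = "arm_bound (conjugate_skew (lam, mu))" and ?E = "{e \<in> young nu. snd e = 1}"
  note edge = first_column_edge[OF R]
  have lam: "is_partition lam" and mu: "is_partition mu" using skew by (simp_all add: is_skew_def)
  have injR: "inj_on R (young nu)" and im: "R ` young nu = T ` ?D"
    using inj_on_Rect[OF finite_diagram T(2) equiv] by simp_all
  have iD: "(i, 1) \<in> ?D" and im': "int (?n + length mu) \<le> i"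
    using left_arm_iff[OF mu lam, THEN iffD1, OF i] by simp_all
  note col1 = diagram_column_1_iff[OF lam mu] and snd_pos = diagram_snd_pos[of _ "(lam, mu)"]
  \<comment> \<open>Column 1 of the diagram begins below \<open>mu\<close> and ends with the last
    row of \<open>lam\<close>; once it is met, every nonempty row further down meets it.\<close>
  have first: "(r', 1) \<in> ?D" if r: "(r, 1) \<in> ?D" "r \<le> r'" "(r', c) \<in> ?D" for r r' c
  proof -
    obtain k d where k: "r' = int k" "part mu k < d" "d \<le> part lam k"
      using r(3) unfolding diagram_iff by (elim exE conjE)
    then have "1 \<le> k" "1 \<le> part lam k" by (cases k; simp)+
    then show ?thesis using part_pos[OF lam, of k] r(1,2) col1 k(1) by auto
  qed
  have inE': "\<exists>e\<in>?E. R e = T (r, 1)" if r: "(r, 1) \<in> ?D" for r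
  proof (rule box_chain_edge[OF finite_diagram equiv disjI2[OF refl] edge r])
    fix C
    assume C: "box_chain (>) ?D T C" "T ` C \<subseteq> {..<T (r, 1)}"
    show "box_chain (>) ?D T (insert (r, 1) C)"
    proof (rule box_chain_insert_first[OF C(1) r])
      fix c
      assume c: "c \<in> C"
      have cD: "c \<in> ?D" by (rule box_chain_subset[OF C(1) c])
      have lt: "T c < T (r, 1)" using subsetD[OF C(2) imageI[OF c]] by simp
      obtain i' j' where ij: "c = (i', j')" by fastforce
      have "\<not> reads_before c (r, 1)"
      proof
        assume "reads_before c (r, 1)"
        then have le: "r \<le> i'" unfolding reads_before_def fst_conv snd_conv ij by linarith
        have f: "(i', 1) \<in> ?D" using first[OF r le, of j'] cD ij by simp
        have "T (r, 1) \<le> T (i', 1)"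
        proof (cases "i' = r")
          case False
          then show ?thesis using SSYT_col[OF T(1) r f] le by simp
        qed simp
        also have "\<dots> \<le> T (i', j')" using SSYT_row[OF T(1) f, of j'] cD snd_pos[OF cD] ij by simp
        finally show False using lt ij by simp
      qed
      then show "\<not> reads_before c (r, 1) \<and> T c < T (r, 1)" using lt by simp
    qed
  qed auto
  have inE: "\<exists>q. (q, 1) \<in> young nu \<and> R (q, 1) = T (r, 1)" if r: "(r, 1) \<in> ?D" for r
    using inE'[OF r] unfolding Bex_def mem_Collect_eq split_paired_Ex snd_conv by blast
  have notE: "T y \<notin> R ` ?E" if y: "y \<in> ?D" "2 \<le> snd y" "T (i, 1) < T y" for y
  proof -
    define M where "M = (\<lambda>c. (int c, 1 :: int)) ` {length mu<..length mu + ?n}"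
    have M: "M \<subseteq> ?D" "\<And>c. c \<in> M \<Longrightarrow> snd c = 1 \<and> fst c \<le> i"
      using im' iD col1[of i] by (auto simp: M_def col1)
    have chain: "box_chain (>) ?D T M"
      unfolding box_chain_def
    proof (intro conjI ballI impI M(1))
      fix c d
      assume cd: "c \<in> M" "d \<in> M" "reads_before c d"
      then obtain b b' where "c = (b, 1)" "d = (b', 1)" "b' < b"
        using M(2)[OF cd(1)] M(2)[OF cd(2)] by (cases c; cases d) (auto simp: reads_before_def)
      then show "T c > T d"
        using SSYT_col[OF T(1), of b' 1 b] subsetD[OF M(1) cd(1)] subsetD[OF M(1) cd(2)] by simp
    qed
    have below: "T ` M \<subseteq> {..<T y}"
    proof (rule image_subsetI)
      fix c
      assume c: "c \<in> M"
      obtain b where c1: "c = (b, 1)" using M(2)[OF c] by (cases c) auto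
      have cD: "(b, 1) \<in> ?D" using subsetD[OF M(1) c] c1 by simp
      have "T (b, 1) \<le> T (i, 1)"
        using SSYT_col[OF T(1) cD iD] M(2)[OF c] c1 by (cases "b = i") auto
      then show "T c \<in> {..<T y}" using y(3) c1 by simp
    qed
    have Cbound: "card C \<le> card M" if C: "box_chain (>) ?D T C" "y \<in> C" "T ` C \<subseteq> {..T y}" for C
    proof -
      have sub: "C \<subseteq> ?D" using C(1) by (simp add: box_chain_def)
      \<comment> \<open>A chain box in column 1 lies weakly above \<open>y\<close>, whose row
        reaches column 2. Then its own row of \<open>lam\<close> reaches column 2 as well, and
        \<open>mu\<close> has no box in this row, so the box in column 2 belongs to the
        diagram.\<close>
      have "\<exists>j\<ge>2. (fst c, j) \<in> ?D" if "c \<in> C" for c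
      proof -
        have "\<not> reads_before c y"
        proof
          assume "reads_before c y"
          then have "T y < T c" using C(1,2) that by (auto simp: box_chain_def)
          then show False using C(3) that by force
        qed
        then have le: "fst c \<le> fst y" by (auto simp: reads_before_def)
        have cD: "c \<in> ?D" using sub that by blast
        show ?thesis
        proof (cases "2 \<le> snd c")
          case True
          then show ?thesis using cD by (intro exI[of _ "snd c"]) simp
        next
          case False
          then have "snd c = 1" using snd_pos[OF cD] by simp
          then have "(fst c, 1) \<in> ?D" using cD by (metis prod.collapse)
          then obtain k where k: "fst c = int k" "part mu k < 1" "1 \<le> part lam k"
            unfolding diagram_iff by (elim exE conjE) simp
          have "(fst y, snd y) \<in> ?D" using y(1) by simp
          then obtain k' c' where k': "fst y = int k'" "snd y = int c'" "c' \<le> part lam k'"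
            unfolding diagram_iff by (elim exE conjE)
          have "1 \<le> k" using k(3) by (cases k) auto
          then have "2 \<le> part lam k" using part_antimono[OF lam, of k k'] k' le k(1) y(2) by simp
          then have "(int k, int 2) \<in> ?D" using k(2) unfolding diagram_int_iff by simp
          then show ?thesis using k(1) by (intro exI[of _ 2]) simp
        qed
      qed
      then have "fst ` C \<subseteq> {i. \<exists>j\<ge>2. (i, j) \<in> ?D}" by auto
      then have "card (fst ` C) \<le> ?n"
        using card_rows_arm_bound[OF lam mu] card_mono[of "{i. \<exists>j\<ge>2. (i, j) \<in> ?D}" "fst ` C"] by linarith
      moreover have "card (fst ` C) = card C" by (rule card_image[OF decreasing_chain_rows[OF T(1) C(1)]])
      moreover have "card M = ?n" unfolding M_def by (subst card_image) (auto simp: inj_on_def)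
      ultimately show "card C \<le> card M" by simp
    qed
    show ?thesis
      by (rule box_chain_not_edge[OF finite_diagram equiv disjI2[OF refl] edge T(2) y(1) chain below Cbound]) assumption+
  qed
  obtain q where q: "(q, 1) \<in> young nu" "R (q, 1) = T (i, 1)"
    using inE[OF iD] by (elim exE conjE)
  note colE = diagram_column_1_iff[OF nu is_partition_Nil, unfolded diagram_normal]
  have "R ` ((\<lambda>r. (r, 1)) ` {q<..int (length nu)}) = T ` ((\<lambda>r. (r, 1)) ` {i<..int (length lam)})" (is "?A = ?B")
  proof
    show "?A \<subseteq> ?B"
    proof clarify
      fix r
      assume r: "r \<in> {q<..int (length nu)}"
      then have rY: "(r, 1) \<in> young nu" using q(1) colE[of q] colE[of r] by simp
      have lt: "T (i, 1) < R (r, 1)" using SSYT_col[OF R q(1) rY] q(2) r by simp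
      have "R (r, 1) \<in> T ` ?D" using imageI[OF rY, of R] im by simp
      then obtain y where y: "R (r, 1) = T y" "y \<in> ?D" by (rule imageE)
      have "R (r, 1) \<in> R ` ?E" using rY by (intro imageI) simp
      then have "\<not> 2 \<le> snd y" using notE[OF y(2)] lt y(1) by auto
      then have "snd y = 1" using snd_pos[OF y(2)] by simp
      then obtain c where y1: "y = (c, 1)" by (cases y) auto
      have "i < c"
      proof (rule ccontr)
        assume "\<not> i < c"
        then have "T y \<le> T (i, 1)"
          using SSYT_col[OF T(1), of c 1 i] y(2) y1 iD by (cases "c = i") auto
        then show False using lt y(1) by simp
      qed
      moreover have "c \<le> int (length lam)" using y(2) y1 col1[of c] by simp
      ultimately have "T (c, 1) \<in> ?B" by (intro imageI) simp
      then show "R (r, 1) \<in> ?B" using y(1) y1 by simp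
    qed
    show "?B \<subseteq> ?A"
    proof clarify
      fix r
      assume r: "r \<in> {i<..int (length lam)}"
      then have rD: "(r, 1) \<in> ?D" using iD by (simp add: col1)
      have lt: "R (q, 1) < T (r, 1)" using SSYT_col[OF T(1) iD rD] r q(2) by simp
      obtain c where c: "(c, 1) \<in> young nu" "R (c, 1) = T (r, 1)"
        using inE[OF rD] by (elim exE conjE)
      have "q < c"
      proof (rule ccontr)
        assume "\<not> q < c"
        then have "R (c, 1) \<le> R (q, 1)"
          using SSYT_col[OF R c(1) q(1)] by (cases "c = q") auto
        then show False using lt c(2) by simp
      qed
      moreover have "c \<le> int (length nu)" using c(1) colE[of c] by simp
      ultimately have "R (c, 1) \<in> ?A" by (intro imageI) simp
      then show "T (r, 1) \<in> ?A" using c(2) by simp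
    qed
  qed
  then have "card ?A = card ?B" by (rule arg_cong)
  moreover have "card ?A = nat (int (length nu) - q)"
  proof -
    have "(\<lambda>r. (r, 1)) ` {q<..int (length nu)} \<subseteq> young nu"
    proof (rule image_subsetI)
      fix r
      assume "r \<in> {q<..int (length nu)}"
      then show "(r, 1) \<in> young nu" using q(1) colE[of q] colE[of r] by simp
    qed
    then have "card ?A = card ((\<lambda>r. (r, 1) :: box) ` {q<..int (length nu)})"
      using card_image[OF inj_on_subset[OF injR]] by blast
    also have "\<dots> = card {q<..int (length nu)}" by (rule card_image) (simp add: inj_on_def)
    finally show ?thesis unfolding card_greaterThanAtMost_int .
  qed
  moreover have "card ?B = nat (int (length lam) - i)"
  proof -
    have "(\<lambda>r. (r, 1)) ` {i<..int (length lam)} \<subseteq> ?D"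
    proof (rule image_subsetI)
      fix r
      assume "r \<in> {i<..int (length lam)}"
      then show "(r, 1) \<in> ?D" using iD col1[of i] col1[of r] by simp
    qed
    then have "card ?B = card ((\<lambda>r. (r, 1) :: box) ` {i<..int (length lam)})"
      using card_image[OF inj_on_subset[OF T(2)]] by blast
    also have "\<dots> = card {i<..int (length lam)}" by (rule card_image) (simp add: inj_on_def)
    finally show ?thesis unfolding card_greaterThanAtMost_int .
  qed
  ultimately have "nat (int (length nu) - q) = nat (int (length lam) - i)" by (simp only:)
  moreover have "q \<le> int (length nu)" "i \<le> int (length lam)"
    using iD col1[of i] q(1) colE[of q] by simp_all
  ultimately have "i + int (length nu) - int (length lam) = q" by linarith
  then show ?thesis using q by (simp only:)
qed

section \<open>The arms under rectification\<close>

lemma rho_cases: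
  fixes L :: "box \<Rightarrow> nat"
  assumes skew: "is_skew (lam, mu)" and L: "L \<in> SSYT (diagram (lam, mu)) {1..}"
    and Rect: "Rect (diagram (lam, mu)) L = (nu, S)"
  obtains R where "is_partition nu" "R \<in> SSYT (young nu) UNIV"
    "knuth_equiv (row_word (young nu) R) (row_word (diagram (lam, mu)) (phi_T (diagram (lam, mu)) L))"
    "inj_on R (young nu)" "Rect (diagram (lam, mu)) (phi_T (diagram (lam, mu)) L) = (nu, R)"
    "S = (\<lambda>y\<in>young nu. label_val (R y))"
proof -
  let ?D = "diagram (lam, mu)"
  obtain nu' R where R: "Rect ?D (phi_T ?D L) = (nu', R)" "is_partition nu'" "R \<in> SSYT (young nu') UNIV"
    "knuth_equiv (row_word (young nu') R) (row_word ?D (phi_T ?D L))" by (rule Rect_cases)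
  have "Rect ?D L = (nu', \<lambda>y\<in>young nu'. label_val (R y))" by (rule Rect_phi_T[OF finite_diagram R(1)])
  then have eq: "nu' = nu" "S = (\<lambda>y\<in>young nu. label_val (R y))" using Rect by simp_all
  have "inj_on R (young nu')"
    using inj_on_Rect[OF finite_diagram inj_on_phi_T[OF finite_diagram] R(4)] by simp
  then show thesis using that[of R] R eq by simp
qed

lemma rho_bij:
  fixes L :: "box \<Rightarrow> nat"
  assumes "is_skew (lam, mu)" "L \<in> SSYT (diagram (lam, mu)) {1..}" "Rect (diagram (lam, mu)) L = (nu, S)"
  shows "bij_betw (rho (diagram (lam, mu)) L) (diagram (lam, mu)) (young nu)"
  using rho_cases[OF assms] rho_properties(1)[OF finite_diagram] by metis

lemma Rect_rho:
  fixes L :: "box \<Rightarrow> nat"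
  assumes "is_skew (lam, mu)" "L \<in> SSYT (diagram (lam, mu)) {1..}" "Rect (diagram (lam, mu)) L = (nu, S)"
    and x: "x \<in> diagram (lam, mu)"
  shows "S (rho (diagram (lam, mu)) L x) = L x"
proof -
  let ?D = "diagram (lam, mu)"
  obtain R where R: "Rect ?D (phi_T ?D L) = (nu, R)" "S = (\<lambda>y\<in>young nu. label_val (R y))"
    using rho_cases[OF assms(1-3)] by metis
  have "rho ?D L x \<in> young nu"
    using bij_betwE[OF rho_properties(1)[OF finite_diagram R(1)]] x by blast
  then have "S (rho ?D L x) = label_val (R (rho ?D L x))" by (simp add: R(2))
  also have "\<dots> = label_val (phi_T ?D L x)" by (simp add: rho_properties(2)[OF finite_diagram R(1) x])
  also have "\<dots> = L x" by (rule label_val_phi_T[OF x])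
  finally show ?thesis .
qed

lemma rho_eqI:
  fixes L :: "box \<Rightarrow> nat"
  assumes "Rect D (phi_T D L) = (nu, R)" "finite D" "inj_on R (young nu)" "x \<in> D"
    and "y \<in> young nu" "R y = phi_T D L x"
  shows "rho D L x = y"
proof (rule inj_onD[OF assms(3)])
  show "R (rho D L x) = R y" using rho_properties(2)[OF assms(2,1,4)] assms(6) by simp
  show "rho D L x \<in> young nu" using bij_betwE[OF rho_properties(1)[OF assms(2,1)]] assms(4) by blast
qed fact

text \<open>The target involves the shape \<open>nu\<close> but not \<open>L\<close>, so all
  tableaux with the same rectified shape agree on the arm.\<close>

lemma rho_right_arm:
  fixes L :: "box \<Rightarrow> nat"
  assumes skew: "is_skew (lam, mu)" and L: "L \<in> SSYT (diagram (lam, mu)) {1..}"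
    and Rect: "Rect (diagram (lam, mu)) L = (nu, S)" and j: "(1, j) \<in> right_arm (lam, mu)"
  shows "rho (diagram (lam, mu)) L (1, j) = (1, j + int (part nu 1) - int (part lam 1))"
proof -
  let ?D = "diagram (lam, mu)"
  obtain R where R: "is_partition nu" "R \<in> SSYT (young nu) UNIV"
    "knuth_equiv (row_word (young nu) R) (row_word ?D (phi_T ?D L))"
    "inj_on R (young nu)" "Rect ?D (phi_T ?D L) = (nu, R)"
    by (rule rho_cases[OF skew L Rect])
  have "(1, j) \<in> ?D" using right_arm_iff[THEN iffD1, OF j] by simp
  with right_arm_rectified[OF skew phi_T_SSYT[OF finite_diagram L] inj_on_phi_T[OF finite_diagram] R(1-3) j]
  show ?thesis by (intro rho_eqI[OF R(5) finite_diagram R(4)]) simp_all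
qed

lemma rho_left_arm:
  fixes L :: "box \<Rightarrow> nat"
  assumes skew: "is_skew (lam, mu)" and L: "L \<in> SSYT (diagram (lam, mu)) {1..}"
    and Rect: "Rect (diagram (lam, mu)) L = (nu, S)" and i: "(i, 1) \<in> left_arm (lam, mu)"
  shows "rho (diagram (lam, mu)) L (i, 1) = (i + int (length nu) - int (length lam), 1)"
proof -
  let ?D = "diagram (lam, mu)"
  obtain R where R: "is_partition nu" "R \<in> SSYT (young nu) UNIV"
    "knuth_equiv (row_word (young nu) R) (row_word ?D (phi_T ?D L))"
    "inj_on R (young nu)" "Rect ?D (phi_T ?D L) = (nu, R)"
    by (rule rho_cases[OF skew L Rect])
  have "is_partition lam" "is_partition mu" using skew by (simp_all add: is_skew_def)
  then have "(i, 1) \<in> ?D" using left_arm_iff[THEN iffD1, OF _ _ i] by simp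
  with left_arm_rectified[OF skew phi_T_SSYT[OF finite_diagram L] inj_on_phi_T[OF finite_diagram] R(1-3) i]
  show ?thesis by (intro rho_eqI[OF R(5) finite_diagram R(4)]) simp_all
qed

section \<open>Fibres of rectification\<close>

lemma Rect_positive:
  assumes "is_skew (lam, mu)" "L \<in> SSYT (diagram (lam, mu)) {1..}" "Rect (diagram (lam, mu)) L = (nu, S)"
  shows "is_partition nu" "S \<in> SSYT (young nu) {1::nat..}"
    "knuth_equiv (row_word (young nu) S) (row_word (diagram (lam, mu)) L)"
proof -
  let ?D = "diagram (lam, mu)"
  obtain nu' S' where S': "Rect ?D L = (nu', S')" "is_partition nu'" "S' \<in> SSYT (young nu') UNIV"
    "knuth_equiv (row_word (young nu') S') (row_word ?D L)" by (rule Rect_cases)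
  then have eq: "nu' = nu" "S' = S" using assms(3) by simp_all
  show "is_partition nu" "knuth_equiv (row_word (young nu) S) (row_word ?D L)" using S' eq by simp_all
  have "set (row_word (young nu) S) = set (row_word ?D L)"
    using knuth_equiv_mset[OF S'(4)] eq mset_eq_setD by blast
  then have "S ` young nu = L ` ?D" by simp
  moreover have "L ` ?D \<subseteq> {1..}" using assms(2) unfolding SSYT_def by (auto simp: PiE_def Pi_def)
  ultimately show "S \<in> SSYT (young nu) {1..}" using SSYT_subset[of S "young nu" UNIV] S'(3) eq by simp
qed

lemma lr_coeff_nonneg_card:
  assumes "is_skew (lam, mu)" "is_partition nu"
  shows "lr_coeff mu nu lam = int (card (lr_tableaux (length lam) (part mu) (\<lambda>k. part lam k - part mu k) nu))"
  using lr_coeff_eq_card[of mu nu lam] assms by (simp add: is_skew_def)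

text \<open>The cardinality is the same for every \<open>S\<close> of shape \<open>nu\<close>, which
  lets the coefficient come out of the sum over rectified tableaux.\<close>

lemma card_Rect_fiber:
  assumes skew: "is_skew (lam, mu)" and nu: "is_partition nu" and S: "S \<in> SSYT (young nu) {1::nat..}"
  defines "F \<equiv> {L \<in> SSYT (diagram (lam, mu)) {1..}. Rect (diagram (lam, mu)) L = (nu, S)}"
  shows "finite F" "card F = nat (lr_coeff mu nu lam)"
proof -
  let ?D = "diagram (lam, mu)" and ?g = "diagram_rows (nu, []) S"
  define G where "G = {f \<in> skew_tableaux (lam, mu). knuth_equiv (rword (length lam) f) (rword (length nu) ?g)}"
  have g: "?g \<in> normal_tableaux nu" using bij_betwE[OF SSYT_normal_bij[OF nu]] S by blast
  have wS: "row_word (young nu) S = rword (length nu) ?g" using row_word_diagram[of nu "[]" S] by simp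
  have S': "S \<in> SSYT (young nu) UNIV" using S by (rule SSYT_subset) simp
  have iff: "Rect ?D L = (nu, S) \<longleftrightarrow> knuth_equiv (rword (length lam) (diagram_rows (lam, mu) L)) (rword (length nu) ?g)"
    if L: "L \<in> SSYT ?D {1..}" for L :: "box \<Rightarrow> nat"
  proof
    assume "Rect ?D L = (nu, S)"
    then show "knuth_equiv (rword (length lam) (diagram_rows (lam, mu) L)) (rword (length nu) ?g)"
      using Rect_positive(3)[OF skew L] knuth_equiv_sym by (simp add: wS row_word_diagram)
  next
    assume "knuth_equiv (rword (length lam) (diagram_rows (lam, mu) L)) (rword (length nu) ?g)"
    then show "Rect ?D L = (nu, S)"
      by (intro Rect_eqI[OF nu S']) (simp add: wS row_word_diagram knuth_equiv_sym)
  qed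
  have bij: "bij_betw (diagram_rows (lam, mu)) F G"
  proof (rule bij_betw_subset[OF bij_betw_diagram_rows[OF skew]])
    show "F \<subseteq> SSYT ?D {1..}" by (auto simp: F_def)
    have im: "diagram_rows (lam, mu) ` SSYT ?D {1..} = skew_tableaux (lam, mu)"
      using bij_betw_diagram_rows[OF skew] by (simp add: bij_betw_def)
    show "diagram_rows (lam, mu) ` F = G"
    proof
      show "diagram_rows (lam, mu) ` F \<subseteq> G" using iff im by (auto simp: F_def G_def)
      show "G \<subseteq> diagram_rows (lam, mu) ` F"
      proof
        fix f
        assume f: "f \<in> G"
        then obtain L where L: "L \<in> SSYT ?D {1..}" "f = diagram_rows (lam, mu) L"
          using im unfolding G_def by blast
        then have "L \<in> F" using iff[OF L(1)] f by (simp add: F_def G_def)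
        then show "f \<in> diagram_rows (lam, mu) ` F" using L(2) by blast
      qed
    qed
  qed
  have "G \<subseteq> {f \<in> skew_tableaux (lam, mu). mset (rword (length lam) f) = mset (rword (length nu) ?g)}"
    using knuth_equiv_mset by (auto simp: G_def)
  then have "finite G"
    unfolding skew_tableaux_def fst_conv snd_conv by (rule finite_subset) (rule finite_row_tableaux_mset)
  then show "finite F" using bij_betw_finite[OF bij] by simp
  have "card F = card G" by (rule bij_betw_same_card[OF bij])
  also have "\<dots> = card (lr_tableaux (length lam) (part mu) (\<lambda>k. part lam k - part mu k) nu)"
    unfolding G_def skew_tableaux_def fst_conv snd_conv by (rule card_rectification_fiber[OF nu g])
  also have "\<dots> = nat (lr_coeff mu nu lam)" by (simp add: lr_coeff_nonneg_card[OF skew nu])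
  finally show "card F = nat (lr_coeff mu nu lam)" .
qed

lemma Rect_shape_in_lr_set:
  assumes "is_skew (lam, mu)" "L \<in> SSYT (diagram (lam, mu)) {1::nat..}" "Rect (diagram (lam, mu)) L = (nu, S)"
  shows "nu \<in> lr_set (lam, mu)"
proof -
  have nu: "is_partition nu" and S: "S \<in> SSYT (young nu) {1..}" by (rule Rect_positive[OF assms])+
  have "card {L \<in> SSYT (diagram (lam, mu)) {1..}. Rect (diagram (lam, mu)) L = (nu, S)} \<noteq> 0"
    using card_Rect_fiber(1)[OF assms(1) nu S] assms(2,3) by (auto simp: card_eq_0_iff)
  then have "nat (lr_coeff mu nu lam) \<noteq> 0" unfolding card_Rect_fiber(2)[OF assms(1) nu S] .
  then show ?thesis using nu by (simp add: lr_set_def)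
qed

lemma finite_lr_set:
  assumes skew: "is_skew (lam, mu)"
  shows "finite (lr_set (lam, mu))"
proof (rule finite_subset[OF _ finite_partitions])
  let ?l = "\<lambda>k. part lam k - part mu k"
  show "lr_set (lam, mu) \<subseteq> {nu. is_partition nu \<and> sum_list nu = (\<Sum>k\<in>{1..length lam}. ?l k)}"
  proof
    fix nu
    assume "nu \<in> lr_set (lam, mu)"
    then have nu: "is_partition nu" and pos: "lr_coeff mu nu lam > 0" by (simp_all add: lr_set_def)
    have "lr_tableaux (length lam) (part mu) ?l nu \<noteq> {}"
      using pos unfolding lr_coeff_nonneg_card[OF skew nu] by force
    then obtain f where f: "f \<in> row_tableaux (length lam) (part mu) ?l"
      "mset (rword (length lam) f) = mset (rword (length nu) (super_tableau nu))"
      using lr_tableaux_iff[OF nu] by blast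
    have "sum_list nu = length (rword (length lam) f)"
      using arg_cong[OF f(2), of size] length_rword_normal[OF super_tableau_in[OF nu]] by simp
    also have "\<dots> = (\<Sum>k\<in>{1..length lam}. ?l k)"
      using f(1) by (simp add: length_rword row_tableaux_def)
    finally show "nu \<in> {nu. is_partition nu \<and> sum_list nu = (\<Sum>k\<in>{1..length lam}. ?l k)}" using nu by simp
  qed
qed

section \<open>Absolute convergence\<close>

lemma SSYT_mem: "M \<in> SSYT D X \<Longrightarrow> x \<in> D \<Longrightarrow> M x \<in> X"
  unfolding SSYT_def mem_Collect_eq by (blast dest: PiE_mem)

text \<open>Every box is weakly to the left of and above a corner, whose entry is at least as large. Hence a
  small power of the entry in the corner can be distributed over all boxes.\<close>

lemma corner_dominates:
  assumes fin: "finite D" and x: "x \<in> D"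
  shows "\<exists>c\<in>corners D. \<forall>M\<in>SSYT D (X :: nat set). M x \<le> M c"
proof -
  define Y where "Y = {y \<in> D. \<forall>M\<in>SSYT D X. M x \<le> M y}"
  have Y: "finite Y" "x \<in> Y" using assms by (auto simp: Y_def)
  obtain c where c: "c \<in> Y" "\<And>y. y \<in> Y \<Longrightarrow> fst y + snd y \<le> fst c + snd c"
    using Max_in[of "(\<lambda>y. fst y + snd y) ` Y"] Max_ge[of "(\<lambda>y. fst y + snd y) ` Y"] Y
    by (metis (no_types, lifting) empty_iff finite_imageI image_iff)
  obtain i j where ij: "c = (i, j)" by fastforce
  have cD: "(i, j) \<in> D" and cM: "\<And>M. M \<in> SSYT D X \<Longrightarrow> M x \<le> M (i, j)" using c(1) ij by (auto simp: Y_def)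
  have "(i + 1, j) \<notin> D"
  proof
    assume n: "(i + 1, j) \<in> D"
    have "M x \<le> M (i + 1, j)" if "M \<in> SSYT D X" for M
      using cM[OF that] SSYT_col[OF that cD n] by simp
    then have "(i + 1, j) \<in> Y" using n by (simp add: Y_def)
    then show False using c(2)[of "(i + 1, j)"] ij by simp
  qed
  moreover have "(i, j + 1) \<notin> D"
  proof
    assume n: "(i, j + 1) \<in> D"
    have "M x \<le> M (i, j + 1)" if "M \<in> SSYT D X" for M
      using cM[OF that] SSYT_row[OF that cD n] by simp
    then have "(i, j + 1) \<in> Y" using n by (simp add: Y_def)
    then show False using c(2)[of "(i, j + 1)"] ij by simp
  qed
  ultimately have "c \<in> corners D" using cD ij by (simp add: corners_def)
  then show ?thesis using cM ij by blast
qed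

text \<open>Finitely many fillings lie in a cube with letters up to some \<open>N\<close>, and the
  sum over the cube factors into partial sums of the series.\<close>

lemma summable_on_prod_PiE:
  fixes g :: "nat \<Rightarrow> real"
  assumes fin: "finite D" and g: "\<And>n. 0 \<le> g n" "summable g"
  shows "(\<lambda>M. \<Prod>x\<in>D. g (M x)) summable_on (D \<rightarrow>\<^sub>E UNIV)"
proof (rule nonneg_bdd_above_summable_on)
  show "0 \<le> (\<Prod>x\<in>D. g (M x))" for M using g(1) by (simp add: prod_nonneg)
  show "bdd_above (sum (\<lambda>M. \<Prod>x\<in>D. g (M x)) ` {F. F \<subseteq> D \<rightarrow>\<^sub>E UNIV \<and> finite F})"
  proof (rule bdd_aboveI2)
    fix F
    assume "F \<in> {F. F \<subseteq> (D \<rightarrow>\<^sub>E (UNIV :: nat set)) \<and> finite F}"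
    then have F: "F \<subseteq> D \<rightarrow>\<^sub>E UNIV" "finite F" by auto
    define N where "N = Max (insert 0 (\<Union>M\<in>F. M ` D))"
    have "finite (insert 0 (\<Union>M\<in>F. M ` D))" using F(2) fin by simp
    then have N: "M x \<le> N" if "M \<in> F" "x \<in> D" for M x
      unfolding N_def using that by (intro Max_ge) auto
    have sub: "F \<subseteq> D \<rightarrow>\<^sub>E {..N}"
      using F(1) N by (auto simp: PiE_def Pi_def)
    have "(\<Sum>M\<in>F. \<Prod>x\<in>D. g (M x)) \<le> (\<Sum>M\<in>D \<rightarrow>\<^sub>E {..N}. \<Prod>x\<in>D. g (M x))"
      by (rule sum_mono2) (use fin sub g(1) in \<open>auto simp: finite_PiE prod_nonneg\<close>)
    also have "\<dots> = (\<Prod>x\<in>D. \<Sum>n\<in>{..N}. g n)"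
      by (rule prod_sum_PiE[symmetric]) (use fin in auto)
    also have "\<dots> \<le> (\<Prod>x\<in>D. suminf g)"
      by (rule prod_mono) (use g in \<open>auto intro!: sum_nonneg sum_le_suminf\<close>)
    finally show "(\<Sum>M\<in>F. \<Prod>x\<in>D. g (M x)) \<le> (\<Prod>x\<in>D. suminf g)" .
  qed
qed

theorem schur_zeta_summable:
  assumes fin: "finite D" and s: "\<And>x. x \<in> D \<Longrightarrow> 1 \<le> Re (s x)" "\<And>c. c \<in> corners D \<Longrightarrow> 1 < Re (s c)"
  shows "(\<lambda>M. \<Prod>x\<in>D. of_nat (M x) powr (- s x)) summable_on SSYT D {1::nat..}"
proof -
  let ?C = "corners D"
  have finC: "finite ?C" using fin by (rule finite_subset[rotated]) (auto simp: corners_def)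
  have CD: "?C \<subseteq> D" by (auto simp: corners_def)
  \<comment> \<open>The excess over 1 available at every corner; the inserted 1 keeps the minimum
    defined when there are no corners.\<close>
  define e where "e = Min (insert 1 ((\<lambda>c. Re (s c) - 1) ` ?C))"
  have e: "0 < e" "\<And>c. c \<in> ?C \<Longrightarrow> e \<le> Re (s c) - 1"
    using finC s(2) by (auto simp: e_def)
  \<comment> \<open>Small enough for each corner to give away one power \<open>- d\<close> for every
    box of \<open>D\<close>; the added 1 avoids a division by zero.\<close>
  define d where "d = e / (card D + 1)"
  have d: "0 < d" "card D * d \<le> e" using e(1) by (auto simp: d_def field_simps)
  define g where "g n = (if n = 0 then 0 else real n powr (- 1 - d))" for n :: nat
  have g: "0 \<le> g n" for n by (simp add: g_def)
  have "summable (\<lambda>n. real n powr (- 1 - d))" using d(1) by (simp add: summable_real_powr_iff)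
  moreover have "(\<lambda>n. real n powr (- 1 - d)) = g" by (auto simp: g_def)
  ultimately have "summable g" by simp
  then have sum: "(\<lambda>M. \<Prod>x\<in>D. g (M x)) summable_on (D \<rightarrow>\<^sub>E UNIV)"
    by (rule summable_on_prod_PiE[OF fin g])
  have bound: "norm (\<Prod>x\<in>D. of_nat (M x) powr (- s x)) \<le> (\<Prod>x\<in>D. g (M x))" if M: "M \<in> SSYT D {1..}" for M :: "box \<Rightarrow> nat"
  proof -
    have pos: "1 \<le> M x" if "x \<in> D" for x using SSYT_mem[OF M that] by simp
    define P where "P = (\<Prod>c\<in>?C. real (M c) powr (- d))"
    have "norm (\<Prod>x\<in>D. of_nat (M x) powr (- s x)) = (\<Prod>x\<in>D. real (M x) powr (- Re (s x)))"
      unfolding prod_norm[symmetric]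
      by (intro prod.cong refl) (simp add: norm_powr_real_powr)
    also have "\<dots> \<le> (\<Prod>x\<in>D. real (M x) powr (- 1) * (if x \<in> ?C then real (M x) powr (- e) else 1))"
    proof (rule prod_mono, intro conjI)
      fix x
      assume x: "x \<in> D"
      show "0 \<le> real (M x) powr (- Re (s x))" by simp
      show "real (M x) powr (- Re (s x)) \<le> real (M x) powr (- 1) * (if x \<in> ?C then real (M x) powr (- e) else 1)"
      proof (cases "x \<in> ?C")
        case True
        have "real (M x) powr (- Re (s x)) \<le> real (M x) powr (- 1 + - e)"
          using pos[OF x] e(2)[OF True] by (intro powr_mono) auto
        also have "\<dots> = real (M x) powr (- 1) * real (M x) powr (- e)" by (rule powr_add)
        finally show ?thesis using True by simp
      next
        case False
        have "real (M x) powr (- Re (s x)) \<le> real (M x) powr (- 1)"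
          using pos[OF x] s(1)[OF x] by (intro powr_mono) auto
        then show ?thesis using False by simp
      qed
    qed
    also have "\<dots> = (\<Prod>x\<in>D. real (M x) powr (- 1)) * (\<Prod>x\<in>D. if x \<in> ?C then real (M x) powr (- e) else 1)"
      by (rule prod.distrib)
    also have "(\<Prod>x\<in>D. if x \<in> ?C then real (M x) powr (- e) else 1) = (\<Prod>x\<in>D \<inter> ?C. real (M x) powr (- e))"
      by (rule prod.inter_restrict[OF fin, symmetric])
    also have "D \<inter> ?C = ?C" using CD by blast
    also have "(\<Prod>x\<in>?C. real (M x) powr (- e)) \<le> (\<Prod>x\<in>D. real (M x) powr (- d))"
    proof -
      have "(\<Prod>x\<in>?C. real (M x) powr (- e)) \<le> (\<Prod>x\<in>?C. (real (M x) powr (- d)) ^ card D)"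
      proof (rule prod_mono, intro conjI)
        fix x
        assume x: "x \<in> ?C"
        have "1 \<le> M x" using pos CD x by blast
        then have "real (M x) powr (- e) \<le> real (M x) powr (- d * card D)"
          using d(2) by (intro powr_mono) (auto simp: mult.commute)
        also have "\<dots> = (real (M x) powr (- d)) ^ card D"
          using \<open>1 \<le> M x\<close> by (subst powr_realpow[symmetric]) (simp_all add: powr_powr)
        finally show "real (M x) powr (- e) \<le> (real (M x) powr (- d)) ^ card D" .
      qed simp
      also have "\<dots> = P ^ card D" by (simp add: P_def prod_power_distrib)
      \<comment> \<open>One factor \<open>P\<close> for each box: it is at most the power at a
        corner dominating the box, hence at most the power \<open>- d\<close> of the entry of the
        box.\<close>
      also have "\<dots> = (\<Prod>x\<in>D. P)" by simp
      also have "\<dots> \<le> (\<Prod>x\<in>D. real (M x) powr (- d))"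
      proof (rule prod_mono, intro conjI)
        fix x
        assume x: "x \<in> D"
        show "0 \<le> P" by (simp add: P_def prod_nonneg)
        obtain c where c: "c \<in> ?C" "M x \<le> M c" using corner_dominates[OF fin x, of "{1..}"] M by blast
        have le1: "real (M y) powr (- d) \<le> 1" if "y \<in> ?C" for y
          using pos[of y] that CD d(1) powr_mono[of "- d" 0 "real (M y)"] by auto
        have "P = real (M c) powr (- d) * (\<Prod>y\<in>?C - {c}. real (M y) powr (- d))"
          unfolding P_def by (rule prod.remove[OF finC c(1)])
        also have "\<dots> \<le> real (M c) powr (- d) * 1"
          by (intro mult_left_mono prod_le_1) (use le1 in auto)
        also have "\<dots> \<le> real (M x) powr (- d)"
          using pos[OF x] c(2) d(1) by (simp add: powr_mono2')
        finally show "P \<le> real (M x) powr (- d)" .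
      qed
      finally show ?thesis .
    qed
    also have "(\<Prod>x\<in>D. real (M x) powr (- 1)) * (\<Prod>x\<in>D. real (M x) powr (- d)) = (\<Prod>x\<in>D. g (M x))"
      unfolding prod.distrib[symmetric]
    proof (rule prod.cong[OF refl])
      fix x
      assume "x \<in> D"
      then show "real (M x) powr (- 1) * real (M x) powr (- d) = g (M x)"
        using pos[of x] powr_add[of "real (M x)" "- 1" "- d"] by (simp add: g_def)
    qed
    finally show ?thesis by (simp add: prod_nonneg mult_left_mono)
  qed
  have sub: "SSYT D {1::nat..} \<subseteq> D \<rightarrow>\<^sub>E UNIV" by (auto simp: SSYT_def)
  have "(\<lambda>M. \<Prod>x\<in>D. g (M x)) summable_on SSYT D {1..}" by (rule summable_on_subset_banach[OF sum sub])
  moreover have "(\<Prod>x\<in>D. g (M x)) = norm (\<Prod>x\<in>D. g (M x))" for M using g by (simp add: prod_nonneg)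
  ultimately have "(\<lambda>M. norm (\<Prod>x\<in>D. g (M x))) summable_on SSYT D {1..}" by simp
  then have "(\<lambda>M. norm (\<Prod>x\<in>D. of_nat (M x) powr (- s x))) summable_on SSYT D {1::nat..}"
    by (rule Infinite_Sum.abs_summable_on_comparison_test) (use bound g in \<open>simp add: prod_nonneg\<close>)
  then show ?thesis by (rule Infinite_Sum.abs_summable_summable)
qed

section \<open>Pasting\<close>

text \<open>The parameters \<open>ta\<close>, \<open>ra\<close> are the top row and the right-most column of \<open>A\<close>, and \<open>bb\<close>, \<open>lb\<close> the
  bottom row and the left-most column of \<open>B\<close>. A host is a middle diagram in standard position
  whose first column ends in row \<open>h\<close> and whose first row ends in column \<open>w\<close>. In the pasted diagram
  the three pieces are then told apart by the signs of the coordinates.\<close>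

locale pasting =
  fixes A B :: "box set" and l0 l1 :: nat and ta ra bb lb :: int
  assumes finA: "finite A" and finB: "finite B"
    and A: "\<And>i j. (i, j) \<in> A \<Longrightarrow> ta \<le> i \<and> j \<le> ra"
    and B: "\<And>i j. (i, j) \<in> B \<Longrightarrow> i \<le> bb \<and> lb \<le> j"
begin

definition host :: "box set \<Rightarrow> int \<Rightarrow> int \<Rightarrow> bool" where
  "host H h w \<longleftrightarrow> finite H \<and> (\<forall>i j. (i, j) \<in> H \<longrightarrow> 1 \<le> i \<and> 1 \<le> j) \<and>
     (A \<noteq> {} \<longrightarrow> 1 \<le> l0 \<and> left_shift A l0 H = (h - int l0 + 1 - ta, - ra) \<and>
       (\<forall>i j. (i, j) \<in> H \<longrightarrow> i \<le> h) \<and> (\<forall>k<l0. (h - int k, 1) \<in> H)) \<and>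
     (B \<noteq> {} \<longrightarrow> 1 \<le> l1 \<and> right_shift H l1 B = (- bb, w - int l1 + 1 - lb) \<and>
       (\<forall>i j. (i, j) \<in> H \<longrightarrow> j \<le> w) \<and> (\<forall>k<l1. (1, w - int k) \<in> H))"

text \<open>What the gluing demands across the two seams. \<open>cl k\<close> stands for the entry
  \<open>k\<close> places above the lower end of the first column, \<open>cr k\<close> for the entry
  \<open>k\<close> places before the end of the first row. As only these values enter, the middle
  tableau can be exchanged without touching the outer ones.\<close>

definition compatible :: "(box \<Rightarrow> nat) \<Rightarrow> (box \<Rightarrow> nat) \<Rightarrow> (nat \<Rightarrow> nat) \<Rightarrow> (nat \<Rightarrow> nat) \<Rightarrow> bool" where
  "compatible P Q cl cr \<longleftrightarrow>
     (\<forall>i j k. (i, j) \<in> A \<and> k < l0 \<and> i - ta = int l0 - 1 - int k \<longrightarrow> P (i, j) \<le> cl k) \<and>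
     (\<forall>i j k. (i, j) \<in> B \<and> k < l1 \<and> j - lb = int l1 - 1 - int k \<longrightarrow> Q (i, j) < cr k)"

definition triples :: "box set \<Rightarrow> int \<Rightarrow> int \<Rightarrow> ((box \<Rightarrow> nat) \<times> (box \<Rightarrow> nat) \<times> (box \<Rightarrow> nat)) set" where
  "triples H h w = {(P, L, Q). P \<in> SSYT A {1..} \<and> L \<in> SSYT H {1..} \<and> Q \<in> SSYT B {1..} \<and>
     compatible P Q (\<lambda>k. L (h - int k, 1)) (\<lambda>k. L (1, w - int k))}"

lemma paste_iff:
  "(i, j) \<in> paste A l0 H l1 B \<longleftrightarrow> (i, j) \<in> H \<or> (i, j) - left_shift A l0 H \<in> A \<or> (i, j) - right_shift H l1 B \<in> B"
proof -
  have "y \<in> (+) t ` S \<longleftrightarrow> y - t \<in> S" for y t :: box and S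
  proof
    assume "y - t \<in> S"
    then have "t + (y - t) \<in> (+) t ` S" by (rule imageI)
    then show "y \<in> (+) t ` S" by simp
  qed auto
  then show ?thesis by (auto simp: paste_def)
qed

context
  fixes H :: "box set" and h w :: int
  assumes host: "host H h w"
begin

lemma in_H: "(i, j) \<in> H \<Longrightarrow> 1 \<le> i \<and> 1 \<le> j"
  using host by (simp add: host_def)

lemma finH: "finite H"
  using host by (simp add: host_def)

lemma in_A:
  assumes "(i, j) - left_shift A l0 H \<in> A"
  shows "1 \<le> i" "j \<le> 0" "h - int l0 + 1 \<le> i"
    "(i, j) - left_shift A l0 H = (i - (h - int l0 + 1 - ta), j + ra)"
    "\<And>i j. (i, j) \<in> H \<Longrightarrow> i \<le> h" "\<And>k. k < l0 \<Longrightarrow> (h - int k, 1) \<in> H"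
proof -
  have "A \<noteq> {}" using assms by blast
  then have host': "1 \<le> l0" "left_shift A l0 H = (h - int l0 + 1 - ta, - ra)"
    "\<forall>i j. (i, j) \<in> H \<longrightarrow> i \<le> h" "\<forall>k<l0. (h - int k, 1) \<in> H" using host by (simp_all add: host_def)
  show eq: "(i, j) - left_shift A l0 H = (i - (h - int l0 + 1 - ta), j + ra)" by (simp add: host'(2))
  have "(i - (h - int l0 + 1 - ta), j + ra) \<in> A" using assms unfolding eq .
  from A[OF this] show 1: "h - int l0 + 1 \<le> i" and "j \<le> 0" by simp_all
  have "l0 - 1 < l0" using host'(1) by simp
  then have "(h - int (l0 - 1), 1) \<in> H" using host'(4) by blast
  then have "1 \<le> h - int (l0 - 1)" using in_H by blast
  then show "1 \<le> i" using 1 host'(1) by simp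
  show "\<And>i j. (i, j) \<in> H \<Longrightarrow> i \<le> h" "\<And>k. k < l0 \<Longrightarrow> (h - int k, 1) \<in> H" using host'(3,4) by blast+
qed

lemma in_B:
  assumes "(i, j) - right_shift H l1 B \<in> B"
  shows "i \<le> 0" "1 \<le> j" "w - int l1 + 1 \<le> j"
    "(i, j) - right_shift H l1 B = (i + bb, j - (w - int l1 + 1 - lb))"
    "\<And>i j. (i, j) \<in> H \<Longrightarrow> j \<le> w" "\<And>k. k < l1 \<Longrightarrow> (1, w - int k) \<in> H"
proof -
  have "B \<noteq> {}" using assms by blast
  then have host': "1 \<le> l1" "right_shift H l1 B = (- bb, w - int l1 + 1 - lb)"
    "\<forall>i j. (i, j) \<in> H \<longrightarrow> j \<le> w" "\<forall>k<l1. (1, w - int k) \<in> H" using host by (simp_all add: host_def)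
  show eq: "(i, j) - right_shift H l1 B = (i + bb, j - (w - int l1 + 1 - lb))" by (simp add: host'(2))
  have "(i + bb, j - (w - int l1 + 1 - lb)) \<in> B" using assms unfolding eq .
  from B[OF this] show 1: "w - int l1 + 1 \<le> j" and "i \<le> 0" by simp_all
  have "l1 - 1 < l1" using host'(1) by simp
  then have "(1, w - int (l1 - 1)) \<in> H" using host'(4) by blast
  then have "1 \<le> w - int (l1 - 1)" using in_H by blast
  then show "1 \<le> j" using 1 host'(1) by simp
  show "\<And>i j. (i, j) \<in> H \<Longrightarrow> j \<le> w" "\<And>k. k < l1 \<Longrightarrow> (1, w - int k) \<in> H" using host'(3,4) by blast+
qed

lemma filling_H: "(i, j) \<in> H \<Longrightarrow> paste_filling A P l0 H L l1 B Q (i, j) = L (i, j)"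
  by (simp add: paste_filling_def paste_iff)

lemma filling_A:
  assumes "(i, j) - left_shift A l0 H \<in> A"
  shows "paste_filling A P l0 H L l1 B Q (i, j) = P ((i, j) - left_shift A l0 H)"
proof -
  have "(i, j) \<notin> H" using in_A(2)[OF assms] in_H by fastforce
  then show ?thesis using assms by (simp add: paste_filling_def paste_iff)
qed

lemma filling_B:
  assumes "(i, j) - right_shift H l1 B \<in> B"
  shows "paste_filling A P l0 H L l1 B Q (i, j) = Q ((i, j) - right_shift H l1 B)"
proof -
  have "(i, j) \<notin> H" using in_B(1)[OF assms] in_H by fastforce
  moreover have "(i, j) - left_shift A l0 H \<notin> A" using in_B(1)[OF assms] in_A(1) by fastforce
  ultimately show ?thesis using assms by (simp add: paste_filling_def paste_iff)
qed

text \<open>By the signs of the coordinates, \<open>A\<close> shares rows but no columns with the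
  host, \<open>B\<close> shares columns but no rows, and \<open>A\<close> and \<open>B\<close> share
  neither. Hence \<open>compatible\<close> covers all comparisons between different pieces.\<close>

lemma paste_filling_SSYT:
  assumes "(P, L, Q) \<in> triples H h w"
  shows "paste_filling A P l0 H L l1 B Q \<in> SSYT (paste A l0 H l1 B) {1..}"
proof -
  let ?F = "paste_filling A P l0 H L l1 B Q" and ?D = "paste A l0 H l1 B"
  have P: "P \<in> SSYT A {1..}" and L: "L \<in> SSYT H {1..}" and Q: "Q \<in> SSYT B {1..}"
    and comp: "compatible P Q (\<lambda>k. L (h - int k, 1)) (\<lambda>k. L (1, w - int k))"
    using assms by (simp_all add: triples_def)
  have mem: "?F (i, j) \<in> {1..}" if "(i, j) \<in> ?D" for i j
    using that[unfolded paste_iff]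
  proof (elim disjE)
    assume x: "(i, j) \<in> H"
    show ?thesis unfolding filling_H[OF x] by (rule SSYT_mem[OF L x])
  next
    assume x: "(i, j) - left_shift A l0 H \<in> A"
    show ?thesis unfolding filling_A[OF x] by (rule SSYT_mem[OF P x])
  next
    assume x: "(i, j) - right_shift H l1 B \<in> B"
    show ?thesis unfolding filling_B[OF x] by (rule SSYT_mem[OF Q x])
  qed
  have row: "?F (i, j) \<le> ?F (i, j')" if x: "(i, j) \<in> ?D" and y: "(i, j') \<in> ?D" and lt: "j < j'" for i j j'
    using x[unfolded paste_iff]
  proof (elim disjE)
    assume x: "(i, j) \<in> H"
    then have "1 \<le> i" "1 \<le> j'" using in_H[OF x] lt by auto
    then have y': "(i, j') \<in> H" using y in_A(2) in_B(1) unfolding paste_iff by fastforce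
    show ?thesis unfolding filling_H[OF x] filling_H[OF y'] using SSYT_row[OF L x y'] lt by simp
  next
    assume x: "(i, j) - left_shift A l0 H \<in> A"
    have "\<not> (i, j') - right_shift H l1 B \<in> B" using in_A(1)[OF x] in_B(1) by fastforce
    then consider "(i, j') \<in> H" | "(i, j') - left_shift A l0 H \<in> A" using y unfolding paste_iff by blast
    then show ?thesis
    proof cases
      case 1
      \<comment> \<open>Row \<open>i\<close> is the \<open>k\<close>-th from below in the host;
        since it also meets \<open>A\<close>, it is one of the \<open>l0\<close> glued rows, and the
        comparison passes through the first box of the host in this row.\<close>
      define k where "k = nat (h - i)"
      have k: "i = h - int k" "k < l0" using in_A(5)[OF x 1] in_A(3)[OF x] by (auto simp: k_def)
      have x': "(i - (h - int l0 + 1 - ta), j + ra) \<in> A" using x unfolding in_A(4)[OF x] .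
      have e: "i - (h - int l0 + 1 - ta) - ta = int l0 - 1 - int k" using k(1) by simp
      have "P (i - (h - int l0 + 1 - ta), j + ra) \<le> L (h - int k, 1)"
        using comp x' k(2) e unfolding compatible_def by blast
      also have "\<dots> \<le> L (i, j')"
        using SSYT_row[OF L in_A(6)[OF x k(2)], of j'] 1 in_H[OF 1] k(1) by simp
      finally show ?thesis unfolding filling_A[OF x] filling_H[OF 1] in_A(4)[OF x] .
    next
      case 2
      then show ?thesis
        using SSYT_row[OF P x[unfolded in_A(4)[OF x]] 2[unfolded in_A(4)[OF 2]]] lt
        by (simp add: filling_A[OF x] filling_A[OF 2] in_A(4)[OF x] in_A(4)[OF 2])
    qed
  next
    assume x: "(i, j) - right_shift H l1 B \<in> B"
    have "\<not> (i, j') \<in> H" "\<not> (i, j') - left_shift A l0 H \<in> A"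
      using in_B(1)[OF x] in_A(1) in_H by fastforce+
    then have y': "(i, j') - right_shift H l1 B \<in> B" using y unfolding paste_iff by blast
    show ?thesis
      using SSYT_row[OF Q x[unfolded in_B(4)[OF x]] y'[unfolded in_B(4)[OF y']]] lt
      by (simp add: filling_B[OF x] filling_B[OF y'] in_B(4)[OF x] in_B(4)[OF y'])
  qed
  have col: "?F (i, j) < ?F (i', j)" if x: "(i, j) \<in> ?D" and y: "(i', j) \<in> ?D" and lt: "i < i'" for i i' j
    using x[unfolded paste_iff]
  proof (elim disjE)
    assume x: "(i, j) \<in> H"
    then have "1 \<le> j" "1 \<le> i'" using in_H[OF x] lt by auto
    then have y': "(i', j) \<in> H" using y in_A(2) in_B(1) unfolding paste_iff by fastforce
    show ?thesis unfolding filling_H[OF x] filling_H[OF y'] using SSYT_col[OF L x y'] lt by simp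
  next
    assume x: "(i, j) - left_shift A l0 H \<in> A"
    have "\<not> (i', j) \<in> H" "\<not> (i', j) - right_shift H l1 B \<in> B"
      using in_A(2)[OF x] in_B(2) in_H by fastforce+
    then have y': "(i', j) - left_shift A l0 H \<in> A" using y unfolding paste_iff by blast
    show ?thesis
      using SSYT_col[OF P x[unfolded in_A(4)[OF x]] y'[unfolded in_A(4)[OF y']]] lt
      by (simp add: filling_A[OF x] filling_A[OF y'] in_A(4)[OF x] in_A(4)[OF y'])
  next
    assume x: "(i, j) - right_shift H l1 B \<in> B"
    have "\<not> (i', j) - left_shift A l0 H \<in> A" using in_B(2)[OF x] in_A(2) by fastforce
    then consider "(i', j) \<in> H" | "(i', j) - right_shift H l1 B \<in> B" using y unfolding paste_iff by blast
    then show ?thesis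
    proof cases
      case 1
      define k where "k = nat (w - j)"
      have k: "j = w - int k" "k < l1" using in_B(5)[OF x 1] in_B(3)[OF x] by (auto simp: k_def)
      have x': "(i + bb, j - (w - int l1 + 1 - lb)) \<in> B" using x unfolding in_B(4)[OF x] .
      have e: "j - (w - int l1 + 1 - lb) - lb = int l1 - 1 - int k" using k(1) by simp
      have "Q (i + bb, j - (w - int l1 + 1 - lb)) < L (1, w - int k)"
        using comp x' k(2) e unfolding compatible_def by blast
      also have "\<dots> \<le> L (i', j)"
      proof (cases "i' = 1")
        case False
        then show ?thesis
          using SSYT_col[OF L in_B(6)[OF x k(2)], of i'] 1 in_H[OF 1] k(1) by simp
      qed (simp add: k(1))
      finally show ?thesis unfolding filling_B[OF x] filling_H[OF 1] in_B(4)[OF x] .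
    next
      case 2
      then show ?thesis
        using SSYT_col[OF Q x[unfolded in_B(4)[OF x]] 2[unfolded in_B(4)[OF 2]]] lt
        by (simp add: filling_B[OF x] filling_B[OF 2] in_B(4)[OF x] in_B(4)[OF 2])
    qed
  qed
  have "?F \<in> ?D \<rightarrow>\<^sub>E {1..}"
  proof (rule PiE_I)
    fix x assume "x \<in> ?D" then show "?F x \<in> {1..}" using mem by (cases x) simp
  next
    fix x assume "x \<notin> ?D" then show "?F x = undefined" by (simp add: paste_filling_def)
  qed
  then show ?thesis unfolding SSYT_def using row col by blast
qed

lemma shift_A: "x \<in> A \<Longrightarrow> left_shift A l0 H + x \<in> paste A l0 H l1 B"
  and shift_B: "x \<in> B \<Longrightarrow> right_shift H l1 B + x \<in> paste A l0 H l1 B"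
  by (simp_all add: paste_def)

lemma filling_shift_A:
  assumes "x \<in> A"
  shows "paste_filling A P l0 H L l1 B Q (left_shift A l0 H + x) = P x"
proof -
  obtain i j where ij: "left_shift A l0 H + x = (i, j)" by fastforce
  then have "(i, j) - left_shift A l0 H = x" by (metis add_diff_cancel_left')
  then show ?thesis using filling_A[of i j P L Q] assms ij by simp
qed

lemma filling_shift_B:
  assumes "x \<in> B"
  shows "paste_filling A P l0 H L l1 B Q (right_shift H l1 B + x) = Q x"
proof -
  obtain i j where ij: "right_shift H l1 B + x = (i, j)" by fastforce
  then have "(i, j) - right_shift H l1 B = x" by (metis add_diff_cancel_left')
  then show ?thesis using filling_B[of i j P L Q] assms ij by simp
qed

lemma SSYT_translate:
  assumes M: "M \<in> SSYT D X" and sub: "\<And>x. x \<in> S \<Longrightarrow> t + x \<in> D"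
  shows "(\<lambda>x\<in>S. M (t + x)) \<in> SSYT S X"
proof -
  obtain t1 t2 where t: "t = (t1, t2)" by fastforce
  have "M (t1 + i, t2 + j) \<le> M (t1 + i, t2 + j')" if "(i, j) \<in> S" "(i, j') \<in> S" "j < j'" for i j j'
    using SSYT_row[OF M, of "t1 + i" "t2 + j" "t2 + j'"] sub[OF that(1)] sub[OF that(2)] that(3) by (simp add: t)
  moreover have "M (t1 + i, t2 + j) < M (t1 + i', t2 + j)" if "(i, j) \<in> S" "(i', j) \<in> S" "i < i'" for i i' j
    using SSYT_col[OF M, of "t1 + i" "t2 + j" "t1 + i'"] sub[OF that(1)] sub[OF that(2)] that(3) by (simp add: t)
  moreover have "(\<lambda>x\<in>S. M (t + x)) \<in> S \<rightarrow>\<^sub>E X" using SSYT_mem[OF M sub] by simp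
  ultimately show ?thesis by (simp add: SSYT_def t)
qed

lemma SSYT_paste_triple:
  assumes M: "M \<in> SSYT (paste A l0 H l1 B) {1..}"
  shows "(\<lambda>x\<in>A. M (left_shift A l0 H + x), restrict M H, \<lambda>x\<in>B. M (right_shift H l1 B + x)) \<in> triples H h w"
proof -
  let ?D = "paste A l0 H l1 B"
  have HD: "x \<in> ?D" if "x \<in> H" for x using that by (simp add: paste_def)
  have "restrict M H = (\<lambda>x\<in>H. M (0 + x))" by simp
  then have L: "restrict M H \<in> SSYT H {1..}" using SSYT_translate[OF M, of H 0] HD by simp
  have P: "(\<lambda>x\<in>A. M (left_shift A l0 H + x)) \<in> SSYT A {1..}" by (rule SSYT_translate[OF M shift_A])
  have Q: "(\<lambda>x\<in>B. M (right_shift H l1 B + x)) \<in> SSYT B {1..}" by (rule SSYT_translate[OF M shift_B])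
  have 1: "M (left_shift A l0 H + (i, j)) \<le> restrict M H (h - int k, 1)"
    if x: "(i, j) \<in> A" and k: "k < l0" "i - ta = int l0 - 1 - int k" for i j k
  proof -
    obtain i' j' where ij: "left_shift A l0 H + (i, j) = (i', j')" by fastforce
    then have "(i', j') - left_shift A l0 H = (i, j)" by (metis add_diff_cancel_left')
    then have a: "(i', j') - left_shift A l0 H \<in> A" using x by simp
    have i': "i' = h - int k" using in_A(4)[OF a] \<open>(i', j') - left_shift A l0 H = (i, j)\<close> k(2) by simp
    have c: "(h - int k, 1) \<in> H" by (rule in_A(6)[OF a k(1)])
    have "M (i', j') \<le> M (h - int k, 1)"
      using SSYT_row[OF M, of i' j' 1] shift_A[OF x] HD[OF c] in_A(2)[OF a] by (simp add: ij i')
    then show ?thesis using c by (simp add: ij)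
  qed
  have 2: "M (right_shift H l1 B + (i, j)) < restrict M H (1, w - int k)"
    if x: "(i, j) \<in> B" and k: "k < l1" "j - lb = int l1 - 1 - int k" for i j k
  proof -
    obtain i' j' where ij: "right_shift H l1 B + (i, j) = (i', j')" by fastforce
    then have "(i', j') - right_shift H l1 B = (i, j)" by (metis add_diff_cancel_left')
    then have a: "(i', j') - right_shift H l1 B \<in> B" using x by simp
    have j': "j' = w - int k" using in_B(4)[OF a] \<open>(i', j') - right_shift H l1 B = (i, j)\<close> k(2) by simp
    have c: "(1, w - int k) \<in> H" by (rule in_B(6)[OF a k(1)])
    have "M (i', j') < M (1, w - int k)"
      using SSYT_col[OF M, of i' j' 1] shift_B[OF x] HD[OF c] in_B(1)[OF a] by (simp add: ij j')
    then show ?thesis using c by (simp add: ij)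
  qed
  have "compatible (\<lambda>x\<in>A. M (left_shift A l0 H + x)) (\<lambda>x\<in>B. M (right_shift H l1 B + x))
      (\<lambda>k. restrict M H (h - int k, 1)) (\<lambda>k. restrict M H (1, w - int k))"
    unfolding compatible_def
  proof (intro conjI allI impI)
    fix i j k
    assume *: "(i, j) \<in> A \<and> k < l0 \<and> i - ta = int l0 - 1 - int k"
    have "(\<lambda>x\<in>A. M (left_shift A l0 H + x)) (i, j) = M (left_shift A l0 H + (i, j))"
      by (rule restrict_apply') (use * in blast)
    then show "(\<lambda>x\<in>A. M (left_shift A l0 H + x)) (i, j) \<le> restrict M H (h - int k, 1)"
      using 1[of i j k] * by argo
  next
    fix i j k
    assume *: "(i, j) \<in> B \<and> k < l1 \<and> j - lb = int l1 - 1 - int k"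
    have "(\<lambda>x\<in>B. M (right_shift H l1 B + x)) (i, j) = M (right_shift H l1 B + (i, j))"
      by (rule restrict_apply') (use * in blast)
    then show "(\<lambda>x\<in>B. M (right_shift H l1 B + x)) (i, j) < restrict M H (1, w - int k)"
      using 2[of i j k] * by argo
  qed
  then show ?thesis using P L Q by (simp add: triples_def)
qed

lemma bij_betw_paste_filling:
  "bij_betw (\<lambda>(P, L, Q). paste_filling A P l0 H L l1 B Q) (triples H h w) (SSYT (paste A l0 H l1 B) {1..})"
proof -
  define F where "F = (\<lambda>(P :: box \<Rightarrow> nat, L, Q). paste_filling A P l0 H L l1 B Q)"
  define G where "G M = (\<lambda>x\<in>A. M (left_shift A l0 H + x), restrict M H, \<lambda>x\<in>B. M (right_shift H l1 B + x))"
    for M :: "box \<Rightarrow> nat"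
  have ext: "f \<in> extensional D" if "f \<in> SSYT D X" for f :: "box \<Rightarrow> nat" and D X
    using that by (simp add: SSYT_def PiE_def)
  have GF: "G (F p) = p" if p: "p \<in> triples H h w" for p
  proof -
    obtain P L Q where pe: "p = (P, L, Q)" by (cases p)
    have PLQ: "P \<in> extensional A" "L \<in> extensional H" "Q \<in> extensional B"
      using p pe ext by (auto simp: triples_def)
    have "(\<lambda>x\<in>A. paste_filling A P l0 H L l1 B Q (left_shift A l0 H + x)) = P"
      by (rule extensionalityI[OF restrict_extensional PLQ(1)]) (simp add: filling_shift_A)
    moreover have "restrict (paste_filling A P l0 H L l1 B Q) H = L"
    proof (rule extensionalityI[OF restrict_extensional PLQ(2)])
      fix x assume x: "x \<in> H"
      then have "(fst x, snd x) \<in> H" by simp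
      from filling_H[OF this, of P L Q] x
      show "restrict (paste_filling A P l0 H L l1 B Q) H x = L x" by simp
    qed
    moreover have "(\<lambda>x\<in>B. paste_filling A P l0 H L l1 B Q (right_shift H l1 B + x)) = Q"
      by (rule extensionalityI[OF restrict_extensional PLQ(3)]) (simp add: filling_shift_B)
    ultimately show ?thesis by (simp add: pe F_def G_def)
  qed
  have FG: "F (G M) = M" if M: "M \<in> SSYT (paste A l0 H l1 B) {1..}" for M
  proof -
    let ?F = "paste_filling A (\<lambda>x\<in>A. M (left_shift A l0 H + x)) l0 H (restrict M H) l1 B (\<lambda>x\<in>B. M (right_shift H l1 B + x))"
    have "?F = M"
    proof (rule extensionalityI[OF _ ext[OF M]])
      show "?F \<in> extensional (paste A l0 H l1 B)" by (simp add: paste_filling_def)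
      fix x
      assume "x \<in> paste A l0 H l1 B"
      then consider "x \<in> H" | y where "y \<in> A" "x = left_shift A l0 H + y" | y where "y \<in> B" "x = right_shift H l1 B + y"
        by (auto simp: paste_def)
      then show "?F x = M x"
      proof cases
        case 1
        then have "(fst x, snd x) \<in> H" by simp
        from filling_H[OF this, of "\<lambda>x\<in>A. M (left_shift A l0 H + x)" "restrict M H" "\<lambda>x\<in>B. M (right_shift H l1 B + x)"]
        show ?thesis using 1 by simp
      qed (simp_all add: filling_shift_A filling_shift_B)
    qed
    then show ?thesis by (simp add: F_def G_def)
  qed
  have "F p \<in> SSYT (paste A l0 H l1 B) {1..}" if "p \<in> triples H h w" for p
  proof -
    obtain P L Q where pe: "p = (P, L, Q)" by (cases p)
    have "(P, L, Q) \<in> triples H h w" using that pe by simp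
    from paste_filling_SSYT[OF this] show ?thesis by (simp add: F_def pe)
  qed
  moreover have "G M \<in> triples H h w" if "M \<in> SSYT (paste A l0 H l1 B) {1..}" for M
    unfolding G_def by (rule SSYT_paste_triple[OF that])
  ultimately have "bij_betw F (triples H h w) (SSYT (paste A l0 H l1 B) {1..})"
    using GF FG by (intro bij_betw_byWitness[where f' = G]) blast+
  then show ?thesis by (simp only: F_def)
qed

lemma prod_paste:
  fixes f :: "'x \<Rightarrow> 'y \<Rightarrow> 'z::comm_monoid_mult"
  shows "(\<Prod>x\<in>paste A l0 H l1 B. f (paste_filling A P l0 H L l1 B Q x) (paste_filling A a l0 H v l1 B b x)) =
    (\<Prod>x\<in>A. f (P x) (a x)) * (\<Prod>x\<in>H. f (L x) (v x)) * (\<Prod>x\<in>B. f (Q x) (b x))"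
proof -
  let ?g = "\<lambda>x. f (paste_filling A P l0 H L l1 B Q x) (paste_filling A a l0 H v l1 B b x)"
  let ?A = "(+) (left_shift A l0 H) ` A" and ?B = "(+) (right_shift H l1 B) ` B"
  have inA: "1 \<le> fst x \<and> snd x \<le> 0" if xA: "x \<in> ?A" for x
  proof -
    obtain y where y: "y \<in> A" "x = left_shift A l0 H + y" using xA by (rule imageE) simp
    have "(fst x, snd x) - left_shift A l0 H = y" unfolding prod.collapse y(2) by (rule add_diff_cancel_left')
    then have "(fst x, snd x) - left_shift A l0 H \<in> A" using y(1) by simp
    then show ?thesis using in_A(1,2) by blast
  qed
  have inB: "fst x \<le> 0" if xB: "x \<in> ?B" for x
  proof -
    obtain y where y: "y \<in> B" "x = right_shift H l1 B + y" using xB by (rule imageE) simp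
    have "(fst x, snd x) - right_shift H l1 B = y" unfolding prod.collapse y(2) by (rule add_diff_cancel_left')
    then have "(fst x, snd x) - right_shift H l1 B \<in> B" using y(1) by simp
    then show ?thesis using in_B(1) by blast
  qed
  have inH': "1 \<le> fst x \<and> 1 \<le> snd x" if "x \<in> H" for x using in_H[of "fst x" "snd x"] that by simp
  have d1: "?A \<inter> H = {}"
  proof (rule equals0I)
    fix x assume x: "x \<in> ?A \<inter> H"
    have "snd x \<le> 0" using inA[OF IntD1[OF x]] by blast
    moreover have "1 \<le> snd x" using inH'[OF IntD2[OF x]] by blast
    ultimately show False by simp
  qed
  have d2: "(?A \<union> H) \<inter> ?B = {}"
  proof (rule equals0I)
    fix x assume x: "x \<in> (?A \<union> H) \<inter> ?B"
    have "1 \<le> fst x" using IntD1[OF x]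
    proof
      assume "x \<in> ?A" from inA[OF this] show ?thesis by blast
    next
      assume "x \<in> H" from inH'[OF this] show ?thesis by blast
    qed
    moreover have "fst x \<le> 0" by (rule inB[OF IntD2[OF x]])
    ultimately show False by simp
  qed
  have "(\<Prod>x\<in>paste A l0 H l1 B. ?g x) = (\<Prod>x\<in>?A \<union> H. ?g x) * (\<Prod>x\<in>?B. ?g x)"
    unfolding paste_def using d2 finA finB finH by (intro prod.union_disjoint) auto
  also have "(\<Prod>x\<in>?A \<union> H. ?g x) = (\<Prod>x\<in>?A. ?g x) * (\<Prod>x\<in>H. ?g x)"
    using d1 finA finH by (intro prod.union_disjoint) auto
  also have "(\<Prod>x\<in>?A. ?g x) = (\<Prod>x\<in>A. f (P x) (a x))"
    by (subst prod.reindex) (simp_all add: filling_shift_A inj_on_def)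
  also have "(\<Prod>x\<in>?B. ?g x) = (\<Prod>x\<in>B. f (Q x) (b x))"
    by (subst prod.reindex) (simp_all add: filling_shift_B inj_on_def)
  also have "(\<Prod>x\<in>H. ?g x) = (\<Prod>x\<in>H. f (L x) (v x))"
  proof (rule prod.cong[OF refl])
    fix x assume x: "x \<in> H"
    then have "(fst x, snd x) \<in> H" by simp
    from filling_H[OF this, of P L Q] filling_H[OF this, of a v b]
    show "?g x = f (L x) (v x)" by simp
  qed
  finally show ?thesis .
qed

lemma finite_paste: "finite (paste A l0 H l1 B)"
  using finA finB finH by (simp add: paste_def)

end

text \<open>This transfers the assumption on real parts at corners from one host to another. A right
  neighbour outside \<open>A\<close> is a box of the first column in a glued row, and every host has
  that box; all other neighbours belong to \<open>A\<close> and move along with it.\<close>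

lemma corner_A:
  assumes H: "host H h w" and H': "host H' h' w'" and x: "x \<in> A"
    and corner: "left_shift A l0 H' + x \<in> corners (paste A l0 H' l1 B)"
  shows "left_shift A l0 H + x \<in> corners (paste A l0 H l1 B)"
proof -
  obtain p q where pq: "x = (p, q)" by fastforce
  have "A \<noteq> {}" using x by blast
  then have s: "left_shift A l0 H = (h - int l0 + 1 - ta, - ra)" "left_shift A l0 H' = (h' - int l0 + 1 - ta, - ra)"
    and c: "\<forall>k<l0. (h' - int k, 1) \<in> H'" and hH: "\<forall>i j. (i, j) \<in> H \<longrightarrow> i \<le> h"
    using H H' by (simp_all add: host_def)
  define i where "i = h - int l0 + 1 - ta + p"
  define i' where "i' = h' - int l0 + 1 - ta + p"
  define j where "j = q - ra"
  have e: "left_shift A l0 H + x = (i, j)" "left_shift A l0 H' + x = (i', j)"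
    by (simp_all add: s pq i_def i'_def j_def)
  have a: "(i, j) - left_shift A l0 H \<in> A" using e(1) x by (metis add_diff_cancel_left')
  have no: "(i' + 1, j) \<notin> paste A l0 H' l1 B" "(i', j + 1) \<notin> paste A l0 H' l1 B"
    using corner unfolding e(2) corners_def by auto
  have pos: "1 \<le> i" "j \<le> 0" "h - int l0 + 1 \<le> i" using in_A[OF H a] by simp_all
  have moveA: "(i' + d, j + d') - left_shift A l0 H' \<in> A" if "(i + d, j + d') - left_shift A l0 H \<in> A" for d d'
    using that by (simp add: s i_def i'_def)
  have "(i + 1, j) \<notin> paste A l0 H l1 B"
  proof
    assume "(i + 1, j) \<in> paste A l0 H l1 B"
    then have "(i + 1, j) - left_shift A l0 H \<in> A"
      unfolding paste_iff using in_H[OF H, of "i + 1" j] in_B(2)[OF H, of "i + 1" j] pos(2) by auto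
    then have "(i' + 1, j) - left_shift A l0 H' \<in> A" using moveA[of 1 0] by simp
    then show False using no(1) unfolding paste_iff by blast
  qed
  moreover have "(i, j + 1) \<notin> paste A l0 H l1 B"
  proof
    assume "(i, j + 1) \<in> paste A l0 H l1 B"
    then consider "(i, j + 1) \<in> H" | "(i, j + 1) - left_shift A l0 H \<in> A"
      unfolding paste_iff using in_B(1)[OF H, of i "j + 1"] pos(1) by auto
    then show False
    proof cases
      case 1
      have "j = 0" using in_H[OF H 1] pos(2) by simp
      moreover have "i \<le> h" using hH 1 by blast
      then have k: "nat (h - i) < l0" "i' = h' - int (nat (h - i))" using pos(3) by (auto simp: i_def i'_def)
      then have "(i', 1) \<in> H'" using c by metis
      ultimately show False using no(2) unfolding paste_iff by simp
    next
      case 2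
      then have "(i', j + 1) - left_shift A l0 H' \<in> A" using moveA[of 0 1] by simp
      then show False using no(2) unfolding paste_iff by blast
    qed
  qed
  moreover have "(i, j) \<in> paste A l0 H l1 B" using a unfolding paste_iff by blast
  ultimately show ?thesis unfolding e(1) corners_def by simp
qed

text \<open>As for \<open>A\<close>, with the first row of the host and neighbours below.\<close>

lemma corner_B:
  assumes H: "host H h w" and H': "host H' h' w'" and x: "x \<in> B"
    and corner: "right_shift H' l1 B + x \<in> corners (paste A l0 H' l1 B)"
  shows "right_shift H l1 B + x \<in> corners (paste A l0 H l1 B)"
proof -
  obtain p q where pq: "x = (p, q)" by fastforce
  have "B \<noteq> {}" using x by blast
  then have s: "right_shift H l1 B = (- bb, w - int l1 + 1 - lb)" "right_shift H' l1 B = (- bb, w' - int l1 + 1 - lb)"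
    and c: "\<forall>k<l1. (1, w' - int k) \<in> H'" and wH: "\<forall>i j. (i, j) \<in> H \<longrightarrow> j \<le> w"
    using H H' by (simp_all add: host_def)
  define j where "j = w - int l1 + 1 - lb + q"
  define j' where "j' = w' - int l1 + 1 - lb + q"
  define i where "i = p - bb"
  have e: "right_shift H l1 B + x = (i, j)" "right_shift H' l1 B + x = (i, j')"
    by (simp_all add: s pq i_def j'_def j_def)
  have a: "(i, j) - right_shift H l1 B \<in> B" using e(1) x by (metis add_diff_cancel_left')
  have no: "(i + 1, j') \<notin> paste A l0 H' l1 B" "(i, j' + 1) \<notin> paste A l0 H' l1 B"
    using corner unfolding e(2) corners_def by auto
  have pos: "i \<le> 0" "1 \<le> j" "w - int l1 + 1 \<le> j" using in_B[OF H a] by simp_all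
  have moveB: "(i + d, j' + d') - right_shift H' l1 B \<in> B" if "(i + d, j + d') - right_shift H l1 B \<in> B" for d d'
    using that by (simp add: s j_def j'_def)
  have "(i, j + 1) \<notin> paste A l0 H l1 B"
  proof
    assume "(i, j + 1) \<in> paste A l0 H l1 B"
    then have "(i, j + 1) - right_shift H l1 B \<in> B"
      unfolding paste_iff using in_H[OF H, of i "j + 1"] in_A(1)[OF H, of i "j + 1"] pos(1) by auto
    then have "(i, j' + 1) - right_shift H' l1 B \<in> B" using moveB[of 0 1] by simp
    then show False using no(2) unfolding paste_iff by blast
  qed
  moreover have "(i + 1, j) \<notin> paste A l0 H l1 B"
  proof
    assume "(i + 1, j) \<in> paste A l0 H l1 B"
    then consider "(i + 1, j) \<in> H" | "(i + 1, j) - right_shift H l1 B \<in> B"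
      unfolding paste_iff using in_A(2)[OF H, of "i + 1" j] pos(2) by auto
    then show False
    proof cases
      case 1
      have "i = 0" using in_H[OF H 1] pos(1) by simp
      moreover have "j \<le> w" using wH 1 by blast
      then have k: "nat (w - j) < l1" "j' = w' - int (nat (w - j))" using pos(3) by (auto simp: j_def j'_def)
      then have "(1, j') \<in> H'" using c by metis
      ultimately show False using no(1) unfolding paste_iff by simp
    next
      case 2
      then have "(i + 1, j') - right_shift H' l1 B \<in> B" using moveB[of 1 0] by simp
      then show False using no(1) unfolding paste_iff by blast
    qed
  qed
  moreover have "(i, j) \<in> paste A l0 H l1 B" using a unfolding paste_iff by blast
  ultimately show ?thesis unfolding e(1) corners_def by simp
qed

end

section \<open>Skew diagrams as outer pieces and as hosts\<close>

locale skew_pasting =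
  fixes alpha beta :: skew and l0 l1 :: nat
  assumes skew_alpha: "is_skew alpha" and skew_beta: "is_skew beta"
begin

sublocale pasting "diagram alpha" "diagram beta" l0 l1
  "Min (fst ` right_column (diagram alpha))" "Max (snd ` diagram alpha)"
  "Max (fst ` diagram beta)" "Min (snd ` bottom_row (diagram beta))"
proof
  let ?A = "diagram alpha" and ?B = "diagram beta"
  show "finite ?A" "finite ?B" by simp_all
  fix i j
  {
    assume ij: "(i, j) \<in> ?A"
    obtain al am where alpha: "alpha = (al, am)" by fastforce
    have al: "is_partition al" using skew_alpha by (simp add: alpha is_skew_def)
    have "j \<in> snd ` ?A" using ij by force
    then show "Min (fst ` right_column ?A) \<le> i \<and> j \<le> Max (snd ` ?A)"
    proof (intro conjI)
      assume "j \<in> snd ` ?A"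
      then show "j \<le> Max (snd ` ?A)" by simp
      have fin: "finite (right_column ?A)" unfolding right_column_def by simp
      have "Max (snd ` ?A) \<in> snd ` ?A" using ij by (intro Max_in) auto
      then obtain x where x: "x \<in> ?A" "Max (snd ` ?A) = snd x" by (rule imageE)
      have "x \<in> right_column ?A" unfolding right_column_def mem_Collect_eq using x(1) x(2)[symmetric] by (rule conjI)
      then have "right_column ?A \<noteq> {}" by blast
      then have "Min (fst ` right_column ?A) \<in> fst ` right_column ?A" using fin by (intro Min_in) auto
      then obtain y where y: "y \<in> right_column ?A" "Min (fst ` right_column ?A) = fst y" by (rule imageE)
      show "Min (fst ` right_column ?A) \<le> i"
      proof (rule ccontr)
        assume "\<not> ?thesis"
        then have less: "i < fst y" by (simp add: y(2))
        have "y \<in> diagram (al, am)" using y(1) by (simp add: right_column_def alpha)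
        then have "(fst y, snd y) \<in> diagram (al, am)" by (simp only: prod.collapse)
        then obtain k c where kc: "fst y = int k" "snd y = int c" "part am k < c" "c \<le> part al k"
          unfolding diagram_iff by (elim exE conjE)
        have "(i, j) \<in> diagram (al, am)" using ij by (simp add: alpha)
        then obtain k' c' where kc': "i = int k'" "j = int c'" "part am k' < c'" "c' \<le> part al k'"
          unfolding diagram_iff by (elim exE conjE)
        have "1 \<le> k'" using kc'(3,4) by (cases k') auto
        then have "part al k \<le> part al k'" using part_antimono[OF al, of k' k] less kc(1) kc'(1) by simp
        \<comment> \<open>The row of \<open>i\<close> lies above that of \<open>y\<close> and is at
          least as long in \<open>al\<close>, so its last box is in the right-most column too,
          contrary to the choice of \<open>y\<close> as topmost.\<close>
        have last: "(int k', int (part al k')) \<in> ?A" unfolding alpha diagram_int_iff using kc'(3,4) by simp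
        then have "int (part al k') \<in> snd ` ?A" by force
        then have "int (part al k') \<le> Max (snd ` ?A)" by simp
        moreover have "snd y = Max (snd ` ?A)" using y(1) by (simp add: right_column_def)
        ultimately have "int (part al k') = Max (snd ` ?A)"
          using kc(2,4) \<open>part al k \<le> part al k'\<close> by simp
        then have "(int k', int (part al k')) \<in> right_column ?A" using last by (simp add: right_column_def)
        then have "int k' \<in> fst ` right_column ?A" by force
        then have "Min (fst ` right_column ?A) \<le> int k'" using fin by simp
        then show False using less kc'(1) y(2) by simp
      qed
    qed
  }
  {
    assume ij: "(i, j) \<in> ?B"
    obtain be bm where beta: "beta = (be, bm)" by fastforce
    have bm: "is_partition bm" using skew_beta by (simp add: beta is_skew_def)
    have "i \<in> fst ` ?B" using ij by force
    then have le: "i \<le> Max (fst ` ?B)" by simp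
    have fin: "finite (bottom_row ?B)" unfolding bottom_row_def by simp
    have "Max (fst ` ?B) \<in> fst ` ?B" using ij by (intro Max_in) auto
    then obtain x where x: "x \<in> ?B" "Max (fst ` ?B) = fst x" by (rule imageE)
    have "(fst x, snd x) \<in> diagram (be, bm)" using x(1) by (simp add: beta)
    then obtain k c where kc: "fst x = int k" "snd x = int c" "part bm k < c" "c \<le> part be k"
      unfolding diagram_iff by (elim exE conjE)
    have "(i, j) \<in> diagram (be, bm)" using ij by (simp add: beta)
    then obtain k' c' where kc': "i = int k'" "j = int c'" "part bm k' < c'" "c' \<le> part be k'"
      unfolding diagram_iff by (elim exE conjE)
    have "1 \<le> k'" using kc'(3,4) by (cases k') auto
    then have "part bm k \<le> part bm k'" using part_antimono[OF bm, of k' k] le x(2) kc(1) kc'(1) by simp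
    \<comment> \<open>The first box of the bottom row; since the parts of \<open>bm\<close>
      decrease, no row above starts further to the left.\<close>
    have "(int k, int (Suc (part bm k))) \<in> ?B" unfolding beta diagram_int_iff using kc(3,4) by simp
    then have "(int k, int (Suc (part bm k))) \<in> bottom_row ?B" using x(2) kc(1) by (simp add: bottom_row_def)
    then have "int (Suc (part bm k)) \<in> snd ` bottom_row ?B" by force
    then have "Min (snd ` bottom_row ?B) \<le> int (Suc (part bm k))" using fin by (intro Min_le) auto
    also have "\<dots> \<le> j" using kc'(2,3) \<open>part bm k \<le> part bm k'\<close> by simp
    finally show "i \<le> Max (fst ` ?B) \<and> Min (snd ` bottom_row ?B) \<le> j" using le by simp
  }
qed

lemma host_diagram:
  assumes skew: "is_skew (lam, mu)"
    and left: "diagram alpha \<noteq> {} \<Longrightarrow> 1 \<le> l0" "\<And>k. k < l0 \<Longrightarrow> (int (length lam) - int k, 1) \<in> diagram (lam, mu)"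
    and right: "diagram beta \<noteq> {} \<Longrightarrow> 1 \<le> l1" "\<And>k. k < l1 \<Longrightarrow> (1, int (part lam 1) - int k) \<in> diagram (lam, mu)"
  shows "host (diagram (lam, mu)) (int (length lam)) (int (part lam 1))"
proof -
  let ?D = "diagram (lam, mu)"
  have lam: "is_partition lam" and mu: "is_partition mu" using skew by (simp_all add: is_skew_def)
  have pos: "1 \<le> i \<and> 1 \<le> j" if "(i, j) \<in> ?D" for i j
    using diagram_fst_pos[OF that] diagram_snd_pos[OF that] by simp
  have bounds: "i \<le> int (length lam) \<and> j \<le> int (part lam 1)" if ij: "(i, j) \<in> ?D" for i j
  proof -
    obtain k c where kc: "i = int k" "j = int c" "part mu k < c" "c \<le> part lam k"
      using ij unfolding diagram_iff by (elim exE conjE)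
    have k: "1 \<le> k" using kc(3,4) by (cases k) auto
    then have "k \<le> length lam" using part_pos[OF lam k] kc(3,4) by simp
    moreover have "part lam k \<le> part lam 1" by (rule part_antimono[OF lam _ k]) simp
    ultimately show ?thesis using kc by simp
  qed
  have A: "left_shift (diagram alpha) l0 ?D =
      (int (length lam) - int l0 + 1 - Min (fst ` right_column (diagram alpha)), - Max (snd ` diagram alpha))"
    if "diagram alpha \<noteq> {}"
  proof -
    have h: "(int (length lam), 1) \<in> ?D" using left(2)[of 0] left(1)[OF that] by simp
    have "Min (snd ` ?D) = 1"
    proof (rule Min_eqI)
      show "1 \<in> snd ` ?D" using h by force
      fix y assume "y \<in> snd ` ?D" then show "1 \<le> y" using diagram_snd_pos by (auto simp del: diagram_int_iff)
    qed simp
    moreover have "Max (fst ` left_column ?D) = int (length lam)"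
    proof (rule Max_eqI)
      show "finite (fst ` left_column ?D)" by (simp add: left_column_def)
      have "(int (length lam), 1) \<in> left_column ?D" using h calculation by (simp add: left_column_def)
      then show "int (length lam) \<in> fst ` left_column ?D" by force
      fix y assume "y \<in> fst ` left_column ?D"
      then obtain x where "x \<in> left_column ?D" "y = fst x" by blast
      then have xD: "x \<in> ?D" and y: "y = fst x" by (simp_all add: left_column_def)
      from xD have "(fst x, snd x) \<in> ?D" by (simp only: prod.collapse)
      then show "y \<le> int (length lam)" using bounds y by blast
    qed
    ultimately show ?thesis by (simp add: left_shift_def)
  qed
  have B: "right_shift ?D l1 (diagram beta) =
      (- Max (fst ` diagram beta), int (part lam 1) - int l1 + 1 - Min (snd ` bottom_row (diagram beta)))"
    if "diagram beta \<noteq> {}"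
  proof -
    have w: "(1, int (part lam 1)) \<in> ?D" using right(2)[of 0] right(1)[OF that] by simp
    have "Min (fst ` ?D) = 1"
    proof (rule Min_eqI)
      show "1 \<in> fst ` ?D" using w by force
      fix y assume "y \<in> fst ` ?D" then show "1 \<le> y" using diagram_fst_pos by (auto simp del: diagram_int_iff)
    qed simp
    moreover have "Max (snd ` top_row ?D) = int (part lam 1)"
    proof (rule Max_eqI)
      show "finite (snd ` top_row ?D)" by (simp add: top_row_def)
      have "(1, int (part lam 1)) \<in> top_row ?D" using w calculation by (simp add: top_row_def)
      then show "int (part lam 1) \<in> snd ` top_row ?D" by force
      fix y assume "y \<in> snd ` top_row ?D"
      then obtain x where "x \<in> top_row ?D" "y = snd x" by blast
      then have xD: "x \<in> ?D" and y: "y = snd x" by (simp_all add: top_row_def)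
      from xD have "(fst x, snd x) \<in> ?D" by (simp only: prod.collapse)
      then show "y \<le> int (part lam 1)" using bounds y by blast
    qed
    ultimately show ?thesis by (simp add: right_shift_def)
  qed
  show ?thesis
    unfolding host_def using finite_diagram pos bounds left right A B by blast
qed

text \<open>\<open>infsum\<close> takes a default value on divergent families, so the zeta value is
  recorded as \<open>has_sum\<close>, with convergence included. A corner of the pasted diagram in
  the middle piece is a corner of that piece, since pasting only adds boxes.\<close>

lemma has_sum_schur_zeta_paste:
  fixes a b v :: "box \<Rightarrow> complex"
  assumes host: "host H h w"
    and v: "\<And>x. x \<in> H \<Longrightarrow> 1 \<le> Re (v x)" "\<And>x. x \<in> corners H \<Longrightarrow> 1 < Re (v x)"
    and a: "\<And>x. x \<in> diagram alpha \<Longrightarrow> 1 \<le> Re (a x)"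
      "\<And>x. x \<in> diagram alpha \<Longrightarrow> left_shift (diagram alpha) l0 H + x \<in> corners (paste (diagram alpha) l0 H l1 (diagram beta)) \<Longrightarrow> 1 < Re (a x)"
    and b: "\<And>x. x \<in> diagram beta \<Longrightarrow> 1 \<le> Re (b x)"
      "\<And>x. x \<in> diagram beta \<Longrightarrow> right_shift H l1 (diagram beta) + x \<in> corners (paste (diagram alpha) l0 H l1 (diagram beta)) \<Longrightarrow> 1 < Re (b x)"
  shows "((\<lambda>(P, L, Q). (\<Prod>x\<in>diagram alpha. of_nat (P x) powr (- a x)) * (\<Prod>x\<in>H. of_nat (L x) powr (- v x)) *
      (\<Prod>x\<in>diagram beta. of_nat (Q x) powr (- b x))) has_sum
    schur_zeta (paste (diagram alpha) l0 H l1 (diagram beta))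
      (paste_filling (diagram alpha) a l0 H v l1 (diagram beta) b)) (triples H h w)"
proof -
  let ?A = "diagram alpha" and ?B = "diagram beta"
  let ?D = "paste ?A l0 H l1 ?B" and ?s = "paste_filling ?A a l0 H v l1 ?B b"
  have cases: "x \<in> H \<or> (\<exists>y\<in>?A. x = left_shift ?A l0 H + y) \<or> (\<exists>y\<in>?B. x = right_shift H l1 ?B + y)" if "x \<in> ?D" for x
    using that by (auto simp: paste_def)
  have sH: "?s x = v x" if "x \<in> H" for x
  proof -
    have "(fst x, snd x) \<in> H" using that by simp
    from filling_H[OF host this, of a v b] show ?thesis by simp
  qed
  note sA = filling_shift_A[OF host, of _ a v b] and sB = filling_shift_B[OF host, of _ a v b]
  have ge: "1 \<le> Re (?s x)" if "x \<in> ?D" for x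
    using cases[OF that]
  proof (elim disjE bexE)
    assume "x \<in> H" then show ?thesis using sH v(1) by simp
  next
    fix y assume "y \<in> ?A" "x = left_shift ?A l0 H + y" then show ?thesis using sA a(1) by simp
  next
    fix y assume "y \<in> ?B" "x = right_shift H l1 ?B + y" then show ?thesis using sB b(1) by simp
  qed
  have gt: "1 < Re (?s x)" if x: "x \<in> corners ?D" for x
  proof -
    have "x \<in> ?D" using x by (auto simp: corners_def)
    from cases[OF this] show ?thesis
    proof (elim disjE bexE)
      assume xH: "x \<in> H"
      have "H \<subseteq> ?D" by (auto simp: paste_def)
      then have "x \<in> corners H" using x xH by (auto simp: corners_def)
      then show ?thesis using sH[OF xH] v(2) by simp
    next
      fix y assume "y \<in> ?A" "x = left_shift ?A l0 H + y" then show ?thesis using sA a(2)[of y] x by simp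
    next
      fix y assume "y \<in> ?B" "x = right_shift H l1 ?B + y" then show ?thesis using sB b(2)[of y] x by simp
    qed
  qed
  have "(\<lambda>M. \<Prod>x\<in>?D. of_nat (M x) powr (- ?s x)) summable_on SSYT ?D {1::nat..}"
    by (rule schur_zeta_summable[OF finite_paste[OF host] ge gt])
  then have "((\<lambda>M. \<Prod>x\<in>?D. of_nat (M x) powr (- ?s x)) has_sum schur_zeta ?D ?s) (SSYT ?D {1::nat..})"
    unfolding schur_zeta_def by (rule has_sum_infsum)
  then have "((\<lambda>p. \<Prod>x\<in>?D. of_nat ((case p of (P, L, Q) \<Rightarrow> paste_filling ?A P l0 H L l1 ?B Q) x) powr (- ?s x))
      has_sum schur_zeta ?D ?s) (triples H h w)"
    by (subst has_sum_reindex_bij_betw[OF bij_betw_paste_filling[OF host]])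
  moreover have "(\<Prod>x\<in>?D. of_nat ((case p of (P, L, Q) \<Rightarrow> paste_filling ?A P l0 H L l1 ?B Q) x) powr (- ?s x)) =
      (case p of (P, L, Q) \<Rightarrow> (\<Prod>x\<in>?A. of_nat (P x) powr (- a x)) * (\<Prod>x\<in>H. of_nat (L x) powr (- v x)) *
      (\<Prod>x\<in>?B. of_nat (Q x) powr (- b x)))" for p :: "(box \<Rightarrow> nat) \<times> (box \<Rightarrow> nat) \<times> (box \<Rightarrow> nat)"
    using prod_paste[OF host, where f = "\<lambda>n s. of_nat n powr (- s) :: complex"] by (cases p) simp
  ultimately show ?thesis by (simp only:)
qed

end

section \<open>The symmetrized weights\<close>

text \<open>For two tableaux with rectifications of the same shape, the permutation \<open>tau\<close> compares the two
  bijections onto the rectified shape. It fixes the arms, so it is absorbed by the symmetrization.\<close>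

lemma sym_weight_rectified:
  fixes v :: "box \<Rightarrow> complex" and L L0 :: "box \<Rightarrow> nat"
  assumes skew: "is_skew (lam, mu)"
    and L: "L \<in> SSYT (diagram (lam, mu)) {1..}" "Rect (diagram (lam, mu)) L = (nu, R)"
    and L0: "L0 \<in> SSYT (diagram (lam, mu)) {1..}" "fst (Rect (diagram (lam, mu)) L0) = nu"
  shows "(\<Sum>\<sigma> | \<sigma> permutes body (lam, mu). \<Prod>x\<in>diagram (lam, mu). of_nat (L x) powr (- v (\<sigma> x))) =
    (\<Sum>\<sigma> | \<sigma> permutes body (lam, mu).
      \<Prod>y\<in>young nu. of_nat (R y) powr (- rearrange (diagram (lam, mu)) L0 (v \<circ> \<sigma>) y))"
proof -
  let ?D = "diagram (lam, mu)" and ?Y = "young nu" and ?B = "body (lam, mu)"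
  obtain R0 where R0: "Rect ?D L0 = (nu, R0)" using L0(2) by (metis prod.collapse)
  define r where "r = rho ?D L"
  define r0 where "r0 = rho ?D L0"
  have br: "bij_betw r ?D ?Y" unfolding r_def by (rule rho_bij[OF skew L])
  have br0: "bij_betw r0 ?D ?Y" unfolding r0_def by (rule rho_bij[OF skew L0(1) R0])
  define tau where "tau x = (if x \<in> ?D then inv_into ?D r0 (r x) else x)" for x
  have r0_tau: "r0 (tau x) = r x" if "x \<in> ?D" for x
    using that bij_betwE[OF br] bij_betw_inv_into_right[OF br0] by (simp add: tau_def)
  have "bij_betw (inv_into ?D r0 \<circ> r) ?D ?D"
    by (rule bij_betw_trans[OF br bij_betw_inv_into[OF br0]])
  then have "bij_betw tau ?D ?D"
    by (subst bij_betw_cong[of ?D tau "inv_into ?D r0 \<circ> r"]) (simp_all add: tau_def)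
  then have tauD: "tau permutes ?D" by (rule bij_imp_permutes) (simp add: tau_def)
  have "tau permutes ?B"
  proof (rule permutes_superset[OF tauD])
    fix x
    assume x: "x \<in> ?D - ?B"
    \<comment> \<open>Outside the body both bijections act on the arms by a translation that depends
      on the shapes alone.\<close>
    have "r x = r0 x"
    proof (cases "x \<in> right_arm (lam, mu)")
      case True
      obtain i j where ij: "x = (i, j)" by fastforce
      then have "i = 1" using True right_arm_iff[of i j lam mu] by simp
      then show ?thesis
        using rho_right_arm[OF skew L, of j] rho_right_arm[OF skew L0(1) R0, of j] True ij
        by (simp add: r_def r0_def)
    next
      case False
      then have la: "x \<in> left_arm (lam, mu)" using x by (auto simp: body_def)
      obtain i j where ij: "x = (i, j)" by fastforce
      have "is_partition lam" "is_partition mu" using skew by (simp_all add: is_skew_def)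
      then have "j = 1" using la ij left_arm_iff[of mu lam i j] by simp
      then show ?thesis
        using rho_left_arm[OF skew L, of i] rho_left_arm[OF skew L0(1) R0, of i] la ij
        by (simp add: r_def r0_def)
    qed
    then show "tau x = x" using x bij_betw_inv_into_left[OF br0, of x] by (simp add: tau_def)
  qed
  then have inv_tau: "inv tau permutes ?B" by (rule permutes_inv)
  define g where "g \<sigma> = (\<Prod>x\<in>?D. of_nat (R (r0 x)) powr (- v (\<sigma> x)))" for \<sigma>
  have 1: "(\<Prod>y\<in>?Y. of_nat (R y) powr (- rearrange ?D L0 (v \<circ> \<sigma>) y)) = g \<sigma>" for \<sigma>
  proof -
    have "(\<Prod>y\<in>?Y. of_nat (R y) powr (- rearrange ?D L0 (v \<circ> \<sigma>) y)) =
        (\<Prod>x\<in>?D. of_nat (R (r0 x)) powr (- rearrange ?D L0 (v \<circ> \<sigma>) (r0 x)))"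
      by (rule prod.reindex_bij_betw[OF br0, symmetric])
    also have "\<dots> = g \<sigma>"
      unfolding g_def
    proof (rule prod.cong[OF refl])
      fix x
      assume x: "x \<in> ?D"
      have "r0 x \<in> young (fst (Rect ?D L0))" using bij_betwE[OF br0] x L0(2) by simp
      then have "rearrange ?D L0 (v \<circ> \<sigma>) (r0 x) = v (\<sigma> x)"
        using bij_betw_inv_into_left[OF br0 x] by (simp add: rearrange_def r0_def)
      then show "of_nat (R (r0 x)) powr (- rearrange ?D L0 (v \<circ> \<sigma>) (r0 x)) = (of_nat (R (r0 x)) powr (- v (\<sigma> x)) :: complex)"
        by simp
    qed
    finally show ?thesis .
  qed
  \<comment> \<open>On the diagram, \<open>L\<close> equals \<open>R\<close> composed with
    \<open>r0\<close> and \<open>tau\<close>; moving \<open>tau\<close> to the exponents replaces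
    the permutation by its product with \<open>inv tau\<close>, which runs through the same
    group.\<close>
  have 2: "(\<Prod>x\<in>?D. of_nat (L x) powr (- v (\<sigma> x))) = g (\<sigma> \<circ> inv tau)" for \<sigma>
  proof -
    have "(\<Prod>x\<in>?D. of_nat (L x) powr (- v (\<sigma> x))) =
        (\<Prod>x\<in>?D. of_nat (R (r0 (tau x))) powr (- v ((\<sigma> \<circ> inv tau) (tau x))) :: complex)"
    proof (rule prod.cong[OF refl])
      fix x
      assume x: "x \<in> ?D"
      have "R (r0 (tau x)) = L x" using Rect_rho[OF skew L x] r0_tau[OF x] by (simp add: r_def)
      then show "of_nat (L x) powr (- v (\<sigma> x)) =
          (of_nat (R (r0 (tau x))) powr (- v ((\<sigma> \<circ> inv tau) (tau x))) :: complex)"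
        by (simp add: permutes_inverses(2)[OF tauD])
    qed
    also have "\<dots> = g (\<sigma> \<circ> inv tau)"
      unfolding g_def by (rule prod.reindex_bij_betw[OF permutes_imp_bij[OF tauD]])
    finally show ?thesis .
  qed
  have "(\<Sum>\<sigma> | \<sigma> permutes ?B. g (\<sigma> \<circ> inv tau)) = (\<Sum>\<sigma> | \<sigma> permutes ?B. g \<sigma>)"
    by (rule sum_permutations_compose_right[OF inv_tau, symmetric])
  then show ?thesis unfolding 1 2 .
qed

section \<open>The symmetrized identity\<close>

lemma has_sum_sum_finite:
  assumes "finite S" "\<And>s. s \<in> S \<Longrightarrow> (f s has_sum X s) T"
  shows "((\<lambda>t. \<Sum>s\<in>S. f s t :: complex) has_sum (\<Sum>s\<in>S. X s)) T"
  using assms by (induction S rule: finite_induct) (auto intro!: has_sum_add)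

lemma (in pasting) compatible_cong:
  assumes "\<And>k. k < l0 \<Longrightarrow> cl k = cl' k" "\<And>k. k < l1 \<Longrightarrow> cr k = cr' k"
  shows "compatible P Q cl cr \<longleftrightarrow> compatible P Q cl' cr'"
  unfolding compatible_def
  by (intro arg_cong2[of _ _ _ _ "(\<and>)"] all_cong1 imp_cong refl) (simp_all add: assms)

text \<open>The arm is a run of boxes ending at the foot of the first column; if the box
  \<open>k\<close> places above the foot were outside it, the arm would have at most
  \<open>k\<close> boxes.\<close>

lemma left_arm_tail:
  assumes skew: "is_skew (lam, mu)" and "l0 \<le> card (left_arm (lam, mu))" "k < l0"
  shows "(int (length lam) - int k, 1) \<in> left_arm (lam, mu)"
proof (rule ccontr)
  have part: "is_partition lam" "is_partition mu" using skew by (simp_all add: is_skew_def)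
  note la = left_arm_iff[OF part(2,1)] and col = diagram_column_1_iff[OF part]
  assume no: "(int (length lam) - int k, 1) \<notin> left_arm (lam, mu)"
  have "left_arm (lam, mu) \<subseteq> (\<lambda>i. (i, 1)) ` {int (length lam) - int k<..int (length lam)}"
  proof
    fix x
    assume x: "x \<in> left_arm (lam, mu)"
    obtain i j where ij: "x = (i, j)" by fastforce
    have j: "j = 1" and i: "(i, 1) \<in> diagram (lam, mu)"
      "int (arm_bound (conjugate_skew (lam, mu)) + length mu) \<le> i" "i \<le> int (length lam)"
      using x la[of i j] ij by auto
    have "int (length lam) - int k < i"
    proof (rule ccontr)
      assume "\<not> ?thesis"
      then have "(int (length lam) - int k, 1) \<in> left_arm (lam, mu)"
        unfolding la using i col[of i] col[of "int (length lam) - int k"] by simp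
      then show False using no by simp
    qed
    then show "x \<in> (\<lambda>i. (i, 1)) ` {int (length lam) - int k<..int (length lam)}" using ij j i(3) by simp
  qed
  then have "card (left_arm (lam, mu)) \<le> card ((\<lambda>i. (i, 1 :: int)) ` {int (length lam) - int k<..int (length lam)})"
    by (rule card_mono[rotated]) simp
  also have "\<dots> \<le> card {int (length lam) - int k<..int (length lam)}" by (rule card_image_le) simp
  also have "\<dots> = k" by simp
  finally show False using assms(2,3) by simp
qed

lemma right_arm_tail:
  assumes "l1 \<le> card (right_arm (lam, mu))" "k < l1"
  shows "(1, int (part lam 1) - int k) \<in> right_arm (lam, mu)"
proof (rule ccontr)
  note ra = right_arm_iff[of _ _ lam mu] and row = diagram_row_1_iff[of _ lam mu]
  assume no: "(1, int (part lam 1) - int k) \<notin> right_arm (lam, mu)"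
  have "right_arm (lam, mu) \<subseteq> (\<lambda>j. (1, j)) ` {int (part lam 1) - int k<..int (part lam 1)}"
  proof
    fix x
    assume x: "x \<in> right_arm (lam, mu)"
    obtain i j where ij: "x = (i, j)" by fastforce
    have i: "i = 1" and j: "(1, j) \<in> diagram (lam, mu)"
      "int (arm_bound (lam, mu) + part mu 1) \<le> j" "j \<le> int (part lam 1)"
      using x ra[of i j] ij by auto
    have "int (part lam 1) - int k < j"
    proof (rule ccontr)
      assume "\<not> ?thesis"
      then have "(1, int (part lam 1) - int k) \<in> right_arm (lam, mu)"
        unfolding ra using j row[of j] row[of "int (part lam 1) - int k"] by simp
      then show False using no by simp
    qed
    then show "x \<in> (\<lambda>j. (1, j)) ` {int (part lam 1) - int k<..int (part lam 1)}" using ij i j(3) by simp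
  qed
  then have "card (right_arm (lam, mu)) \<le> card ((\<lambda>j. (1 :: int, j)) ` {int (part lam 1) - int k<..int (part lam 1)})"
    by (rule card_mono[rotated]) simp
  also have "\<dots> \<le> card {int (part lam 1) - int k<..int (part lam 1)}" by (rule card_image_le) simp
  also have "\<dots> = k" by simp
  finally show False using assms by simp
qed

theorem theorem4p3:
  fixes lam mu :: "nat list" and alpha beta :: skew and l0 l1 :: nat
    and v a b :: "box \<Rightarrow> complex"
    and u :: "nat list \<Rightarrow> (box \<Rightarrow> complex) \<Rightarrow> box \<Rightarrow> complex"
  assumes "is_skew (lam, mu)" and "is_skew alpha" and "is_skew beta"
    and "if diagram alpha = {} then l0 = 0
         else 1 \<le> l0 \<and> l0 \<le> card (right_column (diagram alpha))"
    and "if diagram beta = {} then l1 = 0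
         else 1 \<le> l1 \<and> l1 \<le> card (bottom_row (diagram beta))"
    and "l0 \<le> card (left_arm (lam, mu))" and "l1 \<le> card (right_arm (lam, mu))"
    and "v \<in> diagram (lam, mu) \<rightarrow>\<^sub>E UNIV"
    and "a \<in> diagram alpha \<rightarrow>\<^sub>E UNIV" and "b \<in> diagram beta \<rightarrow>\<^sub>E UNIV"
    and "\<And>i j. (i, j) \<in> diagram (lam, mu) \<Longrightarrow>
           if i = 1 \<and> int (arm_bound (lam, mu) + part mu 1) \<le> j \<and> j \<le> int (part lam 1) - 1
            \<or> j = 1 \<and> int (arm_bound (conjugate_skew (lam, mu)) + part (conjugate mu) 1) \<le> i
                    \<and> i \<le> int (part (conjugate lam) 1) - 1
           then Re (v (i, j)) \<ge> 1 else Re (v (i, j)) > 1"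
    and "\<And>x. x \<in> diagram alpha \<Longrightarrow>
           if left_shift (diagram alpha) l0 (diagram (lam, mu)) + x
              \<in> corners (paste (diagram alpha) l0 (diagram (lam, mu)) l1 (diagram beta))
           then Re (a x) > 1 else Re (a x) \<ge> 1"
    and "\<And>x. x \<in> diagram beta \<Longrightarrow>
           if right_shift (diagram (lam, mu)) l1 (diagram beta) + x
              \<in> corners (paste (diagram alpha) l0 (diagram (lam, mu)) l1 (diagram beta))
           then Re (b x) > 1 else Re (b x) \<ge> 1"
    and "\<And>nu. nu \<in> lr_set (lam, mu) \<Longrightarrow> u nu \<in> U (lam, mu) nu"
  shows "sym_sum (body (lam, mu))
           (\<lambda>v. schur_zeta (paste (diagram alpha) l0 (diagram (lam, mu)) l1 (diagram beta))
                 (paste_filling (diagram alpha) a l0 (diagram (lam, mu)) v l1 (diagram beta) b)) v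
       = sym_sum (body (lam, mu))
           (\<lambda>v. \<Sum>nu\<in>lr_set (lam, mu). of_int (lr_coeff mu nu lam) *
                 schur_zeta (paste (diagram alpha) l0 (diagram (nu, [])) l1 (diagram beta))
                   (paste_filling (diagram alpha) a l0 (diagram (nu, [])) (u nu v) l1 (diagram beta) b)) v"
proof -
  let ?A = "diagram alpha" and ?B = "diagram beta" and ?D = "diagram (lam, mu)" and ?body = "body (lam, mu)"
  let ?h = "int (length lam)" and ?w = "int (part lam 1)"
  interpret skew_pasting alpha beta l0 l1
    by unfold_locales (rule assms)+
  note skew = assms(1)
  have lam: "is_partition lam" and mu: "is_partition mu" using skew by (simp_all add: is_skew_def)
  have l0: "1 \<le> l0" if "?A \<noteq> {}" using assms(4) that by simp
  have l1: "1 \<le> l1" if "?B \<noteq> {}" using assms(5) that by simp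
  have la: "(?h - int k, 1) \<in> left_arm (lam, mu)" if "k < l0" for k
    by (rule left_arm_tail[OF skew assms(6) that])
  have ra: "(1, ?w - int k) \<in> right_arm (lam, mu)" if "k < l1" for k
    by (rule right_arm_tail[OF assms(7) that])
  have laD: "(?h - int k, 1) \<in> ?D" if "k < l0" for k using left_arm_iff[OF mu lam] la[OF that] by blast
  have raD: "(1, ?w - int k) \<in> ?D" if "k < l1" for k using right_arm_iff ra[OF that] by blast
  have hostD: "host ?D ?h ?w"
    by (rule host_diagram[OF skew l0 laD l1 raD])

  \<comment> \<open>Arm boxes that are followed by another arm box: the only ones whose variable may
    have real part 1. They lie outside the body, so no permutation moves them, and the next arm box
    prevents them from being corners, in the original shape as well as after rectification.\<close>
  define inarm where "inarm x \<longleftrightarrow> (\<exists>j. x = (1, j) \<and> x \<in> right_arm (lam, mu) \<and> (1, j + 1) \<in> right_arm (lam, mu)) \<or>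
    (\<exists>i. x = (i, 1) \<and> x \<in> left_arm (lam, mu) \<and> (i + 1, 1) \<in> left_arm (lam, mu))" for x
  have Re_v: "1 \<le> Re (v x) \<and> (1 < Re (v x) \<or> inarm x)" if x: "x \<in> ?D" for x
  proof -
    obtain i j where ij: "x = (i, j)" by fastforce
    have xD: "(i, j) \<in> ?D" using x ij by simp
    note re = assms(11)[OF xD]
    define C1 where "C1 \<longleftrightarrow> i = 1 \<and> int (arm_bound (lam, mu) + part mu 1) \<le> j \<and> j \<le> int (part lam 1) - 1"
    define C2 where "C2 \<longleftrightarrow> j = 1 \<and> int (arm_bound (conjugate_skew (lam, mu)) + part (conjugate mu) 1) \<le> i
                    \<and> i \<le> int (part (conjugate lam) 1) - 1"
    have re': "if C1 \<or> C2 then Re (v (i, j)) \<ge> 1 else Re (v (i, j)) > 1"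
      using re unfolding C1_def C2_def .
    have "inarm x" if C1
    proof -
      have i: "i = 1" and j: "int (arm_bound (lam, mu) + part mu 1) \<le> j" "j \<le> ?w - 1" using that by (simp_all add: C1_def)
      have "(1, j) \<in> right_arm (lam, mu)" unfolding right_arm_iff using xD i j by simp
      moreover have "(1, j + 1) \<in> right_arm (lam, mu)"
        unfolding right_arm_iff diagram_row_1_iff using xD i j diagram_row_1_iff[of j lam mu] by simp
      ultimately show ?thesis using ij i by (simp add: inarm_def)
    qed
    moreover have "inarm x" if C2
    proof -
      have j: "j = 1" and i: "int (arm_bound (conjugate_skew (lam, mu)) + length mu) \<le> i" "i \<le> ?h - 1"
        using that part_conjugate_1[OF mu] part_conjugate_1[OF lam] by (simp_all add: C2_def)
      have "(i, 1) \<in> left_arm (lam, mu)" unfolding left_arm_iff[OF mu lam] using xD i j by simp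
      moreover have "(i + 1, 1) \<in> left_arm (lam, mu)"
        unfolding left_arm_iff[OF mu lam] diagram_column_1_iff[OF lam mu]
        using xD i j diagram_column_1_iff[OF lam mu, of i] by simp
      ultimately show ?thesis using ij j by (simp add: inarm_def)
    qed
    ultimately show ?thesis using re' ij by (auto split: if_splits)
  qed
  have inarm_body: "x \<notin> ?body" if "inarm x" for x
    using that by (auto simp: inarm_def body_def)
  have Re_perm: "1 \<le> Re (v (\<sigma> x)) \<and> (1 < Re (v (\<sigma> x)) \<or> inarm x)"
    if \<sigma>: "\<sigma> permutes ?body" and x: "x \<in> ?D" for \<sigma> x
  proof (cases "x \<in> ?body")
    case True
    then have "\<sigma> x \<in> ?body" using permutes_in_image[OF \<sigma>] by simp
    moreover from this have "\<sigma> x \<in> ?D" by (simp add: body_def)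
    ultimately show ?thesis using Re_v[of "\<sigma> x"] inarm_body[of "\<sigma> x"] by blast
  next
    case False
    then show ?thesis using Re_v[OF x] permutes_not_in[OF \<sigma> False] by simp
  qed
  have inarm_not_corner: "x \<notin> corners ?D" if "inarm x" for x
    using that left_arm_iff[OF mu lam] right_arm_iff[of _ _ lam mu] unfolding inarm_def corners_def by fastforce

  define PA where "PA P = (\<Prod>x\<in>?A. of_nat (P x) powr (- a x))" for P :: "box \<Rightarrow> nat"
  define PB where "PB Q = (\<Prod>x\<in>?B. of_nat (Q x) powr (- b x))" for Q :: "box \<Rightarrow> nat"
  \<comment> \<open>The finite symmetrization is carried out for each tableau separately. The
    symmetrized weight depends on \<open>L\<close> only through its rectification, whereas the
    single weights do not.\<close>
  define W where "W L = (\<Sum>\<sigma> | \<sigma> permutes ?body. \<Prod>x\<in>?D. of_nat (L x) powr (- v (\<sigma> x)))" for L :: "box \<Rightarrow> nat"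
  define T where "T = triples ?D ?h ?w"
  define lhs where "lhs \<sigma> = schur_zeta (paste ?A l0 ?D l1 ?B) (paste_filling ?A a l0 ?D (v \<circ> \<sigma>) l1 ?B b)" for \<sigma>
  have finbody: "finite {\<sigma>. \<sigma> permutes ?body}"
    by (rule finite_permutations) (simp add: body_def)
  have a_ge: "1 \<le> Re (a x)" if "x \<in> ?A" for x
    using assms(12)[OF that] by (auto split: if_splits)
  have b_ge: "1 \<le> Re (b x)" if "x \<in> ?B" for x
    using assms(13)[OF that] by (auto split: if_splits)
  have a_gt: "1 < Re (a x)" if "x \<in> ?A" "left_shift ?A l0 ?D + x \<in> corners (paste ?A l0 ?D l1 ?B)" for x
    using assms(12)[OF that(1)] that(2) by simp
  have b_gt: "1 < Re (b x)" if "x \<in> ?B" "right_shift ?D l1 ?B + x \<in> corners (paste ?A l0 ?D l1 ?B)" for x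
    using assms(13)[OF that(1)] that(2) by simp
  have sum_lhs: "((\<lambda>(P, L, Q). PA P * W L * PB Q) has_sum (\<Sum>\<sigma> | \<sigma> permutes ?body. lhs \<sigma>)) T"
  proof -
    have "((\<lambda>(P, L, Q). PA P * (\<Prod>x\<in>?D. of_nat (L x) powr (- (v \<circ> \<sigma>) x)) * PB Q) has_sum lhs \<sigma>) T"
      if \<sigma>: "\<sigma> permutes ?body" for \<sigma>
      unfolding PA_def PB_def T_def lhs_def
    proof (rule has_sum_schur_zeta_paste[OF hostD _ _ a_ge a_gt b_ge b_gt])
      show "1 \<le> Re ((v \<circ> \<sigma>) x)" if "x \<in> ?D" for x using Re_perm[OF \<sigma> that] by simp
      show "1 < Re ((v \<circ> \<sigma>) x)" if c: "x \<in> corners ?D" for x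
      proof -
        have "x \<in> ?D" using c by (auto simp: corners_def)
        then show ?thesis using Re_perm[OF \<sigma>, of x] inarm_not_corner[of x] c by auto
      qed
    qed
    then have "((\<lambda>t. \<Sum>\<sigma> | \<sigma> permutes ?body. case t of (P, L, Q) \<Rightarrow> PA P * (\<Prod>x\<in>?D. of_nat (L x) powr (- (v \<circ> \<sigma>) x)) * PB Q)
        has_sum (\<Sum>\<sigma> | \<sigma> permutes ?body. lhs \<sigma>)) T"
      by (intro has_sum_sum_finite[OF finbody]) simp
    moreover have "(\<Sum>\<sigma> | \<sigma> permutes ?body. case t of (P, L, Q) \<Rightarrow> PA P * (\<Prod>x\<in>?D. of_nat (L x) powr (- (v \<circ> \<sigma>) x)) * PB Q) =
        (case t of (P, L, Q) \<Rightarrow> PA P * W L * PB Q)" for t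
      by (cases t) (simp add: W_def sum_distrib_left sum_distrib_right)
    ultimately show ?thesis by simp
  qed

  define good where "good nu L \<longleftrightarrow> L \<in> SSYT ?D {1..} \<and> fst (Rect ?D L) = nu \<and> u nu = rearrange ?D L" for nu L
  have "\<exists>L. good nu L" if "nu \<in> lr_set (lam, mu)" for nu
    using assms(14)[OF that] unfolding U_def good_def by auto
  then obtain L0 where "\<And>nu. nu \<in> lr_set (lam, mu) \<Longrightarrow> good nu (L0 nu)" by metis
  then have L0: "L0 nu \<in> SSYT ?D {1..}" "fst (Rect ?D (L0 nu)) = nu" "u nu = rearrange ?D (L0 nu)"
    if "nu \<in> lr_set (lam, mu)" for nu using that by (simp_all add: good_def)
  have nu_part: "is_partition nu" if "nu \<in> lr_set (lam, mu)" for nu using that by (simp add: lr_set_def)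
  define c where "c nu = nat (lr_coeff mu nu lam)" for nu
  have c: "of_int (lr_coeff mu nu lam) = (of_nat (c nu) :: complex)" if "nu \<in> lr_set (lam, mu)" for nu
    using that by (simp add: c_def lr_set_def)
  define TN where "TN nu = triples (young nu) (int (length nu)) (int (part nu 1))" for nu
  define WN where "WN nu R = (\<Sum>\<sigma> | \<sigma> permutes ?body. \<Prod>y\<in>young nu. of_nat (R y) powr (- u nu (v \<circ> \<sigma>) y))"
    for nu and R :: "box \<Rightarrow> nat"
  define rhs where "rhs nu \<sigma> = schur_zeta (paste ?A l0 (young nu) l1 ?B)
    (paste_filling ?A a l0 (young nu) (u nu (v \<circ> \<sigma>)) l1 ?B b)" for nu \<sigma>
  have sum_rhs: "((\<lambda>(P, R, Q). PA P * WN nu R * PB Q) has_sum (\<Sum>\<sigma> | \<sigma> permutes ?body. rhs nu \<sigma>)) (TN nu)"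
    if nu: "nu \<in> lr_set (lam, mu)" for nu
  proof -
    note L = L0[OF nu]
    obtain R0 where R0: "Rect ?D (L0 nu) = (nu, R0)" using L(2) by (metis prod.collapse)
    let ?r = "rho ?D (L0 nu)"
    have bij: "bij_betw ?r ?D (young nu)" by (rule rho_bij[OF skew L(1) R0])
    have rla: "?r (i, 1) = (i + int (length nu) - ?h, 1)" if "(i, 1) \<in> left_arm (lam, mu)" for i
      by (rule rho_left_arm[OF skew L(1) R0 that])
    have rra: "?r (1, j) = (1, j + int (part nu 1) - ?w)" if "(1, j) \<in> right_arm (lam, mu)" for j
      by (rule rho_right_arm[OF skew L(1) R0 that])
    have laY: "(i + int (length nu) - ?h, 1) \<in> young nu" if "(i, 1) \<in> left_arm (lam, mu)" for i
      using bij_betwE[OF bij] rla[OF that] that left_arm_iff[OF mu lam, of i 1] by metis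
    have raY: "(1, j + int (part nu 1) - ?w) \<in> young nu" if "(1, j) \<in> right_arm (lam, mu)" for j
      using bij_betwE[OF bij] rra[OF that] that right_arm_iff[of 1 j lam mu] by metis
    have hostN: "host (young nu) (int (length nu)) (int (part nu 1))"
    proof (rule host_diagram[OF is_skew_normal[OF nu_part[OF nu]], unfolded diagram_normal, OF l0 _ l1])
      show "(int (length nu) - int k, 1) \<in> young nu" if "k < l0" for k
        using laY[OF la[OF that]] by simp
      show "(1, int (part nu 1) - int k) \<in> young nu" if "k < l1" for k
        using raY[OF ra[OF that]] by simp
    qed
    have val: "u nu (v \<circ> \<sigma>) (?r x) = v (\<sigma> x)" if x: "x \<in> ?D" for x \<sigma>
    proof -
      have "?r x \<in> young (fst (Rect ?D (L0 nu)))" using bij_betwE[OF bij] x L(2) by simp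
      then show ?thesis using bij_betw_inv_into_left[OF bij x] by (simp add: L(3) rearrange_def)
    qed
    have not_corner: "?r x \<notin> corners (young nu)" if "inarm x" for x
      using that unfolding inarm_def
    proof (elim disjE exE conjE)
      fix j
      assume j: "x = (1, j)" "x \<in> right_arm (lam, mu)" "(1, j + 1) \<in> right_arm (lam, mu)"
      have "?r x = (1, j + int (part nu 1) - ?w)" using rra[of j] j by simp
      moreover have "(1, j + int (part nu 1) - ?w + 1) \<in> young nu" using raY[OF j(3)] by (simp add: algebra_simps)
      ultimately show ?thesis by (simp add: corners_def)
    next
      fix i
      assume i: "x = (i, 1)" "x \<in> left_arm (lam, mu)" "(i + 1, 1) \<in> left_arm (lam, mu)"
      have "?r x = (i + int (length nu) - ?h, 1)" using rla[of i] i by simp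
      moreover have "(i + int (length nu) - ?h + 1, 1) \<in> young nu" using laY[OF i(3)] by (simp add: algebra_simps)
      ultimately show ?thesis by (simp add: corners_def)
    qed
    have "((\<lambda>(P, R, Q). PA P * (\<Prod>y\<in>young nu. of_nat (R y) powr (- u nu (v \<circ> \<sigma>) y)) * PB Q) has_sum rhs nu \<sigma>) (TN nu)"
      if \<sigma>: "\<sigma> permutes ?body" for \<sigma>
      unfolding PA_def PB_def TN_def rhs_def
    proof (rule has_sum_schur_zeta_paste[OF hostN _ _ a_ge _ b_ge])
      have preimage: "\<exists>x\<in>?D. y = ?r x" if "y \<in> young nu" for y
        using bij that unfolding bij_betw_def by blast
      show "1 \<le> Re (u nu (v \<circ> \<sigma>) y)" if y: "y \<in> young nu" for y
      proof -
        obtain x where x: "x \<in> ?D" "y = ?r x" using preimage[OF y] by blast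
        show ?thesis using Re_perm[OF \<sigma> x(1)] val[OF x(1)] x(2) by simp
      qed
      show "1 < Re (u nu (v \<circ> \<sigma>) y)" if y: "y \<in> corners (young nu)" for y
      proof -
        have "y \<in> young nu" using y by (auto simp: corners_def)
        then obtain x where x: "x \<in> ?D" "y = ?r x" using preimage by blast
        show ?thesis using Re_perm[OF \<sigma> x(1)] val[OF x(1)] x(2) not_corner[of x] y by auto
      qed
      show "1 < Re (a x)" if "x \<in> ?A" "left_shift ?A l0 (young nu) + x \<in> corners (paste ?A l0 (young nu) l1 ?B)" for x
        by (rule a_gt[OF that(1) corner_A[OF hostD hostN that]])
      show "1 < Re (b x)" if "x \<in> ?B" "right_shift (young nu) l1 ?B + x \<in> corners (paste ?A l0 (young nu) l1 ?B)" for x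
        by (rule b_gt[OF that(1) corner_B[OF hostD hostN that]])
    qed
    then have "((\<lambda>t. \<Sum>\<sigma> | \<sigma> permutes ?body. case t of (P, R, Q) \<Rightarrow>
          PA P * (\<Prod>y\<in>young nu. of_nat (R y) powr (- u nu (v \<circ> \<sigma>) y)) * PB Q)
        has_sum (\<Sum>\<sigma> | \<sigma> permutes ?body. rhs nu \<sigma>)) (TN nu)"
      by (intro has_sum_sum_finite[OF finbody]) simp
    moreover have "(\<Sum>\<sigma> | \<sigma> permutes ?body. case t of (P, R, Q) \<Rightarrow>
          PA P * (\<Prod>y\<in>young nu. of_nat (R y) powr (- u nu (v \<circ> \<sigma>) y)) * PB Q) =
        (case t of (P, R, Q) \<Rightarrow> PA P * WN nu R * PB Q)" for t
      by (cases t) (simp add: WN_def sum_distrib_left sum_distrib_right)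
    ultimately show ?thesis by simp
  qed

  \<comment> \<open>The glued rows and columns end in the arms, whose entries rectification keeps at
    the same distance from the ends. So \<open>P\<close> and \<open>Q\<close> fit \<open>L\<close>
    exactly if they fit its rectification.\<close>
  have transfer: "(P, L, Q) \<in> T \<longleftrightarrow> (P, R, Q) \<in> TN nu"
    if L: "L \<in> SSYT ?D {1..}" "Rect ?D L = (nu, R)" for P L Q nu R
  proof -
    have R: "R \<in> SSYT (young nu) {1..}" by (rule Rect_positive(2)[OF skew L])
    have left: "R (int (length nu) - int k, 1) = L (?h - int k, 1)" if "k < l0" for k
      using Rect_rho[OF skew L laD[OF that]] rho_left_arm[OF skew L la[OF that]] by simp
    have right: "R (1, int (part nu 1) - int k) = L (1, ?w - int k)" if "k < l1" for k
      using Rect_rho[OF skew L raD[OF that]] rho_right_arm[OF skew L ra[OF that]] by simp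
    have "compatible P Q (\<lambda>k. L (?h - int k, 1)) (\<lambda>k. L (1, ?w - int k)) \<longleftrightarrow>
        compatible P Q (\<lambda>k. R (int (length nu) - int k, 1)) (\<lambda>k. R (1, int (part nu 1) - int k))"
      by (rule compatible_cong) (simp_all only: left right)
    then show ?thesis using L(1) R by (simp add: T_def TN_def triples_def)
  qed

  define Fib where "Fib nu R = {L \<in> SSYT ?D {1..}. Rect ?D L = (nu, R)}" for nu and R :: "box \<Rightarrow> nat"
  have "\<exists>e. bij_betw e {0..<c nu} (Fib nu R)" if "nu \<in> lr_set (lam, mu)" "R \<in> SSYT (young nu) {1..}" for nu R
    using card_Rect_fiber[OF skew nu_part[OF that(1)] that(2)] ex_bij_betw_nat_finite[of "Fib nu R"]
    by (simp add: Fib_def c_def)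
  then obtain en where en: "\<And>nu R. nu \<in> lr_set (lam, mu) \<Longrightarrow> R \<in> SSYT (young nu) {1..} \<Longrightarrow>
      bij_betw (en nu R) {0..<c nu} (Fib nu R)" by metis
  \<comment> \<open>The \<open>k\<close>-th embedding of the triples for \<open>nu\<close> into
    those for the skew shape: \<open>R\<close> is replaced by the \<open>k\<close>-th member of its
    fibre. The \<open>c nu\<close> disjoint copies for every \<open>nu\<close> exhaust
    \<open>T\<close>, and this is how the coefficients arise.\<close>
  define E where "E p t = (case t of (P, R, Q) \<Rightarrow> (P, en (fst p) R (snd p), Q))" for p :: "nat list \<times> nat" and t :: "(box \<Rightarrow> nat) \<times> (box \<Rightarrow> nat) \<times> (box \<Rightarrow> nat)"
  define I where "I = Sigma (lr_set (lam, mu)) (\<lambda>nu. {0..<c nu})"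
  have finI: "finite I" unfolding I_def using finite_lr_set[OF skew] by simp
  have TN_R: "R \<in> SSYT (young nu) {1..}" if "(P, R, Q) \<in> TN nu" for P R Q nu
    using that by (simp add: TN_def triples_def)
  have enF: "en nu R k \<in> SSYT ?D {1..} \<and> Rect ?D (en nu R k) = (nu, R)"
    if "(nu, k) \<in> I" "(P, R, Q) \<in> TN nu" for nu k P R Q
  proof -
    have "nu \<in> lr_set (lam, mu)" "k \<in> {0..<c nu}" using that(1) by (simp_all add: I_def)
    then have "en nu R k \<in> Fib nu R" using bij_betwE[OF en[OF _ TN_R[OF that(2)]]] by blast
    then show ?thesis by (simp add: Fib_def)
  qed
  have piece: "((\<lambda>(P, L, Q). PA P * W L * PB Q) has_sum (\<Sum>\<sigma> | \<sigma> permutes ?body. rhs (fst p) \<sigma>)) (E p ` TN (fst p))"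
    if p: "p \<in> I" for p
  proof -
    obtain nu k where pe: "p = (nu, k)" by (cases p)
    have I: "(nu, k) \<in> I" using p pe by simp
    then have nu: "nu \<in> lr_set (lam, mu)" by (simp add: I_def)
    have inj: "inj_on (E p) (TN nu)"
    proof (rule inj_onI)
      fix t t'
      assume t: "t \<in> TN nu" "t' \<in> TN nu" "E p t = E p t'"
      obtain P R Q where te: "t = (P, R, Q)" by (cases t)
      obtain P' R' Q' where te': "t' = (P', R', Q')" by (cases t')
      have eq: "P = P'" "en nu R k = en nu R' k" "Q = Q'" using t(3) by (simp_all add: E_def te te' pe)
      have "(nu, R) = (nu, R')"
        using enF[OF I t(1)[unfolded te]] enF[OF I t(2)[unfolded te']] eq(2) by metis
      then show "t = t'" using eq te te' by simp
    qed
    have "(case E p t of (P, L, Q) \<Rightarrow> PA P * W L * PB Q) = (case t of (P, R, Q) \<Rightarrow> PA P * WN nu R * PB Q)"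
      if t: "t \<in> TN nu" for t
    proof -
      obtain P R Q where te: "t = (P, R, Q)" by (cases t)
      note F = enF[OF I t[unfolded te]]
      \<comment> \<open>Here the symmetrization is essential: single weights on the two sides agree
        only up to a permutation of the body variables.\<close>
      have "W (en nu R k) = WN nu R"
        unfolding W_def WN_def L0(3)[OF nu]
        by (rule sym_weight_rectified[OF skew conjunct1[OF F] conjunct2[OF F] L0(1,2)[OF nu]])
      then show ?thesis by (simp add: E_def te pe)
    qed
    then have "((\<lambda>t. case E p t of (P, L, Q) \<Rightarrow> PA P * W L * PB Q) has_sum (\<Sum>\<sigma> | \<sigma> permutes ?body. rhs nu \<sigma>)) (TN nu)"
      using sum_rhs[OF nu] by (subst has_sum_cong) auto
    then have "((\<lambda>(P, L, Q). PA P * W L * PB Q) \<circ> E p has_sum (\<Sum>\<sigma> | \<sigma> permutes ?body. rhs nu \<sigma>)) (TN nu)"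
      by (simp only: comp_def)
    then have "((\<lambda>(P, L, Q). PA P * W L * PB Q) has_sum (\<Sum>\<sigma> | \<sigma> permutes ?body. rhs nu \<sigma>)) (E p ` TN nu)"
      by (rule has_sum_reindex[OF inj, THEN iffD2])
    then show ?thesis by (simp add: pe)
  qed
  have disjoint: "E p ` TN (fst p) \<inter> E q ` TN (fst q) = {}" if pq: "p \<in> I" "q \<in> I" "p \<noteq> q" for p q
  proof (rule equals0I)
    fix x
    assume "x \<in> E p ` TN (fst p) \<inter> E q ` TN (fst q)"
    then obtain t t' where t: "t \<in> TN (fst p)" "x = E p t" "t' \<in> TN (fst q)" "x = E q t'" by blast
    obtain nu k where pe: "p = (nu, k)" by (cases p)
    obtain nu' k' where qe: "q = (nu', k')" by (cases q)
    obtain P R Q where te: "t = (P, R, Q)" by (cases t)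
    obtain P' R' Q' where te': "t' = (P', R', Q')" by (cases t')
    have I: "(nu, k) \<in> I" "(nu', k') \<in> I" using pq pe qe by simp_all
    have tT: "(P, R, Q) \<in> TN nu" "(P', R', Q') \<in> TN nu'" using t te te' pe qe by simp_all
    have eq: "en nu R k = en nu' R' k'" using t(2,4) by (simp add: E_def te te' pe qe)
    have "(nu, R) = (nu', R')" using enF[OF I(1) tT(1)] enF[OF I(2) tT(2)] eq by metis
    then have nu: "nu' = nu" "R' = R" by simp_all
    have "k \<in> {0..<c nu}" "k' \<in> {0..<c nu}" "nu \<in> lr_set (lam, mu)" using I nu by (simp_all add: I_def)
    then have "k = k'"
      using en[OF _ TN_R[OF tT(1)]] eq nu unfolding bij_betw_def inj_on_def by blast
    then show False using pq(3) pe qe nu by simp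
  qed
  have cover: "T = (\<Union>p\<in>I. E p ` TN (fst p))"
  proof
    show "T \<subseteq> (\<Union>p\<in>I. E p ` TN (fst p))"
    proof
      fix t
      assume t: "t \<in> T"
      obtain P L Q where te: "t = (P, L, Q)" by (cases t)
      have L: "L \<in> SSYT ?D {1..}" using t te by (simp add: T_def triples_def)
      obtain nu R where R: "Rect ?D L = (nu, R)" by (cases "Rect ?D L")
      have nu: "nu \<in> lr_set (lam, mu)" by (rule Rect_shape_in_lr_set[OF skew L R])
      have tN: "(P, R, Q) \<in> TN nu" using transfer[OF L R] t te by simp
      have "L \<in> Fib nu R" using L R by (simp add: Fib_def)
      then have "L \<in> en nu R ` {0..<c nu}" using en[OF nu TN_R[OF tN]] unfolding bij_betw_def by blast
      then obtain k where k: "k \<in> {0..<c nu}" "L = en nu R k" by blast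
      have "(nu, k) \<in> I" using nu k(1) by (simp add: I_def)
      moreover have "t = E (nu, k) (P, R, Q)" by (simp add: E_def te k(2))
      ultimately show "t \<in> (\<Union>p\<in>I. E p ` TN (fst p))" using tN by (intro UN_I[of "(nu, k)"]) simp_all
    qed
    show "(\<Union>p\<in>I. E p ` TN (fst p)) \<subseteq> T"
    proof
      fix x
      assume "x \<in> (\<Union>p\<in>I. E p ` TN (fst p))"
      then obtain p t where p: "p \<in> I" "t \<in> TN (fst p)" "x = E p t" by blast
      obtain nu k where pe: "p = (nu, k)" by (cases p)
      obtain P R Q where te: "t = (P, R, Q)" by (cases t)
      have tT: "(P, R, Q) \<in> TN nu" and I: "(nu, k) \<in> I" using p pe te by simp_all
      note F = enF[OF I tT]
      have "(P, en nu R k, Q) \<in> T" using transfer[OF conjunct1[OF F] conjunct2[OF F]] tT by blast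
      then show "x \<in> T" by (simp add: p(3) E_def pe te)
    qed
  qed
  \<comment> \<open>Only finitely many pieces are joined, so their sums simply add up.\<close>
  have "((\<lambda>(P, L, Q). PA P * W L * PB Q) has_sum (\<Sum>p\<in>I. \<Sum>\<sigma> | \<sigma> permutes ?body. rhs (fst p) \<sigma>)) T"
    unfolding cover by (rule sum_has_sum[OF finI piece disjoint])
  then have "(\<Sum>\<sigma> | \<sigma> permutes ?body. lhs \<sigma>) = (\<Sum>p\<in>I. \<Sum>\<sigma> | \<sigma> permutes ?body. rhs (fst p) \<sigma>)"
    using sum_lhs infsumI by metis
  also have "\<dots> = (\<Sum>nu\<in>lr_set (lam, mu). \<Sum>k\<in>{0..<c nu}. \<Sum>\<sigma> | \<sigma> permutes ?body. rhs nu \<sigma>)"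
    unfolding I_def by (subst sum.Sigma[OF finite_lr_set[OF skew]]) (simp, simp only: split_def)
  also have "\<dots> = (\<Sum>nu\<in>lr_set (lam, mu). \<Sum>\<sigma> | \<sigma> permutes ?body. of_int (lr_coeff mu nu lam) * rhs nu \<sigma>)"
    by (intro sum.cong refl) (simp add: c sum_distrib_left)
  also have "\<dots> = (\<Sum>\<sigma> | \<sigma> permutes ?body. \<Sum>nu\<in>lr_set (lam, mu). of_int (lr_coeff mu nu lam) * rhs nu \<sigma>)"
    by (rule sum.swap)
  finally show ?thesis by (simp add: sym_sum_def lhs_def rhs_def)
qed

end
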